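(* Let $p \geq 2$ and let $2 \leq d_1 \leq d_2 \leq \cdots \leq d_p$ be integers such that $$d_p - 1 \;\geq\; \sum_{j=1}^{p-1}(d_j - 1) \;\geq\; 3,$$ and such that all of the following hold: (a) it is not the case that $p = 2$ and $\min(d_1,d_2) = 2$; (b) $f_N(d_1,\ldots,d_p)$ is odd; (c) at least one of $d_1,\ldots,d_p$ is even. Then $f_m(d_1,\ldots,d_p) = f_N(d_1,\ldots,d_p) + 1$.
   Context: A product vector in $\mathbb{C}^{d_1}\otimes\cdots\otimes\mathbb{C}^{d_p}$ is a nonzero vector of the form $v_1\otimes\cdots\otimes v_p$ with $v_j\in\mathbb{C}^{d_j}$. An unextendible product basis (UPB) is a set $S \subseteq \mathbb{C}^{d_1}\otimes\cdots\otimes\mathbb{C}^{d_p}$ of unit product vectors that are pairwise orthogonal and such that no product vector outside $S$ is orthogonal to every element of $S$. $f_m(d_1,\ldots,d_p)$ denotes the minimum cardinality of a UPB in $\mathbb{C}^{d_1}\otimes\cdots\otimes\mathbb{C}^{d_p}$, and $f_N(d_1,\ldots,d_p) := \sum_{j=1}^p (d_j - 1) + 1$. *)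

theory Defs
  imports Complex_Main "HOL-Library.FuncSet"
begin

text \<open>The space C^{d_0} (x) ... (x) C^{d_{p-1}} (0-based factors) is modelled as complex-valued
  functions on the multi-index set idx p d; a tensor is identified with its coefficient function
  (coefficients outside idx p d are irrelevant / set to zero for product tensors).\<close>

definition idx :: "nat \<Rightarrow> (nat \<Rightarrow> nat) \<Rightarrow> (nat \<Rightarrow> nat) set" where
  "idx p d = PiE {..<p} (\<lambda>j. {..<d j})"

definition prod_tensor :: "nat \<Rightarrow> (nat \<Rightarrow> nat) \<Rightarrow> (nat \<Rightarrow> nat \<Rightarrow> complex)
    \<Rightarrow> (nat \<Rightarrow> nat) \<Rightarrow> complex" where
  "prod_tensor p d v = (\<lambda>i. if i \<in> idx p d then (\<Prod>j<p. v j (i j)) else 0)"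

definition tinner :: "nat \<Rightarrow> (nat \<Rightarrow> nat) \<Rightarrow> ((nat \<Rightarrow> nat) \<Rightarrow> complex)
    \<Rightarrow> ((nat \<Rightarrow> nat) \<Rightarrow> complex) \<Rightarrow> complex" where
  "tinner p d x y = (\<Sum>i\<in>idx p d. x i * cnj (y i))"

definition is_product_vector :: "nat \<Rightarrow> (nat \<Rightarrow> nat) \<Rightarrow> ((nat \<Rightarrow> nat) \<Rightarrow> complex) \<Rightarrow> bool" where
  "is_product_vector p d x \<longleftrightarrow>
     (\<exists>v. x = prod_tensor p d v) \<and> (\<exists>i\<in>idx p d. x i \<noteq> 0)"

definition is_UPB :: "nat \<Rightarrow> (nat \<Rightarrow> nat) \<Rightarrow> ((nat \<Rightarrow> nat) \<Rightarrow> complex) set \<Rightarrow> bool" where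
  "is_UPB p d S \<longleftrightarrow>
     finite S \<and>
     (\<forall>x\<in>S. is_product_vector p d x \<and> tinner p d x x = 1) \<and>
     (\<forall>x\<in>S. \<forall>y\<in>S. x \<noteq> y \<longrightarrow> tinner p d x y = 0) \<and>
     (\<forall>x. is_product_vector p d x \<and> x \<notin> S \<longrightarrow> \<not> (\<forall>s\<in>S. tinner p d x s = 0))"

definition f_m :: "nat \<Rightarrow> (nat \<Rightarrow> nat) \<Rightarrow> nat" where
  "f_m p d = (LEAST n. \<exists>S. is_UPB p d S \<and> card S = n)"

definition f_N :: "nat \<Rightarrow> (nat \<Rightarrow> nat) \<Rightarrow> nat" where
  "f_N p d = (\<Sum>j<p. d j - 1) + 1"

end

theory Submission
  imports Defs "HOL-Complex_Analysis.Complex_Analysis" "HOL-Real_Asymp.Real_Asymp"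
    "Jordan_Normal_Form.Determinant"
begin

text \<open>Write \<open>n\<close> for the sum of \<open>d j - 1\<close> over all factors but the last, \<open>D\<close> for the last dimension
  and \<open>2 k = n + D + 1\<close>, the claimed minimum.

  Lower bound: at most \<open>d j - 1\<close> vectors never span the factor \<open>j\<close>, so by distributing the members of
  a UPB over the factors one sees that there are at least \<open>f_N\<close> of them; if there are exactly \<open>f_N\<close>,
  orthogonality in factor \<open>j\<close> is a \<open>(d j - 1)\<close>-regular graph on an odd number of vertices, which is
  impossible for even \<open>d j\<close>.

  Upper bound: take vectors \<open>e i\<close> and \<open>f i\<close> with \<open>i\<close> in \<open>Z/k\<close>. The pairs \<open>(e i, f i')\<close> with
  \<open>i - i' < n\<close> modulo \<open>k\<close> are made orthogonal in the first factors, an interval of \<open>d j - 1\<close> residues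
  going to factor \<open>j\<close>, by vectors in general position. All other pairs are orthogonal in the last
  factor, where the \<open>e i\<close> and the \<open>f i\<close> form two orthogonal families whose mutual Gram matrix is a circulant
  with \<open>n\<close> nonzero diagonals, and with exactly \<open>n + 1\<close> singular values equal to \<open>1\<close> and the others
  smaller, so that the dimension is \<open>2 k - (n + 1) = D\<close>. Every \<open>D + 1\<close> of these vectors have to
  span. The eigenvalues of such a circulant are the values at roots of unity of a polynomial of
  degree below \<open>n\<close>, unimodular at \<open>n + 1\<close> consecutive roots. One such polynomial is found by a
  second-order perturbation of a monomial. Along suitable lines through it, continued
  to imaginary parameters, the minors expressing the spanning condition degenerate to products of
  Vandermonde determinants, hence they do not vanish nearby on the real line either.\<close>

section \<open>Determinants and Vandermonde matrices\<close>

text \<open>The size \<open>2 k = n + D + 1\<close> leaves one unit of slack, and it is spent on the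
  last factor: there a nonzero vector may be orthogonal to \<open>D\<close> members instead of
  \<open>D - 1\<close>. This choice answers the main obstacle. The polynomials used are conjugation
  symmetric, so their phases come in mirror pairs of rows, and the admissible phases satisfy one
  affine relation: there are fewer free coefficients than pairs, by one. Hence no pair of rows can
  be moved alone, but the outermost \<open>m\<close> pairs can, for every \<open>m\<close> from 2
  on. Where a single exceptional row is wanted, two are created and one is dropped. Two pairs need
  four rows, which is where \<open>n >= 3\<close> enters. A phase with sine \<open>w\<close> is
  exp(i arcsin w). It is unimodular for real \<open>w\<close> in the unit interval, but when
  \<open>w\<close> moves down the imaginary direction it explodes while its mirror phase decays.
  This separates the rows by size and splits the minors into Vandermonde blocks.\<close>

hide_const (open) module.smult

text \<open>Matrices are plain functions, so that limits and holomorphy can be stated entry by entry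
  without carrier conditions.\<close>

definition cdet :: "nat \<Rightarrow> (nat \<Rightarrow> nat \<Rightarrow> complex) \<Rightarrow> complex" where
  "cdet n M = Determinant.det (Matrix.mat n n (\<lambda>(i, j). M i j))"

lemma cdet_eq:
  "cdet n M = (\<Sum>p\<in>{p. p permutes {0..<n}}. signof p * (\<Prod>i = 0..<n. M i (p i)))"
  unfolding cdet_def Determinant.det_def
  by (auto intro!: sum.cong prod.cong simp: permutes_in_image)

lemma cdet_nonzero_iff:
  "cdet n M \<noteq> 0 \<longleftrightarrow> (\<forall>v. (\<forall>i<n. (\<Sum>j<n. M i j * v j) = 0) \<longrightarrow> (\<forall>j<n. v j = 0))"
proof -
  let ?A = "Matrix.mat n n (\<lambda>(i, j). M i j)"
  have A: "?A \<in> carrier_mat n n" by simp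
  have mul: "?A *\<^sub>v Matrix.vec n v = 0\<^sub>v n \<longleftrightarrow> (\<forall>i<n. (\<Sum>j<n. M i j * v j) = 0)" for v
    by (auto simp: vec_eq_iff scalar_prod_def lessThan_atLeast0)
  have "cdet n M = 0 \<longleftrightarrow> (\<exists>v. v \<in> carrier_vec n \<and> v \<noteq> 0\<^sub>v n \<and> ?A *\<^sub>v v = 0\<^sub>v n)"
    unfolding cdet_def by (rule det_0_iff_vec_prod_zero_field[OF A])
  also have "\<dots> \<longleftrightarrow> (\<exists>v. (\<forall>i<n. (\<Sum>j<n. M i j * v j) = 0) \<and> (\<exists>j<n. v j \<noteq> 0))"
  proof
    assume "\<exists>v. v \<in> carrier_vec n \<and> v \<noteq> 0\<^sub>v n \<and> ?A *\<^sub>v v = 0\<^sub>v n"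
    then obtain v where v: "v \<in> carrier_vec n" "v \<noteq> 0\<^sub>v n" "?A *\<^sub>v v = 0\<^sub>v n" by blast
    have "v = Matrix.vec n (vec_index v)" using v(1) by auto
    then have "\<forall>i<n. (\<Sum>j<n. M i j * vec_index v j) = 0" using v(3) mul by metis
    moreover have "\<exists>j<n. vec_index v j \<noteq> 0" using v(1,2) by (auto simp: vec_eq_iff)
    ultimately show "\<exists>v. (\<forall>i<n. (\<Sum>j<n. M i j * v j) = 0) \<and> (\<exists>j<n. v j \<noteq> 0)" by blast
  next
    assume "\<exists>v. (\<forall>i<n. (\<Sum>j<n. M i j * v j) = 0) \<and> (\<exists>j<n. v j \<noteq> 0)"
    then obtain v where v: "\<forall>i<n. (\<Sum>j<n. M i j * v j) = 0" "\<exists>j<n. v j \<noteq> 0" by blast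
    show "\<exists>v. v \<in> carrier_vec n \<and> v \<noteq> 0\<^sub>v n \<and> ?A *\<^sub>v v = 0\<^sub>v n"
      using v mul by (intro exI[of _ "Matrix.vec n v"]) (auto simp: vec_eq_iff)
  qed
  finally show ?thesis by blast
qed

lemma homogeneous_solution:
  fixes M :: "nat \<Rightarrow> nat \<Rightarrow> complex"
  assumes "m < n"
  obtains v where "\<exists>j<n. v j \<noteq> 0" "\<forall>i<m. (\<Sum>j<n. M i j * v j) = 0"
proof -
  \<comment> \<open>Padding with zero rows makes the system square and its determinant zero.\<close>
  define M' where "M' i j = (if i < m then M i j else 0)" for i j
  have "cdet n M' = 0" unfolding cdet_eq
  proof (rule sum.neutral, rule ballI)
    fix p assume "p \<in> {p. p permutes {0..<n}}"
    have "(\<Prod>i = 0..<n. M' i (p i)) = 0"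
      using assms by (intro prod_zero) (auto simp: M'_def intro!: bexI[of _ m])
    then show "signof p * (\<Prod>i = 0..<n. M' i (p i)) = 0" by simp
  qed
  then obtain v where v: "\<forall>i<n. (\<Sum>j<n. M' i j * v j) = 0" "\<exists>j<n. v j \<noteq> 0"
    using cdet_nonzero_iff[of n M'] by blast
  show ?thesis
  proof (rule that[of v])
    show "\<forall>i<m. (\<Sum>j<n. M i j * v j) = 0"
    proof (intro allI impI)
      fix i assume "i < m"
      then show "(\<Sum>j<n. M i j * v j) = 0" using v(1)[rule_format, of i] assms by (simp add: M'_def)
    qed
  qed (use v in auto)
qed

lemma homogeneous_solution_set:
  fixes a :: "'b \<Rightarrow> nat \<Rightarrow> complex"
  assumes "finite C" "card C < n"
  obtains v where "\<exists>j<n. v j \<noteq> 0" "\<forall>x\<in>C. (\<Sum>j<n. v j * a x j) = 0"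
proof -
  obtain h where h: "bij_betw h {0..<card C} C" using ex_bij_betw_nat_finite[OF assms(1)] by blast
  obtain v where v: "\<exists>j<n. v j \<noteq> 0" "\<forall>i<card C. (\<Sum>j<n. a (h i) j * v j) = 0"
    using homogeneous_solution[OF assms(2), of "\<lambda>i. a (h i)"] by blast
  show ?thesis
  proof (rule that[of v])
    show "\<forall>x\<in>C. (\<Sum>j<n. v j * a x j) = 0"
    proof
      fix x assume "x \<in> C"
      then obtain i where "i < card C" "x = h i" using h unfolding bij_betw_def by force
      then show "(\<Sum>j<n. v j * a x j) = 0" using v(2) by (simp add: mult.commute)
    qed
  qed (use v in auto)
qed

lemma tendsto_cdet:
  assumes "\<And>i j. i < n \<Longrightarrow> j < n \<Longrightarrow> ((\<lambda>r. M r i j) \<longlongrightarrow> L i j) F"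
  shows "((\<lambda>r. cdet n (M r)) \<longlongrightarrow> cdet n L) F"
  unfolding cdet_eq
  by (intro tendsto_sum tendsto_mult tendsto_const tendsto_prod assms) (auto simp: permutes_in_image)

lemma holomorphic_on_cdet:
  assumes "\<And>i j. i < n \<Longrightarrow> j < n \<Longrightarrow> (\<lambda>z. M z i j) holomorphic_on S"
  shows "(\<lambda>z. cdet n (M z)) holomorphic_on S"
  unfolding cdet_eq
  by (intro holomorphic_intros assms) (auto simp: permutes_in_image)

section \<open>Vandermonde matrices with one or two groups of columns\<close>

lemma vandermonde_kernel:
  fixes x :: "'i \<Rightarrow> complex"
  assumes fin: "finite I" and inj: "inj_on x I" and nz: "\<And>c. c \<in> I \<Longrightarrow> x c \<noteq> 0"
    and eq: "\<And>j. j0 \<le> j \<Longrightarrow> j < j0 + card I \<Longrightarrow> (\<Sum>c\<in>I. a c * x c ^ j) = 0"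
    and c: "c \<in> I"
  shows "a c = 0"
proof -
  \<comment> \<open>Weighting the equations with the coefficients of a polynomial that vanishes at
    every node except \<open>x c\<close> isolates the unknown \<open>a c\<close>; the shift
    \<open>j0\<close> only contributes a nonzero factor.\<close>
  define p where "p = (\<Prod>b\<in>I - {c}. [:- x b, 1:])"
  have "degree p \<le> (\<Sum>b\<in>I - {c}. degree [:- x b, 1:])" unfolding p_def by (rule degree_prod_sum_le[unfolded comp_def]) (use fin in auto)
  also have "\<dots> = card I - 1" using c fin by simp
  finally have deg: "degree p < card I" using c fin card_gt_0_iff[of I] by fastforce
  have val: "poly p (x b) = 0" if "b \<in> I" "b \<noteq> c" for b
    unfolding p_def poly_prod using that fin by (intro prod_zero) auto
  have nzc: "poly p (x c) \<noteq> 0"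
    unfolding p_def poly_prod using fin c inj by (auto simp: inj_on_def)
  have expand: "poly p y = (\<Sum>i<card I. poly.coeff p i * y ^ i)" for y
    unfolding poly_altdef using deg by (intro sum.mono_neutral_left) (auto simp: coeff_eq_0)
  have "0 = (\<Sum>i<card I. poly.coeff p i * (\<Sum>b\<in>I. a b * x b ^ (j0 + i)))"
    using eq by simp
  also have "\<dots> = (\<Sum>b\<in>I. a b * x b ^ j0 * poly p (x b))"
    unfolding expand sum_distrib_left by (subst sum.swap) (simp add: power_add mult_ac)
  also have "\<dots> = (\<Sum>b\<in>I. if b = c then a c * x c ^ j0 * poly p (x c) else 0)"
    by (intro sum.cong) (auto simp: val)
  also have "\<dots> = a c * x c ^ j0 * poly p (x c)" using fin c by simp
  finally show ?thesis using nzc nz[OF c] by simp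
qed

text \<open>Both spanning conditions of the construction lead to this matrix:
  \<open>\<alpha>\<close> columns of pure powers next to columns whose rows carry weights. The
  weight is indexed by the exponent \<open>j0 + i\<close>, so that changing \<open>j0\<close> slides
  a window along a fixed sequence of rows.\<close>

definition mixed_vandermonde ::
  "nat \<Rightarrow> nat \<Rightarrow> (nat \<Rightarrow> complex) \<Rightarrow> (nat \<Rightarrow> complex) \<Rightarrow> (nat \<Rightarrow> complex) \<Rightarrow> nat \<Rightarrow> nat \<Rightarrow> complex" where
  "mixed_vandermonde \<alpha> j0 x y \<Lambda> i c =
     (if c < \<alpha> then x c ^ (j0 + i) else \<Lambda> (j0 + i) * y (c - \<alpha>) ^ (j0 + i))"

lemma sum_lessThan_add: "(\<Sum>c<\<alpha> + \<beta>. f c) = (\<Sum>c<\<alpha>. f c) + (\<Sum>c<\<beta>. f (\<alpha> + c))"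
  for f :: "nat \<Rightarrow> 'a::comm_monoid_add"
proof -
  have "{..<\<alpha> + \<beta>} = {..<\<alpha>} \<union> {\<alpha>..<\<alpha> + \<beta>}" by auto
  then have "(\<Sum>c<\<alpha> + \<beta>. f c) = (\<Sum>c<\<alpha>. f c) + (\<Sum>c\<in>{\<alpha>..<\<alpha> + \<beta>}. f c)"
    by (simp add: sum.union_disjoint ivl_disj_int)
  also have "(\<Sum>c\<in>{\<alpha>..<\<alpha> + \<beta>}. f c) = (\<Sum>c<\<beta>. f (\<alpha> + c))"
    by (rule sum.reindex_bij_witness[of _ "\<lambda>c. \<alpha> + c" "\<lambda>c. c - \<alpha>"]) auto
  finally show ?thesis .
qed

lemma mixed_vandermonde_sum:
  "(\<Sum>c<\<alpha> + \<beta>. mixed_vandermonde \<alpha> j0 x y \<Lambda> i c * v c) =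
   (\<Sum>c<\<alpha>. v c * x c ^ (j0 + i)) + \<Lambda> (j0 + i) * (\<Sum>c<\<beta>. v (\<alpha> + c) * y c ^ (j0 + i))"
  unfolding sum_lessThan_add by (simp add: mixed_vandermonde_def sum_distrib_left mult_ac)

lemma mixed_vandermonde_kernel:
  assumes "cdet (\<alpha> + \<beta>) (mixed_vandermonde \<alpha> j0 x y \<Lambda>) \<noteq> 0"
    and eq: "\<And>j. j0 \<le> j \<Longrightarrow> j < j0 + \<alpha> + \<beta> \<Longrightarrow>
          (\<Sum>c<\<alpha>. a c * x c ^ j) + \<Lambda> j * (\<Sum>c<\<beta>. b c * y c ^ j) = 0"
  shows "(\<forall>c<\<alpha>. a c = 0) \<and> (\<forall>c<\<beta>. b c = 0)"
proof -
  define v where "v c = (if c < \<alpha> then a c else b (c - \<alpha>))" for c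
  have "\<forall>i<\<alpha> + \<beta>. (\<Sum>c<\<alpha> + \<beta>. mixed_vandermonde \<alpha> j0 x y \<Lambda> i c * v c) = 0"
    unfolding mixed_vandermonde_sum using eq by (simp add: v_def)
  then have v: "\<forall>c<\<alpha> + \<beta>. v c = 0" using assms(1) unfolding cdet_nonzero_iff by blast
  have "a c = 0" if "c < \<alpha>" for c using v that by (auto simp: v_def dest!: spec[of _ c])
  moreover have "b c = 0" if "c < \<beta>" for c using v[rule_format, of "\<alpha> + c"] that by (simp add: v_def)
  ultimately show ?thesis by blast
qed

text \<open>After rescaling rows and columns the matrix degenerates to two Vandermonde blocks.\<close>

lemma mixed_vandermonde_eventually:
  assumes x: "inj_on x {..<\<alpha>}" "\<And>c. c < \<alpha> \<Longrightarrow> x c \<noteq> 0"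
    and y: "inj_on y {..<\<beta>}" "\<And>c. c < \<beta> \<Longrightarrow> y c \<noteq> 0"
    and low: "\<And>j. j0 \<le> j \<Longrightarrow> j < j0 + \<alpha> \<Longrightarrow> ((\<lambda>r. \<Lambda> r j / s r) \<longlongrightarrow> 0) F"
    and high: "\<And>j. j0 + \<alpha> \<le> j \<Longrightarrow> j < j0 + \<alpha> + \<beta> \<Longrightarrow> ((\<lambda>r. s r / \<Lambda> r j) \<longlongrightarrow> 0) F"
    and nz: "eventually (\<lambda>r. s r \<noteq> 0 \<and> (\<forall>j. j0 + \<alpha> \<le> j \<and> j < j0 + \<alpha> + \<beta> \<longrightarrow> \<Lambda> r j \<noteq> 0)) F"
  shows "eventually (\<lambda>r. cdet (\<alpha> + \<beta>) (mixed_vandermonde \<alpha> j0 x y (\<Lambda> r)) \<noteq> 0) F"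
proof -
  \<comment> \<open>Rows from \<open>\<alpha>\<close> on are multiplied by
    \<open>s r / \<Lambda> r j\<close> and the weighted columns are divided by \<open>s r\<close>;
    off the two diagonal blocks only vanishing factors remain.\<close>
  define N where "N r i c = (if i < \<alpha>
      then (if c < \<alpha> then x c ^ (j0 + i) else \<Lambda> r (j0 + i) / s r * y (c - \<alpha>) ^ (j0 + i))
      else (if c < \<alpha> then s r / \<Lambda> r (j0 + i) * x c ^ (j0 + i) else y (c - \<alpha>) ^ (j0 + i)))" for r i c
  \<comment> \<open>The zero blocks are written as products so that the entries match those of
    \<open>N\<close> factor by factor in the limit.\<close>
  define L where "L i c = (if i < \<alpha>
      then (if c < \<alpha> then x c ^ (j0 + i) else 0 * y (c - \<alpha>) ^ (j0 + i))
      else (if c < \<alpha> then 0 * x c ^ (j0 + i) else y (c - \<alpha>) ^ (j0 + i)))" for i c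
  have "((\<lambda>r. cdet (\<alpha> + \<beta>) (N r)) \<longlongrightarrow> cdet (\<alpha> + \<beta>) L) F"
  proof (rule tendsto_cdet)
    fix i c assume ic: "i < \<alpha> + \<beta>" "c < \<alpha> + \<beta>"
    show "((\<lambda>r. N r i c) \<longlongrightarrow> L i c) F"
      unfolding N_def L_def using ic
      by (cases "i < \<alpha>"; cases "c < \<alpha>"; simp only: if_True if_False)
         (intro tendsto_mult tendsto_const low high; simp)+
  qed
  moreover have "cdet (\<alpha> + \<beta>) L \<noteq> 0" unfolding cdet_nonzero_iff
  proof (intro allI impI)
    fix v c assume eq: "\<forall>i<\<alpha> + \<beta>. (\<Sum>c<\<alpha> + \<beta>. L i c * v c) = 0" and c: "c < \<alpha> + \<beta>"
    have Lsum: "(\<Sum>c<\<alpha> + \<beta>. L i c * v c) = (if i < \<alpha> then (\<Sum>c<\<alpha>. v c * x c ^ (j0 + i))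
        else (\<Sum>c<\<beta>. v (\<alpha> + c) * y c ^ (j0 + i)))" for i
      unfolding sum_lessThan_add by (simp add: L_def mult_ac)
    have A: "(\<Sum>c<\<alpha>. v c * x c ^ j) = 0" if "j0 \<le> j" "j < j0 + \<alpha>" for j
    proof -
      have "j - j0 < \<alpha>" "j - j0 < \<alpha> + \<beta>" "j0 + (j - j0) = j" using that by auto
      then show ?thesis using eq[rule_format, of "j - j0"] unfolding Lsum by simp
    qed
    have B: "(\<Sum>c<\<beta>. v (\<alpha> + c) * y c ^ j) = 0" if "j0 + \<alpha> \<le> j" "j < j0 + \<alpha> + \<beta>" for j
    proof -
      have "\<not> j - j0 < \<alpha>" "j - j0 < \<alpha> + \<beta>" "j0 + (j - j0) = j" using that by auto
      then show ?thesis using eq[rule_format, of "j - j0"] unfolding Lsum by simp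
    qed
    show "v c = 0"
    proof (cases "c < \<alpha>")
      case True
      then show ?thesis using vandermonde_kernel[of "{..<\<alpha>}" x j0 v c] x A by auto
    next
      case False
      then have "c - \<alpha> < \<beta>" using c by simp
      then show ?thesis
        using vandermonde_kernel[of "{..<\<beta>}" y "j0 + \<alpha>" "\<lambda>c. v (\<alpha> + c)" "c - \<alpha>"] y B False by auto
    qed
  qed
  ultimately have "eventually (\<lambda>r. cdet (\<alpha> + \<beta>) (N r) \<noteq> 0) F"
    by (rule tendsto_imp_eventually_ne)
  then show ?thesis using nz
  proof eventually_elim
    case (elim r)
    show ?case unfolding cdet_nonzero_iff
    proof (intro allI impI)
      fix v c
      assume eq: "\<forall>i<\<alpha> + \<beta>. (\<Sum>c<\<alpha> + \<beta>. mixed_vandermonde \<alpha> j0 x y (\<Lambda> r) i c * v c) = 0"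
        and c: "c < \<alpha> + \<beta>"
      \<comment> \<open>The unknowns of the weighted columns are multiplied by \<open>s r\<close> to
        compensate for the division of these columns.\<close>
      define w where "w c = (if c < \<alpha> then v c else s r * v c)" for c
      have "(\<Sum>c<\<alpha> + \<beta>. N r i c * w c) = 0" if i: "i < \<alpha> + \<beta>" for i
      proof -
        have e: "(\<Sum>c<\<alpha>. v c * x c ^ (j0 + i)) + \<Lambda> r (j0 + i) * (\<Sum>c<\<beta>. v (\<alpha> + c) * y c ^ (j0 + i)) = 0"
          using eq[rule_format, OF i] unfolding mixed_vandermonde_sum .
        show ?thesis
        proof (cases "i < \<alpha>")
          case True
          have "(\<Sum>c<\<alpha> + \<beta>. N r i c * w c) = (\<Sum>c<\<alpha>. v c * x c ^ (j0 + i)) +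
              \<Lambda> r (j0 + i) * (\<Sum>c<\<beta>. v (\<alpha> + c) * y c ^ (j0 + i))"
            unfolding sum_lessThan_add using True elim by (simp add: N_def w_def sum_distrib_left mult_ac)
          then show ?thesis using e by simp
        next
          case False
          then have nzi: "\<Lambda> r (j0 + i) \<noteq> 0" using elim i by auto
          have "(\<Sum>c<\<alpha> + \<beta>. N r i c * w c) = s r / \<Lambda> r (j0 + i) * ((\<Sum>c<\<alpha>. v c * x c ^ (j0 + i)) +
              \<Lambda> r (j0 + i) * (\<Sum>c<\<beta>. v (\<alpha> + c) * y c ^ (j0 + i)))"
            unfolding sum_lessThan_add using False nzi
            by (simp add: N_def w_def sum_distrib_left distrib_left mult_ac)
          then show ?thesis using e by simp
        qed
      qed
      then have "w c = 0" using elim(1) c unfolding cdet_nonzero_iff by blast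
      then show "v c = 0" using elim(2) by (auto simp: w_def split: if_splits)
    qed
  qed
qed

section \<open>Unimodular phases\<close>

text \<open>This is exp(i arcsin w) on the strip where the real part lies strictly between -1 and 1.
  Using the sine as parameter makes the family of phases coming from polynomials affine.\<close>

definition unit_branch :: "complex \<Rightarrow> complex" where
  "unit_branch w = csqrt (1 - w\<^sup>2) + \<i> * w"

lemma unit_branch_mult_minus: "unit_branch w * unit_branch (- w) = 1"
proof -
  have "unit_branch w * unit_branch (- w) = (csqrt (1 - w\<^sup>2))\<^sup>2 - (\<i> * w)\<^sup>2"
    by (simp add: unit_branch_def algebra_simps power2_eq_square)
  also have "\<dots> = 1" by (simp add: power_mult_distrib)
  finally show ?thesis .
qed

lemma unit_branch_nonzero: "unit_branch w \<noteq> 0"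
  using unit_branch_mult_minus[of w] by auto

lemma unit_branch_minus: "unit_branch (- w) = inverse (unit_branch w)"
  using unit_branch_mult_minus[of w] by (metis inverse_unique)

lemma unit_branch_of_real:
  assumes "\<bar>g\<bar> \<le> 1"
  shows "unit_branch (of_real g) = Complex (sqrt (1 - g\<^sup>2)) g"
proof -
  have "1 - g\<^sup>2 \<ge> 0" using assms by (simp add: abs_square_le_1)
  then have "csqrt (of_real (1 - g\<^sup>2)) = of_real (sqrt (1 - g\<^sup>2))"
    by (metis of_real_sqrt)
  then show ?thesis by (simp add: unit_branch_def complex_eq_iff)
qed

lemma norm_unit_branch_of_real:
  assumes "\<bar>g\<bar> \<le> 1"
  shows "norm (unit_branch (of_real g)) = 1"
proof -
  have "1 - g\<^sup>2 \<ge> 0" using assms by (simp add: abs_square_le_1)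
  then show ?thesis unfolding unit_branch_of_real[OF assms] by (simp add: cmod_def)
qed

text \<open>Both summands of \<open>unit_branch\<close> have nonnegative real part here, the
  principal root by its choice and the second one equal to \<open>r\<close>, so they cannot
  cancel.\<close>

lemma norm_unit_branch_ge: "norm (unit_branch (of_real g - \<i> * of_real r)) \<ge> r"
proof -
  have "Re (csqrt (1 - (of_real g - \<i> * of_real r)\<^sup>2)) \<ge> 0"
    using csqrt_principal[of "1 - (of_real g - \<i> * of_real r)\<^sup>2"] by auto
  then have "r \<le> Re (unit_branch (of_real g - \<i> * of_real r))"
    by (simp add: unit_branch_def)
  then show ?thesis using complex_Re_le_cmod order_trans by blast
qed

text \<open>The branch cut of the root is avoided: if \<open>1 - w\<^sup>2\<close> were a
  nonpositive real, the square of the real part of \<open>w\<close> would be at least 1. There is no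
  restriction on the imaginary part, which is what permits the continuation to large imaginary
  parameters.\<close>

lemma holomorphic_unit_branch: "unit_branch holomorphic_on {w. \<bar>Re w\<bar> < 1}"
proof -
  have "1 - w\<^sup>2 \<notin> \<real>\<^sub>\<le>\<^sub>0" if "\<bar>Re w\<bar> < 1" for w
  proof
    assume "1 - w\<^sup>2 \<in> \<real>\<^sub>\<le>\<^sub>0"
    then have *: "Re (w\<^sup>2) \<ge> 1" "Im (w\<^sup>2) = 0" by (auto simp: complex_nonpos_Reals_iff)
    have "(Re w)\<^sup>2 < 1" using that by (simp add: abs_square_less_1)
    moreover have "(Re w)\<^sup>2 - (Im w)\<^sup>2 \<ge> 1" using *(1) by (simp add: Re_power2)
    ultimately show False by (smt (verit) zero_le_power2)
  qed
  then show ?thesis unfolding unit_branch_def[abs_def]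
    by (intro holomorphic_intros) auto
qed

text \<open>The phases at the rows \<open>0, \<dots>, n\<close>; row \<open>n - j\<close> is the mirror image of row \<open>j\<close>, and on
  real arguments in \<open>[-1, 1]\<close> the two phases are complex conjugates of each other.\<close>

definition row_phase :: "nat \<Rightarrow> complex \<Rightarrow> (nat \<Rightarrow> complex) \<Rightarrow> nat \<Rightarrow> complex" where
  "row_phase n \<nu> w j = (if n < 2 * j then \<nu> * unit_branch (w (n - j))
     else if 2 * j < n then unit_branch (- w j) / \<nu> else 1)"

lemma row_phase_nonzero: "\<nu> \<noteq> 0 \<Longrightarrow> row_phase n \<nu> w j \<noteq> 0"
  by (simp add: row_phase_def unit_branch_nonzero)

lemma norm_row_phase_of_real:
  assumes "norm \<nu> = 1" "\<And>l. 2 * l < n \<Longrightarrow> \<bar>G l\<bar> < 1" "j \<le> n"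
  shows "norm (row_phase n \<nu> (\<lambda>l. of_real (G l)) j) = 1"
proof -
  have "norm (unit_branch (of_real (G l))) = 1" if "2 * l < n" for l
    using norm_unit_branch_of_real[of "G l"] assms(2)[OF that] by simp
  moreover have "norm (unit_branch (- of_real (G l))) = 1" if "2 * l < n" for l
    using norm_unit_branch_of_real[of "- G l"] assms(2)[OF that] by simp
  ultimately show ?thesis using assms(1,3) by (simp add: row_phase_def norm_mult norm_divide)
qed

lemma holomorphic_row_phase:
  assumes "\<nu> \<noteq> 0" "j \<le> n" "\<And>l. 2 * l < n \<Longrightarrow> (\<lambda>z. w z l) holomorphic_on S"
    and "\<And>l z. 2 * l < n \<Longrightarrow> z \<in> S \<Longrightarrow> \<bar>Re (w z l)\<bar> < 1"
  shows "(\<lambda>z. row_phase n \<nu> (w z) j) holomorphic_on S"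
proof -
  have a: "(\<lambda>z. unit_branch (w z l)) holomorphic_on S" if "2 * l < n" for l
    using holomorphic_on_compose_gen[OF assms(3)[OF that] holomorphic_unit_branch] assms(4)[OF that]
    by (simp add: o_def image_subset_iff)
  have b: "(\<lambda>z. unit_branch (- w z l)) holomorphic_on S" if "2 * l < n" for l
    using holomorphic_on_compose_gen[OF holomorphic_on_minus[OF assms(3)[OF that]] holomorphic_unit_branch] assms(4)[OF that]
    by (simp add: o_def image_subset_iff)
  consider "n < 2 * j" | "2 * j < n" | "2 * j = n" by linarith
  then show ?thesis
  proof cases
    case 1
    then have "2 * (n - j) < n" using assms(2) by linarith
    then show ?thesis using 1 a unfolding row_phase_def by (auto intro!: holomorphic_intros)
  next
    case 2
    then show ?thesis using b assms(1) unfolding row_phase_def by (auto intro!: holomorphic_intros)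
  next
    case 3
    then show ?thesis unfolding row_phase_def by (auto intro!: holomorphic_intros)
  qed
qed

text \<open>Three sizes of rows arise for large \<open>R\<close>: the last \<open>m\<close> rows
  explode, their mirror rows decay, and the rows between them stay unimodular because
  \<open>\<eta>\<close> vanishes there.\<close>

lemma row_phase_imaginary:
  assumes \<nu>: "norm \<nu> = 1" and G: "\<And>l. 2 * l < n \<Longrightarrow> \<bar>G l\<bar> < 1" and j: "j \<le> n"
    and pos: "\<And>l. l < m \<Longrightarrow> \<eta> l > 0" and zero: "\<And>l. m \<le> l \<Longrightarrow> 2 * l < n \<Longrightarrow> \<eta> l = 0"
    and R: "R > 0"
    and \<Lambda>: "\<Lambda> = row_phase n \<nu> (\<lambda>l. of_real (G l) - \<i> * of_real (R * \<eta> l))"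
  shows "n < 2 * j \<Longrightarrow> n - j < m \<Longrightarrow> norm (\<Lambda> j) \<ge> R * \<eta> (n - j)"
    and "2 * j < n \<Longrightarrow> j < m \<Longrightarrow> norm (\<Lambda> j) \<le> 1 / (R * \<eta> j)"
    and "n < 2 * j \<and> m \<le> n - j \<or> 2 * j = n \<or> 2 * j < n \<and> m \<le> j \<Longrightarrow> norm (\<Lambda> j) = 1"
proof -
  let ?w = "\<lambda>l. of_real (G l) - \<i> * of_real (R * \<eta> l) :: complex"
  show "norm (\<Lambda> j) \<ge> R * \<eta> (n - j)" if "n < 2 * j" "n - j < m"
    using norm_unit_branch_ge[of "R * \<eta> (n - j)" "G (n - j)"] \<nu> that
    by (simp add: \<Lambda> row_phase_def norm_mult)
  show "norm (\<Lambda> j) \<le> 1 / (R * \<eta> j)" if "2 * j < n" "j < m"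
  proof -
    have "R * \<eta> j > 0" using R pos that by simp
    moreover have "norm (\<Lambda> j) = inverse (norm (unit_branch (?w j)))"
      using \<nu> that unit_branch_minus[of "?w j"] by (simp add: \<Lambda> row_phase_def norm_divide norm_inverse)
    ultimately show ?thesis using norm_unit_branch_ge[of "R * \<eta> j" "G j"]
      by (simp add: inverse_eq_divide frac_le)
  qed
  show "norm (\<Lambda> j) = 1" if "n < 2 * j \<and> m \<le> n - j \<or> 2 * j = n \<or> 2 * j < n \<and> m \<le> j"
  proof -
    have "\<Lambda> j = row_phase n \<nu> (\<lambda>l. of_real (G l)) j"
      using that zero[of j] zero[of "n - j"] j by (auto simp: \<Lambda> row_phase_def)
    then show ?thesis using norm_row_phase_of_real[of \<nu> n G j] \<nu> G j by simp
  qed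
qed

lemma mixed_vandermonde_imaginary:
  assumes n: "n \<ge> 3" "\<alpha> + \<beta> = n" "\<alpha> \<ge> 1" "\<beta> \<ge> 1"
    and x: "inj_on x {..<\<alpha>}" "\<And>c. c < \<alpha> \<Longrightarrow> x c \<noteq> 0"
    and y: "inj_on y {..<\<beta>}" "\<And>c. c < \<beta> \<Longrightarrow> y c \<noteq> 0"
    and \<nu>: "norm \<nu> = 1" and G: "\<And>l. 2 * l < n \<Longrightarrow> \<bar>G l\<bar> < 1"
  obtains m j0 where "2 \<le> m" "2 * m \<le> n + 1" "j0 \<le> 1"
    "\<And>\<eta> :: nat \<Rightarrow> real. (\<And>l. l < m \<Longrightarrow> \<eta> l > 0) \<Longrightarrow> (\<And>l. m \<le> l \<Longrightarrow> 2 * l < n \<Longrightarrow> \<eta> l = 0) \<Longrightarrow>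
      eventually (\<lambda>R. cdet n (mixed_vandermonde \<alpha> j0 x y
        (row_phase n \<nu> (\<lambda>l. of_real (G l) - \<i> * of_real (R * \<eta> l)))) \<noteq> 0) at_top"
proof (cases "2 * \<beta> \<le> n + 1")
  case True
  define m where "m = max 2 \<beta>"
  \<comment> \<open>For \<open>\<beta> = 1\<close> two rows explode but only one is wanted; the
    window starting at 0 leaves out row \<open>n\<close>.\<close>
  define j0 :: nat where "j0 = (if \<beta> = 1 then 0 else 1)"
  show ?thesis
  proof (rule that[of m j0])
    show m: "2 \<le> m" "2 * m \<le> n + 1" "j0 \<le> 1" using True n by (auto simp: m_def j0_def)
    fix \<eta> :: "nat \<Rightarrow> real"
    assume pos: "\<And>l. l < m \<Longrightarrow> \<eta> l > 0" and zero: "\<And>l. m \<le> l \<Longrightarrow> 2 * l < n \<Longrightarrow> \<eta> l = 0"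
    define \<Lambda> where "\<Lambda> R = row_phase n \<nu> (\<lambda>l. of_real (G l) - \<i> * of_real (R * \<eta> l))" for R
    have im1: "norm (\<Lambda> R j) \<ge> R * \<eta> (n - j)" if "j \<le> n" "R > 0" "n < 2 * j" "n - j < m" for j R
      by (rule row_phase_imaginary(1)[OF \<nu> G that(1) pos zero that(2) \<Lambda>_def that(3,4)])
    have im2: "norm (\<Lambda> R j) \<le> 1 / (R * \<eta> j)" if "j \<le> n" "R > 0" "2 * j < n" "j < m" for j R
      by (rule row_phase_imaginary(2)[OF \<nu> G that(1) pos zero that(2) \<Lambda>_def that(3,4)])
    have im3: "norm (\<Lambda> R j) = 1"
      if "j \<le> n" "R > 0" "n < 2 * j \<and> m \<le> n - j \<or> 2 * j = n \<or> 2 * j < n \<and> m \<le> j" for j R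
      by (rule row_phase_imaginary(3)[OF \<nu> G that(1) pos zero that(2) \<Lambda>_def that(3)])
    have "eventually (\<lambda>R. cdet (\<alpha> + \<beta>) (mixed_vandermonde \<alpha> j0 x y (\<Lambda> R)) \<noteq> 0) at_top"
    \<comment> \<open>The root of \<open>R\<close> separates the bounded rows from those growing at
      least linearly in \<open>R\<close>.\<close>
    proof (rule mixed_vandermonde_eventually[where s = "\<lambda>R. of_real (sqrt R)", OF x y])
      fix j assume j: "j0 \<le> j" "j < j0 + \<alpha>"
      then have jn: "j \<le> n" "j \<le> n - m" using n by (auto simp: m_def j0_def split: if_splits)
      have "\<exists>C\<ge>0. eventually (\<lambda>R. norm (\<Lambda> R j) \<le> 1 + C / R) at_top"
      proof (cases "2 * j < n \<and> j < m")
        case True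
        show ?thesis
        proof (intro exI[of _ "1 / \<eta> j"] conjI eventually_mono[OF eventually_gt_at_top[of 0]])
          fix R :: real assume "0 < R"
          then have "norm (\<Lambda> R j) \<le> 1 / (R * \<eta> j)" using im2[of j R] True jn by auto
          also have "\<dots> = 1 / \<eta> j / R" by simp
          finally show "norm (\<Lambda> R j) \<le> 1 + 1 / \<eta> j / R" by simp
        qed (use pos[of j] True in simp)
      next
        case False
        show ?thesis
        proof (intro exI[of _ 0] conjI eventually_mono[OF eventually_gt_at_top[of 0]])
          fix R :: real assume "0 < R"
          moreover have "n < 2 * j \<and> m \<le> n - j \<or> 2 * j = n \<or> 2 * j < n \<and> m \<le> j"
            using False jn m by linarith
          ultimately show "norm (\<Lambda> R j) \<le> 1 + 0 / R" using im3[of j R] jn by auto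
        qed simp
      qed
      then obtain C where C: "C \<ge> 0" "eventually (\<lambda>R. norm (\<Lambda> R j) \<le> 1 + C / R) at_top" by blast
      have "((\<lambda>R::real. (1 + C / R) / sqrt R) \<longlongrightarrow> 0) at_top" by real_asymp
      moreover have "eventually (\<lambda>R. norm (\<Lambda> R j / of_real (sqrt R)) \<le> (1 + C / R) / sqrt R) at_top"
        using C(2) eventually_gt_at_top[of 0]
        by eventually_elim (simp add: norm_divide divide_right_mono)
      ultimately show "((\<lambda>R. \<Lambda> R j / of_real (sqrt R)) \<longlongrightarrow> 0) at_top"
        by (rule Lim_null_comparison[rotated])
    next
      fix j assume j: "j0 + \<alpha> \<le> j" "j < j0 + \<alpha> + \<beta>"
      then have jn: "j \<le> n" "n - j < m" "n < 2 * j" using n True by (auto simp: m_def j0_def split: if_splits)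
      have e: "\<eta> (n - j) > 0" using pos jn by auto
      have "((\<lambda>R::real. sqrt R / (R * \<eta> (n - j))) \<longlongrightarrow> 0) at_top" using e by real_asymp
      moreover have "eventually (\<lambda>R. norm (of_real (sqrt R) / \<Lambda> R j) \<le> sqrt R / (R * \<eta> (n - j))) at_top"
      proof (rule eventually_mono[OF eventually_gt_at_top[of 0]])
        fix R :: real assume elim: "0 < R"
        have pos': "0 < R * \<eta> (n - j)" using elim e by simp
        have ge: "R * \<eta> (n - j) \<le> norm (\<Lambda> R j)" using im1[of j R] jn elim by blast
        have "sqrt R / norm (\<Lambda> R j) \<le> sqrt R / (R * \<eta> (n - j))"
          by (rule divide_left_mono[OF ge]) (use elim pos' ge in \<open>auto intro!: mult_pos_pos order_less_le_trans[OF pos' ge]\<close>)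
        moreover have "norm (of_real (sqrt R) / \<Lambda> R j) = sqrt R / norm (\<Lambda> R j)"
          using elim by (simp only: norm_divide norm_of_real) simp
        ultimately show "norm (of_real (sqrt R) / \<Lambda> R j) \<le> sqrt R / (R * \<eta> (n - j))" by (simp only:)
      qed
      ultimately show "((\<lambda>R. of_real (sqrt R) / \<Lambda> R j) \<longlongrightarrow> 0) at_top"
        by (rule Lim_null_comparison[rotated])
    next
      have "\<nu> \<noteq> 0" using \<nu> by auto
      then show "eventually (\<lambda>R. complex_of_real (sqrt R) \<noteq> 0 \<and>
          (\<forall>j. j0 + \<alpha> \<le> j \<and> j < j0 + \<alpha> + \<beta> \<longrightarrow> \<Lambda> R j \<noteq> 0)) at_top"
        by (intro eventually_mono[OF eventually_gt_at_top[of 0]]) (auto simp: \<Lambda>_def row_phase_nonzero)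
    qed
    then show "eventually (\<lambda>R. cdet n (mixed_vandermonde \<alpha> j0 x y
        (row_phase n \<nu> (\<lambda>l. of_real (G l) - \<i> * of_real (R * \<eta> l)))) \<noteq> 0) at_top"
      using n by (simp add: \<Lambda>_def)
  qed
next
  case False
  define m where "m = max 2 \<alpha>"
  \<comment> \<open>The mirror situation: for \<open>\<alpha> = 1\<close> rows 0 and 1 decay, and
    the window starting at 1 leaves out row 0.\<close>
  define j0 :: nat where "j0 = (if \<alpha> = 1 then 1 else 0)"
  show ?thesis
  proof (rule that[of m j0])
    show m: "2 \<le> m" "2 * m \<le> n + 1" "j0 \<le> 1" using False n by (auto simp: m_def j0_def)
    fix \<eta> :: "nat \<Rightarrow> real"
    assume pos: "\<And>l. l < m \<Longrightarrow> \<eta> l > 0" and zero: "\<And>l. m \<le> l \<Longrightarrow> 2 * l < n \<Longrightarrow> \<eta> l = 0"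
    define \<Lambda> where "\<Lambda> R = row_phase n \<nu> (\<lambda>l. of_real (G l) - \<i> * of_real (R * \<eta> l))" for R
    have im1: "norm (\<Lambda> R j) \<ge> R * \<eta> (n - j)" if "j \<le> n" "R > 0" "n < 2 * j" "n - j < m" for j R
      by (rule row_phase_imaginary(1)[OF \<nu> G that(1) pos zero that(2) \<Lambda>_def that(3,4)])
    have im2: "norm (\<Lambda> R j) \<le> 1 / (R * \<eta> j)" if "j \<le> n" "R > 0" "2 * j < n" "j < m" for j R
      by (rule row_phase_imaginary(2)[OF \<nu> G that(1) pos zero that(2) \<Lambda>_def that(3,4)])
    have im3: "norm (\<Lambda> R j) = 1"
      if "j \<le> n" "R > 0" "n < 2 * j \<and> m \<le> n - j \<or> 2 * j = n \<or> 2 * j < n \<and> m \<le> j" for j R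
      by (rule row_phase_imaginary(3)[OF \<nu> G that(1) pos zero that(2) \<Lambda>_def that(3)])
    have "eventually (\<lambda>R. cdet (\<alpha> + \<beta>) (mixed_vandermonde \<alpha> j0 x y (\<Lambda> R)) \<noteq> 0) at_top"
    \<comment> \<open>The decaying rows are of order \<open>1 / R\<close> and the other rows of the
      window are at least 1 in modulus.\<close>
    proof (rule mixed_vandermonde_eventually[where s = "\<lambda>R. of_real (1 / sqrt R)", OF x y])
      fix j assume j: "j0 \<le> j" "j < j0 + \<alpha>"
      then have jn: "j \<le> n" "j < m" "2 * j < n" using n m by (auto simp: m_def j0_def split: if_splits)
      have e: "\<eta> j > 0" using pos jn by auto
      have "((\<lambda>R::real. sqrt R / (R * \<eta> j)) \<longlongrightarrow> 0) at_top" using e by real_asymp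
      moreover have "eventually (\<lambda>R. norm (\<Lambda> R j / of_real (1 / sqrt R)) \<le> sqrt R / (R * \<eta> j)) at_top"
      proof (rule eventually_mono[OF eventually_gt_at_top[of 0]])
        fix R :: real assume elim: "0 < R"
        have "norm (\<Lambda> R j) * sqrt R \<le> 1 / (R * \<eta> j) * sqrt R"
          using im2[of j R] elim jn by (intro mult_right_mono) auto
        moreover have "norm (\<Lambda> R j / of_real (1 / sqrt R)) = norm (\<Lambda> R j) * sqrt R"
          using elim by (simp only: norm_divide norm_of_real) simp
        moreover have "1 / (R * \<eta> j) * sqrt R = sqrt R / (R * \<eta> j)" by (simp only: times_divide_eq_left mult_1)
        ultimately show "norm (\<Lambda> R j / of_real (1 / sqrt R)) \<le> sqrt R / (R * \<eta> j)" by (simp only:)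
      qed
      ultimately show "((\<lambda>R. \<Lambda> R j / of_real (1 / sqrt R)) \<longlongrightarrow> 0) at_top"
        by (rule Lim_null_comparison[rotated])
    next
      fix j assume j: "j0 + \<alpha> \<le> j" "j < j0 + \<alpha> + \<beta>"
      then have jn: "j \<le> n" "m \<le> j" using n by (auto simp: m_def j0_def split: if_splits)
      have ev1: "eventually (\<lambda>R. norm (\<Lambda> R j) \<ge> 1) at_top"
      proof (cases "n < 2 * j \<and> n - j < m")
        case True
        then have e: "\<eta> (n - j) > 0" using pos by auto
        show ?thesis
          using eventually_gt_at_top[of 0] eventually_ge_at_top[of "1 / \<eta> (n - j)"]
        proof eventually_elim
          case (elim R)
          have "1 \<le> R * \<eta> (n - j)" using elim(2) e by (simp add: field_simps)
          then show ?case using im1[of j R] True jn elim by auto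
        qed
      next
        case False
        then have c: "n < 2 * j \<and> m \<le> n - j \<or> 2 * j = n \<or> 2 * j < n \<and> m \<le> j" using jn by linarith
        show ?thesis
          by (rule eventually_mono[OF eventually_gt_at_top[of 0]]) (use im3[OF jn(1) _ c] in simp)
      qed
      have "((\<lambda>R::real. 1 / sqrt R) \<longlongrightarrow> 0) at_top" by real_asymp
      moreover have "eventually (\<lambda>R. norm (of_real (1 / sqrt R) / \<Lambda> R j) \<le> 1 / sqrt R) at_top"
        using ev1 eventually_gt_at_top[of 0]
      proof eventually_elim
        case (elim R)
        have "1 / sqrt R / norm (\<Lambda> R j) \<le> 1 / sqrt R / 1" using elim by (intro divide_left_mono) auto
        moreover have "norm (of_real (1 / sqrt R) / \<Lambda> R j) = 1 / sqrt R / norm (\<Lambda> R j)"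
          using elim by (simp only: norm_divide norm_of_real) simp
        ultimately show ?case by simp
      qed
      ultimately show "((\<lambda>R. of_real (1 / sqrt R) / \<Lambda> R j) \<longlongrightarrow> 0) at_top"
        by (rule Lim_null_comparison[rotated])
    next
      have "\<nu> \<noteq> 0" using \<nu> by auto
      then show "eventually (\<lambda>R. complex_of_real (1 / sqrt R) \<noteq> 0 \<and>
          (\<forall>j. j0 + \<alpha> \<le> j \<and> j < j0 + \<alpha> + \<beta> \<longrightarrow> \<Lambda> R j \<noteq> 0)) at_top"
        by (intro eventually_mono[OF eventually_gt_at_top[of 0]]) (auto simp: \<Lambda>_def row_phase_nonzero)
    qed
    then show "eventually (\<lambda>R. cdet n (mixed_vandermonde \<alpha> j0 x y
        (row_phase n \<nu> (\<lambda>l. of_real (G l) - \<i> * of_real (R * \<eta> l)))) \<noteq> 0) at_top"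
      using n by (simp add: \<Lambda>_def)
  qed
qed

text \<open>The determinant is a holomorphic function of \<open>z\<close> on a vertical strip around
  0 and does not vanish at \<open>- \<i> * R\<close> for large \<open>R\<close>. Its zeros are
  therefore isolated, so that small positive \<open>z\<close> avoid them even if 0 is itself a
  zero.\<close>

lemma mixed_vandermonde_perturb:
  assumes n: "n \<ge> 3" "\<alpha> + \<beta> = n" "\<alpha> \<ge> 1" "\<beta> \<ge> 1"
    and x: "inj_on x {..<\<alpha>}" "\<And>c. c < \<alpha> \<Longrightarrow> x c \<noteq> 0"
    and y: "inj_on y {..<\<beta>}" "\<And>c. c < \<beta> \<Longrightarrow> y c \<noteq> 0"
    and \<nu>: "norm \<nu> = 1" and G: "\<And>l. 2 * l < n \<Longrightarrow> \<bar>G l\<bar> < 1"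
  obtains m j0 where "2 \<le> m" "2 * m \<le> n + 1" "j0 \<le> 1"
    "\<And>\<eta> :: nat \<Rightarrow> real. (\<And>l. l < m \<Longrightarrow> \<eta> l > 0) \<Longrightarrow> (\<And>l. m \<le> l \<Longrightarrow> 2 * l < n \<Longrightarrow> \<eta> l = 0) \<Longrightarrow>
      eventually (\<lambda>z. cdet n (mixed_vandermonde \<alpha> j0 x y
        (row_phase n \<nu> (\<lambda>l. of_real (G l + z * \<eta> l)))) \<noteq> 0) (at_right 0)"
proof -
  show ?thesis
  proof (rule mixed_vandermonde_imaginary[OF assms(1-9) G])
    fix m j0 assume m: "2 \<le> m" "2 * m \<le> n + 1" "j0 \<le> 1" and
    im: "\<And>\<eta> :: nat \<Rightarrow> real. (\<And>l. l < m \<Longrightarrow> \<eta> l > 0) \<Longrightarrow> (\<And>l. m \<le> l \<Longrightarrow> 2 * l < n \<Longrightarrow> \<eta> l = 0) \<Longrightarrow>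
      eventually (\<lambda>R. cdet n (mixed_vandermonde \<alpha> j0 x y
        (row_phase n \<nu> (\<lambda>l. of_real (G l) - \<i> * of_real (R * \<eta> l)))) \<noteq> 0) at_top"
  show ?thesis
  proof (rule that[OF m])
    fix \<eta> :: "nat \<Rightarrow> real"
    assume pos: "\<And>l. l < m \<Longrightarrow> \<eta> l > 0" and zero: "\<And>l. m \<le> l \<Longrightarrow> 2 * l < n \<Longrightarrow> \<eta> l = 0"
    define w where "w z l = of_real (G l) + z * of_real (\<eta> l)" for z :: complex and l
    define f where "f z = cdet n (mixed_vandermonde \<alpha> j0 x y (row_phase n \<nu> (w z)))" for z
    have "eventually (\<lambda>\<rho>. \<forall>l\<in>{l. 2 * l < n}. \<rho> * \<bar>\<eta> l\<bar> < 1 - \<bar>G l\<bar>) (at_right (0::real))"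
    proof (rule eventually_ball_finite)
      show "finite {l. 2 * l < n}" by (rule finite_subset[of _ "{..<n}"]) auto
      show "\<forall>l\<in>{l. 2 * l < n}. \<forall>\<^sub>F \<rho> in at_right (0::real). \<rho> * \<bar>\<eta> l\<bar> < 1 - \<bar>G l\<bar>"
      proof
        fix l assume "l \<in> {l. 2 * l < n}"
        then have "0 * \<bar>\<eta> l\<bar> < 1 - \<bar>G l\<bar>" using G by auto
        moreover have "((\<lambda>\<rho>::real. \<rho> * \<bar>\<eta> l\<bar>) \<longlongrightarrow> 0 * \<bar>\<eta> l\<bar>) (at_right 0)" by (intro tendsto_intros)
        ultimately show "\<forall>\<^sub>F \<rho> in at_right (0::real). \<rho> * \<bar>\<eta> l\<bar> < 1 - \<bar>G l\<bar>" by (rule order_tendstoD(2)[rotated])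
      qed
    qed
    then have "eventually (\<lambda>\<rho>. \<rho> > 0 \<and> (\<forall>l\<in>{l. 2 * l < n}. \<rho> * \<bar>\<eta> l\<bar> < 1 - \<bar>G l\<bar>)) (at_right (0::real))"
      using eventually_at_right_less by eventually_elim auto
    then obtain \<rho> where \<rho>: "\<rho> > 0" "\<And>l. 2 * l < n \<Longrightarrow> \<rho> * \<bar>\<eta> l\<bar> < 1 - \<bar>G l\<bar>"
      using eventually_happens'[OF trivial_limit_at_right_real] by blast
    \<comment> \<open>The strip is narrow enough to keep every argument of
      \<open>unit_branch\<close> in its domain of holomorphy, and unbounded in the imaginary
      direction.\<close>
    define S where "S = {z. Re z < \<rho>} \<inter> {z. Re z > - \<rho>}"
    have S: "open S" "convex S" unfolding S_def
      by (intro open_Int convex_Int open_halfspace_Re_lt open_halfspace_Re_gt convex_halfspace_Re_lt convex_halfspace_Re_gt)+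
    have Re: "\<bar>Re (w z l)\<bar> < 1" if "z \<in> S" "2 * l < n" for z l
    proof -
      have "\<bar>Re (w z l)\<bar> \<le> \<bar>G l\<bar> + \<bar>Re z\<bar> * \<bar>\<eta> l\<bar>" by (simp add: w_def abs_mult[symmetric])
      also have "\<dots> \<le> \<bar>G l\<bar> + \<rho> * \<bar>\<eta> l\<bar>" using that by (intro add_left_mono mult_right_mono) (auto simp: S_def)
      also have "\<dots> < 1" using \<rho>(2)[OF that(2)] by simp
      finally show ?thesis .
    qed
    have \<nu>0: "\<nu> \<noteq> 0" using \<nu> by auto
    have hol: "f holomorphic_on S" unfolding f_def
    proof (rule holomorphic_on_cdet)
      fix i c assume ic: "i < n" "c < n"
      have r: "(\<lambda>z. row_phase n \<nu> (w z) (j0 + i)) holomorphic_on S"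
      proof (rule holomorphic_row_phase[OF \<nu>0])
        show "j0 + i \<le> n" using ic m by simp
        show "(\<lambda>z. w z l) holomorphic_on S" for l
          unfolding w_def by (intro holomorphic_intros)
      qed (rule Re)
      show "(\<lambda>z. mixed_vandermonde \<alpha> j0 x y (row_phase n \<nu> (w z)) i c) holomorphic_on S"
        unfolding mixed_vandermonde_def by (cases "c < \<alpha>") (auto intro!: holomorphic_intros r)
    qed
    have z0: "0 \<in> S" using \<rho>(1) by (simp add: S_def)
    obtain R where R: "f (- \<i> * of_real R) \<noteq> 0"
    proof -
      have "eventually (\<lambda>R. f (- \<i> * of_real R) \<noteq> 0) at_top"
      proof -
        have weq: "(\<lambda>l. of_real (G l) - \<i> * of_real (R * \<eta> l)) = w (- \<i> * of_real R)" for R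
          by (simp add: w_def fun_eq_iff)
        show ?thesis using im[of \<eta>, OF pos zero] unfolding f_def weq .
      qed
      then show ?thesis using that eventually_happens'[OF trivial_limit_at_top_linorder] by blast
    qed
    have "Re (- \<i> * of_real R) = 0" by simp
    then have RS: "- \<i> * of_real R \<in> S" using \<rho>(1) unfolding S_def by (metis IntI mem_Collect_eq neg_less_0_iff_less)
    have "eventually (\<lambda>z. f z \<noteq> 0) (at 0)"
    proof (cases "f 0 = 0")
      case True
      show ?thesis
      proof (rule isolated_zeros[OF hol S(1) convex_connected[OF S(2)] z0 True RS R])
        fix r assume "0 < r" "\<And>z. z \<in> ball 0 r - {0} \<Longrightarrow> f z \<noteq> 0"
        then show ?thesis unfolding eventually_at by (auto intro!: exI[of _ r])
      qed
    next
      case False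
      have "isCont f 0" using holomorphic_on_imp_continuous_on[OF hol] S(1) z0
        by (simp add: continuous_on_eq_continuous_at)
      then show ?thesis using False by (intro tendsto_imp_eventually_ne[of f "f 0"]) (auto simp: isCont_def)
    qed
    moreover have "filterlim complex_of_real (at 0) (at_right 0)"
    proof -
      have "(complex_of_real \<longlongrightarrow> of_real 0) (at_right 0)" by (intro tendsto_intros)
      moreover have "eventually (\<lambda>z. complex_of_real z \<noteq> 0) (at_right 0)"
        using eventually_at_right_less[of 0] by eventually_elim auto
      ultimately show ?thesis by (auto intro: filterlim_atI)
    qed
    ultimately have "eventually (\<lambda>z. f (of_real z) \<noteq> 0) (at_right 0)"
      by (rule eventually_compose_filterlim)
    then show "eventually (\<lambda>z. cdet n (mixed_vandermonde \<alpha> j0 x y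
        (row_phase n \<nu> (\<lambda>l. of_real (G l + z * \<eta> l)))) \<noteq> 0) (at_right 0)"
      by (simp add: f_def w_def[abs_def])
  qed
  qed
qed

section \<open>Lagrange interpolation below a square root\<close>

definition interp :: "(nat \<Rightarrow> 'a::field) \<Rightarrow> nat \<Rightarrow> (nat \<Rightarrow> 'a) \<Rightarrow> 'a poly" where
  "interp X P v = (\<Sum>l<P. smult (v l / (\<Prod>i\<in>{..<P} - {l}. X l - X i)) (\<Prod>i\<in>{..<P} - {l}. [:- X i, 1:]))"

lemma degree_interp_less:
  assumes "P > 0"
  shows "degree (interp X P v) < P"
proof -
  have "degree (interp X P v) \<le> P - 1" unfolding interp_def
  proof (rule degree_sum_le)
    fix l assume l: "l \<in> {..<P}"
    have "degree (\<Prod>i\<in>{..<P} - {l}. [:- X i, 1:]) \<le> (\<Sum>i\<in>{..<P} - {l}. degree [:- X i, 1:])"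
      by (rule degree_prod_sum_le[unfolded comp_def]) auto
    also have "\<dots> = P - 1" using l by simp
    finally show "degree (smult (v l / (\<Prod>i\<in>{..<P} - {l}. X l - X i)) (\<Prod>i\<in>{..<P} - {l}. [:- X i, 1:])) \<le> P - 1"
      using degree_smult_le order_trans by blast
  qed auto
  then show ?thesis using assms by linarith
qed

lemma poly_interp_node:
  assumes "inj_on X {..<P}" "j < P"
  shows "poly (interp X P v) (X j) = v j"
proof -
  have "poly (interp X P v) (X j) =
      (\<Sum>l<P. v l / (\<Prod>i\<in>{..<P} - {l}. X l - X i) * (\<Prod>i\<in>{..<P} - {l}. X j - X i))"
    by (simp add: interp_def poly_sum poly_prod)
  also have "\<dots> = (\<Sum>l<P. if l = j then v j else 0)"
  proof (rule sum.cong)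
    fix l assume l: "l \<in> {..<P}"
    show "v l / (\<Prod>i\<in>{..<P} - {l}. X l - X i) * (\<Prod>i\<in>{..<P} - {l}. X j - X i) = (if l = j then v j else 0)"
    proof (cases "l = j")
      case True
      have "(\<Prod>i\<in>{..<P} - {j}. X j - X i) \<noteq> 0" using assms by (auto simp: inj_on_def)
      then show ?thesis using True by simp
    next
      case False
      then have "(\<Prod>i\<in>{..<P} - {l}. X j - X i) = 0" using assms by (intro prod_zero) auto
      then show ?thesis using False by simp
    qed
  qed simp
  also have "\<dots> = v j" using assms by simp
  finally show ?thesis .
qed

lemma poly_eq_if_agree_on_nodes:
  fixes X :: "nat \<Rightarrow> 'a::{comm_ring_1,ring_no_zero_divisors}"
  assumes "inj_on X {..<P}" "degree p < P" "degree q < P" "\<And>l. l < P \<Longrightarrow> poly p (X l) = poly q (X l)"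
  shows "p = q"
proof (rule poly_eqI_degree[of "X ` {..<P}"])
  have "card (X ` {..<P}) = P" using assms(1) by (simp add: card_image)
  then show "degree p < card (X ` {..<P})" "degree q < card (X ` {..<P})" using assms by auto
qed (use assms in auto)

text \<open>At a fixed point, interpolation is a fixed linear functional of the data; limits of the
  data pass through it.\<close>

lemma poly_interp_sum:
  "poly (interp X P v) x = (\<Sum>l<P. v l * poly (interp X P (\<lambda>i. if i = l then 1 else 0)) x)"
proof -
  define c where "c l = 1 / (\<Prod>i\<in>{..<P} - {l}. X l - X i) * (\<Prod>i\<in>{..<P} - {l}. x - X i)" for l
  have gen: "poly (interp X P v) x = (\<Sum>l<P. v l * c l)" for v
    by (simp add: interp_def poly_sum poly_prod c_def)
  have "poly (interp X P (\<lambda>i. if i = l then 1 else 0)) x = c l" if "l < P" for l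
  proof -
    have "poly (interp X P (\<lambda>i. if i = l then 1 else 0)) x = (\<Sum>j<P. if j = l then c j else 0)"
      unfolding gen by (rule sum.cong) auto
    then show ?thesis using that by simp
  qed
  then show ?thesis unfolding gen[of v] by simp
qed

section \<open>The sign of the interpolation error to the left of all nodes\<close>

definition node_poly :: "(nat \<Rightarrow> real) \<Rightarrow> nat \<Rightarrow> real poly" where
  "node_poly X P = (\<Prod>l<P. [:- X l, 1:])"

lemma node_poly_props:
  shows "degree (node_poly X P) = P" "lead_coeff (node_poly X P) = 1"
    "l < P \<Longrightarrow> poly (node_poly X P) (X l) = 0"
proof -
  show "degree (node_poly X P) = P" unfolding node_poly_def by (subst degree_prod_eq_sum_degree) auto
  show "lead_coeff (node_poly X P) = 1" unfolding node_poly_def lead_coeff_prod by simp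
  show "poly (node_poly X P) (X l) = 0" if "l < P"
    unfolding node_poly_def poly_prod using that by (intro prod_zero) auto
qed

lemma node_poly_sign:
  assumes "\<And>l. l < P \<Longrightarrow> x < X l"
  shows "(-1) ^ P * poly (node_poly X P) x > 0"
proof -
  have "(-1) ^ P * poly (node_poly X P) x = (\<Prod>l<P. -1) * (\<Prod>l<P. x - X l)"
    unfolding node_poly_def poly_prod by simp
  also have "\<dots> = (\<Prod>l<P. X l - x)" unfolding prod.distrib[symmetric] by simp
  also have "\<dots> > 0" using assms by (intro prod_pos) auto
  finally show ?thesis .
qed

text \<open>Interpolating a polynomial means reducing it modulo the node polynomial. The error is
  the node polynomial, of known sign left of the nodes, times the quotient \<open>h\<close>, which
  is constant or linear in the applications.\<close>

lemma interp_remainder: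
  assumes X: "inj_on X {..<P}" "P > 0"
    and g: "g = node_poly X P * h + r" "degree r < P"
  shows "poly (interp X P (\<lambda>l. poly g (X l))) x = poly g x - poly (node_poly X P) x * poly h x"
proof -
  have "interp X P (\<lambda>l. poly g (X l)) = r"
    by (rule poly_eq_if_agree_on_nodes[OF X(1)])
       (use X g in \<open>auto simp: degree_interp_less poly_interp_node node_poly_props\<close>)
  then show ?thesis using g by simp
qed

lemma degree_less_if_coeff:
  assumes "P > 0" "\<And>i. i \<ge> P \<Longrightarrow> poly.coeff r i = 0"
  shows "degree r < P"
  using assms by (metis degree_le leading_coeff_0_iff degree_0 not_le)

text \<open>The polynomials to be interpolated have degree \<open>P\<close> or \<open>P + 1\<close>,
  so the quotients of these two monomials determine theirs.\<close>

lemma monom_eq_node_poly: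
  assumes "P > 0"
  obtains r c s where "monom 1 P = node_poly X P + r" "degree r < P"
    "monom 1 (Suc P) = node_poly X P * [:c, 1:] + s" "degree s < P"
proof -
  let ?N = "node_poly X P"
  have N: "poly.coeff ?N i = 0" if "i > P" for i using that by (simp add: coeff_eq_0 node_poly_props)
  have NP: "poly.coeff ?N P = 1" using node_poly_props(1,2)[of X P] by simp
  define r where "r = monom 1 P - ?N"
  have r: "degree r < P"
    by (rule degree_less_if_coeff[OF assms]) (use N NP in \<open>auto simp: r_def le_less\<close>)
  define c where "c = poly.coeff r (P - 1)"
  define s where "s = monom 1 (Suc P) - ?N * [:c, 1:]"
  have s_eq: "s = pCons 0 r - smult c ?N"
    by (simp add: s_def r_def monom_Suc algebra_simps)
  have "degree s < P"
  proof (rule degree_less_if_coeff[OF assms])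
    fix i assume i: "i \<ge> P"
    show "poly.coeff s i = 0"
    proof (cases "i = P")
      case True
      obtain P' where "P = Suc P'" using assms gr0_conv_Suc by blast
      then show ?thesis using True NP by (simp add: s_eq c_def)
    next
      case False
      then have "i > P" using i by simp
      moreover obtain i' where "i = Suc i'" using \<open>i > P\<close> by (cases i) auto
      ultimately show ?thesis using N r by (simp add: s_eq coeff_eq_0)
    qed
  qed
  then show ?thesis using r by (intro that[of r c s]) (auto simp: r_def s_def)
qed

lemma degree_monom_add_less:
  "degree (r::real poly) < P \<Longrightarrow> i < P \<Longrightarrow> degree (smult a (monom 1 i) + r) < P"
  by (metis degree_add_less degree_monom_le degree_smult_le order_le_less_trans)

lemma power_double: "(x::real) ^ (2 * i) = x ^ i * x ^ i"
  by (simp add: mult_2 power_add)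

text \<open>The degree of \<open>B\<close> and \<open>w\<close> is such that the interpolation error is the node polynomial times a
  factor of constant sign; when the parity is wrong, the shift \<open>\<sigma>\<close> makes the coefficient of \<open>x\<^sup>P\<close>
  dominate and fixes that sign.\<close>

lemma odd_direction:
  assumes X: "inj_on X {..<P}" "P \<ge> 2" "\<And>l. l < P \<Longrightarrow> X l < 1"
  obtains B :: "real poly" where "degree B \<le> P - 2"
    "\<And>x. (\<And>l. l < P \<Longrightarrow> x < X l) \<Longrightarrow>
       (1 - x\<^sup>2) * (poly B x)\<^sup>2 < poly (interp X P (\<lambda>l. (1 - (X l)\<^sup>2) * (poly B (X l))\<^sup>2)) x"
proof -
  have P0: "P > 0" using X by simp
  let ?N = "node_poly X P"
  obtain r c s where r: "monom 1 P = ?N + r" "degree r < P"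
    and s: "monom 1 (Suc P) = ?N * [:c, 1:] + s" "degree s < P"
    using monom_eq_node_poly[OF P0, of X] by metis
  show ?thesis
  proof (cases "even P")
    case True
    then obtain j where "P = 2 * j" by (auto elim: evenE)
    then obtain i where i: "P = 2 * i + 2" using X(2) by (intro that[of "j - 1"]) auto
    \<comment> \<open>Then \<open>(1 - x\<^sup>2) * (poly B x)\<^sup>2\<close> has leading term
      \<open>- x ^ P\<close> and quotient -1, while the node polynomial is positive to the
      left.\<close>
    define B :: "real poly" where "B = monom 1 i"
    define g :: "real poly" where "g = ?N * [:-1:] + (smult 1 (monom 1 (2 * i)) + (- r))"
    have "degree (smult 1 (monom 1 (2 * i)) + (- r)) < P"
      by (rule degree_monom_add_less) (use i r in auto)
    note rem = interp_remainder[OF X(1) P0 g_def this]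
    have geq: "g = monom 1 (2 * i) - monom 1 P" unfolding g_def r(1) by simp
    have g: "poly g x = (1 - x\<^sup>2) * (poly B x)\<^sup>2" for x
      unfolding geq by (simp add: B_def poly_monom i power_add power_double) (simp add: algebra_simps power2_eq_square)
    show ?thesis
    proof (rule that[of B])
      show "degree B \<le> P - 2" using i by (simp add: B_def degree_monom_eq)
      fix x assume x: "\<And>l. l < P \<Longrightarrow> x < X l"
      have "poly ?N x > 0" using node_poly_sign[of P x X] x True by simp
      then show "(1 - x\<^sup>2) * (poly B x)\<^sup>2 < poly (interp X P (\<lambda>l. (1 - (X l)\<^sup>2) * (poly B (X l))\<^sup>2)) x"
        using rem[of x] unfolding g by simp
    qed
  next
    case False
    then obtain j where "P = 2 * j + 1" by (auto elim: oddE)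
    then obtain i where i: "P = 2 * i + 3" using X(2) by (intro that[of "j - 1"]) auto
    \<comment> \<open>The quotient is \<open>- (x + c + 2 * \<sigma>)\<close>. Since
      \<open>x < 1\<close>, this choice makes it positive whatever \<open>c\<close> is.\<close>
    define \<sigma> where "\<sigma> = - (\<bar>c\<bar> + 2)"
    define B :: "real poly" where "B = monom 1 i * [:\<sigma>, 1:]"
    define r' where "r' = smult (1 - \<sigma>\<^sup>2) (monom 1 (2 * i + 2)) + (smult (2 * \<sigma>) (monom 1 (2 * i + 1)) +
        (smult (\<sigma>\<^sup>2) (monom 1 (2 * i)) + (- s - smult (2 * \<sigma>) r)))"
    define g :: "real poly" where "g = ?N * (- [:c + 2 * \<sigma>, 1:]) + r'"
    have d: "degree (- s - smult (2 * \<sigma>) r) < P"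
      using r(2) s(2) by (metis degree_diff_less degree_minus degree_smult_le order_le_less_trans)
    have "degree r' < P" unfolding r'_def
      by (intro degree_monom_add_less d) (use i in auto)
    note rem = interp_remainder[OF X(1) P0 g_def this]
    have "g = - (?N * [:c, 1:] + s) - smult (2 * \<sigma>) (?N + r) + smult (1 - \<sigma>\<^sup>2) (monom 1 (2 * i + 2)) + smult (2 * \<sigma>) (monom 1 (2 * i + 1)) +
        smult (\<sigma>\<^sup>2) (monom 1 (2 * i))"
    proof -
      have "?N * (- [:c + 2 * \<sigma>, 1:]) = - (?N * [:c, 1:]) - smult (2 * \<sigma>) ?N"
      proof -
        have "- [:c + 2 * \<sigma>, 1:] = - [:c, 1:] - [:2 * \<sigma>:]" by simp
        then show ?thesis by (simp only: right_diff_distrib mult_minus_right) simp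
      qed
      then show ?thesis unfolding g_def r'_def by (simp add: smult_add_right algebra_simps)
    qed
    then have geq: "g = - monom 1 (Suc P) - smult (2 * \<sigma>) (monom 1 P) + smult (1 - \<sigma>\<^sup>2) (monom 1 (2 * i + 2)) + smult (2 * \<sigma>) (monom 1 (2 * i + 1)) +
        smult (\<sigma>\<^sup>2) (monom 1 (2 * i))" unfolding r(1) s(1) .
    have g: "poly g x = (1 - x\<^sup>2) * (poly B x)\<^sup>2" for x
      unfolding geq by (simp add: B_def poly_monom i power_add power_double) (simp add: algebra_simps eval_nat_numeral)
    show ?thesis
    proof (rule that[of B])
      show "degree B \<le> P - 2" unfolding B_def using i
        by (intro order_trans[OF degree_mult_le]) (simp add: degree_monom_eq)
      fix x assume x: "\<And>l. l < P \<Longrightarrow> x < X l"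
      have "poly ?N x < 0" using node_poly_sign[of P x X] x False by simp
      moreover have "x + c + 2 * \<sigma> < 0" using x[OF P0] X(3)[OF P0] abs_ge_self[of c] abs_ge_zero[of c] unfolding \<sigma>_def by argo
      ultimately have "poly ?N x * (x + c + 2 * \<sigma>) > 0" by (rule mult_neg_neg)
      then show "(1 - x\<^sup>2) * (poly B x)\<^sup>2 < poly (interp X P (\<lambda>l. (1 - (X l)\<^sup>2) * (poly B (X l))\<^sup>2)) x"
        using rem[of x] unfolding g by (simp add: algebra_simps)
    qed
  qed
qed

text \<open>The weight \<open>1 + x\<close> has odd degree, so the parities are exchanged: odd
  \<open>P\<close> needs no shift. For even \<open>P\<close> the degree \<open>P div 2\<close> of
  \<open>w\<close> has to be at most \<open>P - 2\<close>, which fails for \<open>P = 2\<close>. In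
  that case \<open>w\<close> would be constant, and a linear polynomial is interpolated without
  error.\<close>

lemma even_direction:
  assumes X: "inj_on X {..<P}" "P \<ge> 3" "\<And>l. l < P \<Longrightarrow> X l < 1"
  obtains w :: "real poly" where "degree w \<le> P - 2"
    "\<And>x. (\<And>l. l < P \<Longrightarrow> x < X l) \<Longrightarrow>
       (1 + x) * (poly w x)\<^sup>2 < poly (interp X P (\<lambda>l. (1 + X l) * (poly w (X l))\<^sup>2)) x"
proof -
  have P0: "P > 0" using X by simp
  let ?N = "node_poly X P"
  obtain r c s where r: "monom 1 P = ?N + r" "degree r < P"
    and s: "monom 1 (Suc P) = ?N * [:c, 1:] + s" "degree s < P"
    using monom_eq_node_poly[OF P0, of X] by metis
  show ?thesis
  proof (cases "odd P")
    case True
    then obtain i where i: "P = 2 * i + 1" by (auto elim: oddE)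
    define w :: "real poly" where "w = monom 1 i"
    define g :: "real poly" where "g = ?N * [:1:] + (smult 1 (monom 1 (2 * i)) + r)"
    have "degree (smult 1 (monom 1 (2 * i)) + r) < P"
      by (rule degree_monom_add_less) (use i r in auto)
    note rem = interp_remainder[OF X(1) P0 g_def this]
    have geq: "g = monom 1 (2 * i) + monom 1 P" unfolding g_def r(1) by simp
    have g: "poly g x = (1 + x) * (poly w x)\<^sup>2" for x
      unfolding geq by (simp add: w_def poly_monom i power_add power_double) (simp add: algebra_simps power2_eq_square)
    show ?thesis
    proof (rule that[of w])
      show "degree w \<le> P - 2" using i X(2) by (simp add: w_def degree_monom_eq)
      fix x assume x: "\<And>l. l < P \<Longrightarrow> x < X l"
      have "poly ?N x < 0" using node_poly_sign[of P x X] x True by simp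
      then show "(1 + x) * (poly w x)\<^sup>2 < poly (interp X P (\<lambda>l. (1 + X l) * (poly w (X l))\<^sup>2)) x"
        using rem[of x] unfolding g by simp
    qed
  next
    case False
    then obtain j where j: "P = 2 * j" by (auto elim: evenE)
    define i where "i = j - 1"
    have i: "P = 2 * i + 2" "i \<ge> 1" using j X(2) by (auto simp: i_def)
    define \<sigma> where "\<sigma> = - (\<bar>c\<bar> + 2)"
    define w :: "real poly" where "w = monom 1 i * [:\<sigma>, 1:]"
    define r' where "r' = smult (2 * \<sigma> + \<sigma>\<^sup>2) (monom 1 (2 * i + 1)) +
        (smult (\<sigma>\<^sup>2) (monom 1 (2 * i)) + (s + smult (1 + 2 * \<sigma>) r))"
    define g :: "real poly" where "g = ?N * [:c + 1 + 2 * \<sigma>, 1:] + r'"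
    have d: "degree (s + smult (1 + 2 * \<sigma>) r) < P"
      using r(2) s(2) by (metis degree_add_less degree_smult_le order_le_less_trans)
    have "degree r' < P" unfolding r'_def
      by (intro degree_monom_add_less d) (use i in auto)
    note rem = interp_remainder[OF X(1) P0 g_def this]
    have "g = (?N * [:c, 1:] + s) + smult (1 + 2 * \<sigma>) (?N + r) + smult (2 * \<sigma> + \<sigma>\<^sup>2) (monom 1 (2 * i + 1)) +
        smult (\<sigma>\<^sup>2) (monom 1 (2 * i))"
    proof -
      have "?N * [:c + 1 + 2 * \<sigma>, 1:] = ?N * [:c, 1:] + smult (1 + 2 * \<sigma>) ?N"
        by (simp add: algebra_simps smult_add_left)
      then show ?thesis unfolding g_def r'_def by (simp add: smult_add_right algebra_simps)
    qed
    then have geq: "g = monom 1 (Suc P) + smult (1 + 2 * \<sigma>) (monom 1 P) + smult (2 * \<sigma> + \<sigma>\<^sup>2) (monom 1 (2 * i + 1)) +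
        smult (\<sigma>\<^sup>2) (monom 1 (2 * i))" unfolding r(1) s(1) .
    have g: "poly g x = (1 + x) * (poly w x)\<^sup>2" for x
      unfolding geq by (simp add: w_def poly_monom i power_add power_double) (simp add: algebra_simps eval_nat_numeral)
    show ?thesis
    proof (rule that[of w])
      show "degree w \<le> P - 2" unfolding w_def using i
        by (intro order_trans[OF degree_mult_le]) (simp add: degree_monom_eq)
      fix x assume x: "\<And>l. l < P \<Longrightarrow> x < X l"
      have "poly ?N x > 0" using node_poly_sign[of P x X] x False by simp
      moreover have "x + c + 1 + 2 * \<sigma> < 0" using x[OF P0] X(3)[OF P0] abs_ge_self[of c] abs_ge_zero[of c] unfolding \<sigma>_def by argo
      ultimately have "poly ?N x * (x + c + 1 + 2 * \<sigma>) < 0" by (rule mult_pos_neg)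
      then show "(1 + x) * (poly w x)\<^sup>2 < poly (interp X P (\<lambda>l. (1 + X l) * (poly w (X l))\<^sup>2)) x"
        using rem[of x] unfolding g by (simp add: algebra_simps)
    qed
  qed
qed

text \<open>Multiplying by the conjugate sum turns the difference into
  \<open>2 * \<epsilon>\<^sup>2 * g\<close> over a denominator tending to 2.\<close>

lemma sqrt_second_order:
  fixes m g :: real
  shows "((\<lambda>\<epsilon>. (1 - \<epsilon> * m - sqrt ((1 - \<epsilon> * m)\<^sup>2 - 2 * \<epsilon>\<^sup>2 * g)) / \<epsilon>\<^sup>2) \<longlongrightarrow> g) (at_right 0)"
proof -
  define s where "s \<epsilon> = sqrt ((1 - \<epsilon> * m)\<^sup>2 - 2 * \<epsilon>\<^sup>2 * g)" for \<epsilon>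
  have lim: "(s \<longlongrightarrow> sqrt ((1 - 0 * m)\<^sup>2 - 2 * 0\<^sup>2 * g)) (at_right 0)" unfolding s_def
    by (intro tendsto_intros)
  have lim2: "((\<lambda>\<epsilon>. 1 - \<epsilon> * m) \<longlongrightarrow> 1 - 0 * m) (at_right 0)" by (intro tendsto_intros)
  have "((\<lambda>\<epsilon>. 2 * g / (1 - \<epsilon> * m + s \<epsilon>)) \<longlongrightarrow> 2 * g / (1 - 0 * m + sqrt ((1 - 0 * m)\<^sup>2 - 2 * 0\<^sup>2 * g))) (at_right 0)"
    by (intro tendsto_divide tendsto_add tendsto_const lim lim2) simp
  then have L: "((\<lambda>\<epsilon>. 2 * g / (1 - \<epsilon> * m + s \<epsilon>)) \<longlongrightarrow> g) (at_right 0)" by simp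
  have "((\<lambda>\<epsilon>. (1 - \<epsilon> * m)\<^sup>2 - 2 * \<epsilon>\<^sup>2 * g) \<longlongrightarrow> (1 - 0 * m)\<^sup>2 - 2 * 0\<^sup>2 * g) (at_right 0)" by (intro tendsto_intros)
  then have e1: "eventually (\<lambda>\<epsilon>. (1 - \<epsilon> * m)\<^sup>2 - 2 * \<epsilon>\<^sup>2 * g > 0) (at_right 0)"
    by (rule order_tendstoD) simp
  have e2: "eventually (\<lambda>\<epsilon>. 1 - \<epsilon> * m > 0) (at_right 0)"
    using lim2 by (rule order_tendstoD) simp
  have "eventually (\<lambda>\<epsilon>. 2 * g / (1 - \<epsilon> * m + s \<epsilon>) = (1 - \<epsilon> * m - s \<epsilon>) / \<epsilon>\<^sup>2) (at_right 0)"
    using e1 e2 eventually_at_right_less[of 0]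
  proof eventually_elim
    case (elim \<epsilon>)
    have s0: "s \<epsilon> > 0" "(s \<epsilon>)\<^sup>2 = (1 - \<epsilon> * m)\<^sup>2 - 2 * \<epsilon>\<^sup>2 * g" using elim by (auto simp: s_def)
    have "(1 - \<epsilon> * m - s \<epsilon>) * (1 - \<epsilon> * m + s \<epsilon>) = 2 * g * \<epsilon>\<^sup>2"
      using s0(2) by (simp add: power2_eq_square algebra_simps)
    moreover have "1 - \<epsilon> * m + s \<epsilon> \<noteq> 0" using elim s0 by linarith
    ultimately show ?case using elim by (simp add: divide_eq_eq eq_divide_eq mult.commute)
  qed
  then show ?thesis using L unfolding s_def[symmetric] by (rule Lim_transform_eventually[rotated])
qed

text \<open>The polynomial \<open>1 - \<epsilon> * m\<close> is reproduced exactly by interpolation.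
  Hence the interpolant of the root differs from the root only in order
  \<open>\<epsilon>\<^sup>2\<close>, with coefficient \<open>g\<close> minus its interpolant, which
  is negative at \<open>x\<close>. The interpolant is close to 1, hence positive, so squaring keeps
  the inequality.\<close>

lemma interp_sqrt_less:
  fixes m :: "real poly" and g :: "real \<Rightarrow> real"
  assumes X: "inj_on X {..<P}" "P > 0" and m: "degree m < P"
    and g: "g x < poly (interp X P (\<lambda>l. g (X l))) x"
  shows "eventually (\<lambda>\<epsilon>. (poly (interp X P (\<lambda>l. sqrt ((1 - \<epsilon> * poly m (X l))\<^sup>2 - 2 * \<epsilon>\<^sup>2 * g (X l)))) x)\<^sup>2
     < (1 - \<epsilon> * poly m x)\<^sup>2 - 2 * \<epsilon>\<^sup>2 * g x) (at_right 0)"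
proof -
  define L where "L l = poly (interp X P (\<lambda>i. if i = l then 1 else 0)) x" for l
  define s where "s \<epsilon> y = sqrt ((1 - \<epsilon> * poly m y)\<^sup>2 - 2 * \<epsilon>\<^sup>2 * g y)" for \<epsilon> y
  define J where "J \<epsilon> = (\<Sum>l<P. s \<epsilon> (X l) * L l)" for \<epsilon>
  have J: "poly (interp X P (\<lambda>l. s \<epsilon> (X l))) x = J \<epsilon>" for \<epsilon>
    unfolding J_def L_def by (rule poly_interp_sum)
  have Jg: "poly (interp X P (\<lambda>l. g (X l))) x = (\<Sum>l<P. g (X l) * L l)"
    unfolding L_def by (rule poly_interp_sum)
  have M: "1 - \<epsilon> * poly m x = (\<Sum>l<P. (1 - \<epsilon> * poly m (X l)) * L l)" for \<epsilon>
  proof -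
    define q where "q = 1 - smult \<epsilon> m"
    have "degree q < P" unfolding q_def using m X(2)
      by (metis degree_1 degree_diff_less degree_smult_le order_le_less_trans)
    then have "interp X P (\<lambda>l. poly q (X l)) = q"
      by (intro poly_eq_if_agree_on_nodes[OF X(1)]) (use X in \<open>auto simp: degree_interp_less poly_interp_node\<close>)
    then have "poly q x = (\<Sum>l<P. poly q (X l) * L l)"
      unfolding L_def poly_interp_sum[symmetric] by simp
    then show ?thesis by (simp add: q_def)
  qed
  have t: "((\<lambda>\<epsilon>. (1 - \<epsilon> * poly m y - s \<epsilon> y) / \<epsilon>\<^sup>2) \<longlongrightarrow> g y) (at_right 0)" for y
    unfolding s_def by (rule sqrt_second_order)
  have "((\<lambda>\<epsilon>. (\<Sum>l<P. (1 - \<epsilon> * poly m (X l) - s \<epsilon> (X l)) / \<epsilon>\<^sup>2 * L l) - (1 - \<epsilon> * poly m x - s \<epsilon> x) / \<epsilon>\<^sup>2)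
     \<longlongrightarrow> (\<Sum>l<P. g (X l) * L l) - g x) (at_right 0)"
    by (intro tendsto_diff tendsto_sum tendsto_mult tendsto_const t)
  then have "eventually (\<lambda>\<epsilon>. (\<Sum>l<P. (1 - \<epsilon> * poly m (X l) - s \<epsilon> (X l)) / \<epsilon>\<^sup>2 * L l) - (1 - \<epsilon> * poly m x - s \<epsilon> x) / \<epsilon>\<^sup>2 > 0) (at_right 0)"
    by (rule order_tendstoD(1)) (use g Jg in simp)
  moreover have "eventually (\<lambda>\<epsilon>. J \<epsilon> > 0) (at_right 0)"
  proof -
    have st: "((\<lambda>\<epsilon>. s \<epsilon> y) \<longlongrightarrow> sqrt ((1 - 0 * poly m y)\<^sup>2 - 2 * 0\<^sup>2 * g y)) (at_right 0)" for y
      unfolding s_def by (intro tendsto_intros)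
    have "(J \<longlongrightarrow> (\<Sum>l<P. sqrt ((1 - 0 * poly m (X l))\<^sup>2 - 2 * 0\<^sup>2 * g (X l)) * L l)) (at_right 0)"
      unfolding J_def by (intro tendsto_sum tendsto_mult tendsto_const st)
    then have "(J \<longlongrightarrow> (\<Sum>l<P. L l)) (at_right 0)" by simp
    moreover have "(\<Sum>l<P. L l) = 1" using M[of 0] by simp
    ultimately show ?thesis by (intro order_tendstoD(1)) auto
  qed
  ultimately show ?thesis using eventually_at_right_less[of 0]
  proof eventually_elim
    case (elim \<epsilon>)
    have "(\<Sum>l<P. (1 - \<epsilon> * poly m (X l) - s \<epsilon> (X l)) / \<epsilon>\<^sup>2 * L l) =
        ((\<Sum>l<P. (1 - \<epsilon> * poly m (X l)) * L l) - J \<epsilon>) / \<epsilon>\<^sup>2"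
      by (simp add: J_def sum_divide_distrib[symmetric] sum_subtractf[symmetric] algebra_simps)
    also have "\<dots> = (1 - \<epsilon> * poly m x - J \<epsilon>) / \<epsilon>\<^sup>2" unfolding M[symmetric] ..
    finally have "(1 - \<epsilon> * poly m x - J \<epsilon>) / \<epsilon>\<^sup>2 - (1 - \<epsilon> * poly m x - s \<epsilon> x) / \<epsilon>\<^sup>2 > 0"
      using elim(1) by simp
    then have "(s \<epsilon> x - J \<epsilon>) / \<epsilon>\<^sup>2 > 0" by (simp add: diff_divide_distrib)
    then have lt: "J \<epsilon> < s \<epsilon> x" using elim(3) by (simp add: zero_less_divide_iff)
    then have "s \<epsilon> x > 0" using elim(2) by simp
    then have "(s \<epsilon> x)\<^sup>2 = (1 - \<epsilon> * poly m x)\<^sup>2 - 2 * \<epsilon>\<^sup>2 * g x" by (simp add: s_def)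
    moreover have "(J \<epsilon>)\<^sup>2 < (s \<epsilon> x)\<^sup>2" using lt elim(2) by (intro power_strict_mono) auto
    ultimately show ?case unfolding s_def[symmetric] J by simp
  qed
qed

lemma interp_cong: "(\<And>l. l < P \<Longrightarrow> v l = w l) \<Longrightarrow> interp X P v = interp X P w"
  unfolding interp_def by (intro sum.cong) auto

text \<open>The last inequality is strict contraction at the roots of unity outside the prescribed
  rows, whose cosines will form \<open>T\<close>. For \<open>B = 0\<close>, which corresponds to a
  monomial, it is an equality; a small multiple of the polynomial from \<open>odd_direction\<close>
  makes it strict at all points of the finite set \<open>T\<close> at once.\<close>

lemma odd_base:
  fixes X :: "nat \<Rightarrow> real"
  assumes X: "inj_on X {..<P}" "P \<ge> 2" "\<And>l. l < P \<Longrightarrow> X l < 1"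
    and T: "finite T" "\<And>x l. x \<in> T \<Longrightarrow> l < P \<Longrightarrow> x < X l"
  obtains B :: "real poly" where "degree B \<le> P - 2"
    "\<And>l. l < P \<Longrightarrow> (1 - (X l)\<^sup>2) * (poly B (X l))\<^sup>2 < 1"
    "\<And>x. x \<in> T \<Longrightarrow>
       (poly (interp X P (\<lambda>l. sqrt (1 - (1 - (X l)\<^sup>2) * (poly B (X l))\<^sup>2))) x)\<^sup>2
         < 1 - (1 - x\<^sup>2) * (poly B x)\<^sup>2"
proof -
  obtain B :: "real poly" where B: "degree B \<le> P - 2"
    "\<And>x. (\<And>l. l < P \<Longrightarrow> x < X l) \<Longrightarrow>
       (1 - x\<^sup>2) * (poly B x)\<^sup>2 < poly (interp X P (\<lambda>l. (1 - (X l)\<^sup>2) * (poly B (X l))\<^sup>2)) x"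
    using odd_direction[OF X] by blast
  define g where "g x = (1 - x\<^sup>2) * (poly B x)\<^sup>2" for x
  have "eventually (\<lambda>\<epsilon>. \<forall>x\<in>T. (poly (interp X P (\<lambda>l. sqrt ((1 - \<epsilon> * poly 0 (X l))\<^sup>2 - 2 * \<epsilon>\<^sup>2 * g (X l)))) x)\<^sup>2
     < (1 - \<epsilon> * poly 0 x)\<^sup>2 - 2 * \<epsilon>\<^sup>2 * g x) (at_right 0)"
    using T(1)
  proof (rule eventually_ball_finite, intro ballI)
    fix x assume "x \<in> T"
    then show "eventually (\<lambda>\<epsilon>. (poly (interp X P (\<lambda>l. sqrt ((1 - \<epsilon> * poly 0 (X l))\<^sup>2 - 2 * \<epsilon>\<^sup>2 * g (X l)))) x)\<^sup>2
     < (1 - \<epsilon> * poly 0 x)\<^sup>2 - 2 * \<epsilon>\<^sup>2 * g x) (at_right 0)"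
      using X B(2)[OF T(2)] by (intro interp_sqrt_less) (auto simp: g_def)
  qed
  moreover have "eventually (\<lambda>\<epsilon>. \<forall>l\<in>{..<P}. 2 * \<epsilon>\<^sup>2 * g (X l) < 1) (at_right 0)"
  proof (rule eventually_ball_finite, simp, intro ballI)
    fix l assume "l \<in> {..<P}"
    have "((\<lambda>\<epsilon>. 2 * \<epsilon>\<^sup>2 * g (X l)) \<longlongrightarrow> 2 * 0\<^sup>2 * g (X l)) (at_right 0)" by (intro tendsto_intros)
    then show "eventually (\<lambda>\<epsilon>. 2 * \<epsilon>\<^sup>2 * g (X l) < 1) (at_right 0)" by (rule order_tendstoD) simp
  qed
  ultimately have "eventually (\<lambda>\<epsilon>. (\<forall>x\<in>T. (poly (interp X P (\<lambda>l. sqrt ((1 - \<epsilon> * poly 0 (X l))\<^sup>2 - 2 * \<epsilon>\<^sup>2 * g (X l)))) x)\<^sup>2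
     < (1 - \<epsilon> * poly 0 x)\<^sup>2 - 2 * \<epsilon>\<^sup>2 * g x) \<and> (\<forall>l\<in>{..<P}. 2 * \<epsilon>\<^sup>2 * g (X l) < 1)) (at_right 0)"
    by (rule eventually_conj)
  then obtain \<epsilon> where \<epsilon>: "\<And>x. x \<in> T \<Longrightarrow> (poly (interp X P (\<lambda>l. sqrt (1 - 2 * \<epsilon>\<^sup>2 * g (X l)))) x)\<^sup>2
     < 1 - 2 * \<epsilon>\<^sup>2 * g x" "\<And>l. l < P \<Longrightarrow> 2 * \<epsilon>\<^sup>2 * g (X l) < 1"
    using eventually_happens'[OF trivial_limit_at_right_real] by fastforce
  \<comment> \<open>The factor \<open>sqrt 2\<close> produces the 2 in front of
    \<open>\<epsilon>\<^sup>2\<close>.\<close>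
  have e: "(1 - x\<^sup>2) * (poly (smult (sqrt 2 * \<epsilon>) B) x)\<^sup>2 = 2 * \<epsilon>\<^sup>2 * g x" for x
    by (simp add: g_def power_mult_distrib)
  show ?thesis
  proof (rule that[of "smult (sqrt 2 * \<epsilon>) B"], unfold e)
    show "degree (smult (sqrt 2 * \<epsilon>) B) \<le> P - 2" using B(1) by simp
  qed (use \<epsilon> in auto)
qed

text \<open>The polynomial \<open>1 + (1 - x) * w\<close> takes the value 1 at 1. Replacing
  \<open>w\<close> by \<open>\<epsilon> * w\<close> puts the right-hand side into the form under the
  root in \<open>interp_sqrt_less\<close>.\<close>

lemma even_identity:
  fixes x w :: real
  assumes "x \<noteq> 1"
  shows "(2 - (1 + x) * (1 + (1 - x) * w)\<^sup>2) / (1 - x) = (1 - (1 + x) * w)\<^sup>2 - 2 * ((1 + x) * w\<^sup>2)"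
proof -
  have "2 - (1 + x) * (1 + (1 - x) * w)\<^sup>2 = (1 - x) * ((1 - (1 + x) * w)\<^sup>2 - 2 * ((1 + x) * w\<^sup>2))"
    by (simp add: power2_eq_square algebra_simps)
  then show ?thesis using assms by simp
qed

lemma quadratic_from_roots:
  fixes a b c :: real
  assumes "a * u\<^sup>2 + b * u + c = 0" "a * v\<^sup>2 + b * v + c = 0" "u \<noteq> v"
  shows "a * x\<^sup>2 + b * x + c = a * ((x - u) * (x - v))"
proof -
  have "(v - u) * (a * (u + v) + b) = 0"
    using assms(1,2) by (simp add: power2_eq_square algebra_simps)
  then have b: "b = - a * (u + v)" using assms(3) by simp
  have c: "c = a * u * v" using assms(1) unfolding b by (simp add: power2_eq_square algebra_simps)
  show ?thesis unfolding b c by (simp add: power2_eq_square algebra_simps)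
qed

lemma even_base:
  fixes X :: "nat \<Rightarrow> real"
  assumes X: "inj_on X {..<P}" "P \<ge> 2" "\<And>l. l < P \<Longrightarrow> -1 < X l" "\<And>l. l < P \<Longrightarrow> X l < 1"
    and T: "finite T" "\<And>x l. x \<in> T \<Longrightarrow> l < P \<Longrightarrow> x < X l"
  obtains A :: "real poly" where "degree A \<le> P - 1" "poly A 1 = 1"
    "\<And>l. l < P \<Longrightarrow> (1 + X l) * (poly A (X l))\<^sup>2 < 2"
    "\<And>x. x \<in> T \<Longrightarrow>
       (poly (interp X P (\<lambda>l. sqrt ((2 - (1 + X l) * (poly A (X l))\<^sup>2) / (1 - X l)))) x)\<^sup>2
         < (2 - (1 + x) * (poly A x)\<^sup>2) / (1 - x)"
proof -
  note result = that
  have T1: "x < 1" if "x \<in> T" for x using T(2)[OF that, of 0] X(2) X(4)[of 0] by simp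
  have fin: ?thesis if W: "degree W \<le> P - 2"
    "\<And>l. l < P \<Longrightarrow> (1 - (1 + X l) * poly W (X l))\<^sup>2 - 2 * ((1 + X l) * (poly W (X l))\<^sup>2) > 0"
    "\<And>x. x \<in> T \<Longrightarrow>
       (poly (interp X P (\<lambda>l. sqrt ((1 - (1 + X l) * poly W (X l))\<^sup>2 - 2 * ((1 + X l) * (poly W (X l))\<^sup>2)))) x)\<^sup>2
         < (1 - (1 + x) * poly W x)\<^sup>2 - 2 * ((1 + x) * (poly W x)\<^sup>2)" for W
  proof -
    define A where "A = 1 + [:1, -1:] * W"
    have A: "poly A x = 1 + (1 - x) * poly W x" for x by (simp add: A_def algebra_simps)
    have id: "(2 - (1 + x) * (poly A x)\<^sup>2) / (1 - x) = (1 - (1 + x) * poly W x)\<^sup>2 - 2 * ((1 + x) * (poly W x)\<^sup>2)"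
      if "x < 1" for x unfolding A using that by (intro even_identity) auto
    have cong: "interp X P (\<lambda>l. sqrt ((2 - (1 + X l) * (poly A (X l))\<^sup>2) / (1 - X l))) =
       interp X P (\<lambda>l. sqrt ((1 - (1 + X l) * poly W (X l))\<^sup>2 - 2 * ((1 + X l) * (poly W (X l))\<^sup>2)))"
    proof (rule interp_cong)
      fix l assume "l < P"
      then show "sqrt ((2 - (1 + X l) * (poly A (X l))\<^sup>2) / (1 - X l)) =
        sqrt ((1 - (1 + X l) * poly W (X l))\<^sup>2 - 2 * ((1 + X l) * (poly W (X l))\<^sup>2))"
        by (simp only: id[OF X(4)])
    qed
    show ?thesis
    proof (rule result[of A])
      have "degree ([:1, -1:] * W) \<le> 1 + (P - 2)"
        by (rule order_trans[OF degree_mult_le]) (use W(1) in simp)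
      then show "degree A \<le> P - 1" unfolding A_def using X(2)
        by (intro degree_add_le) simp_all
      show "poly A 1 = 1" by (simp add: A)
      show "(1 + X l) * (poly A (X l))\<^sup>2 < 2" if "l < P" for l
      proof -
        have "(2 - (1 + X l) * (poly A (X l))\<^sup>2) / (1 - X l) > 0" unfolding id[OF X(4)[OF that]] by (rule W(2)[OF that])
        moreover have "1 - X l > 0" using X(4)[OF that] by simp
        ultimately have "0 * (1 - X l) < 2 - (1 + X l) * (poly A (X l))\<^sup>2"
          by (simp only: pos_less_divide_eq)
        then show ?thesis by simp
      qed
      show "(poly (interp X P (\<lambda>l. sqrt ((2 - (1 + X l) * (poly A (X l))\<^sup>2) / (1 - X l)))) x)\<^sup>2
         < (2 - (1 + x) * (poly A x)\<^sup>2) / (1 - x)" if "x \<in> T" for x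
        unfolding cong id[OF T1[OF that]] by (rule W(3)[OF that])
    qed
  qed
  show ?thesis
  proof (cases "P = 2")
    case False
    then have P3: "P \<ge> 3" using X(2) by simp
    obtain w :: "real poly" where w: "degree w \<le> P - 2"
      "\<And>x. (\<And>l. l < P \<Longrightarrow> x < X l) \<Longrightarrow>
         (1 + x) * (poly w x)\<^sup>2 < poly (interp X P (\<lambda>l. (1 + X l) * (poly w (X l))\<^sup>2)) x"
      using even_direction[OF X(1) P3 X(4)] by blast
    define g where "g x = (1 + x) * (poly w x)\<^sup>2" for x
    define m where "m = [:1, 1:] * w"
    have "degree m \<le> 1 + (P - 2)" unfolding m_def
      by (rule order_trans[OF degree_mult_le]) (use w(1) in simp)
    then have m: "degree m < P" using P3 by linarith
    have "eventually (\<lambda>\<epsilon>. \<forall>x\<in>T. (poly (interp X P (\<lambda>l. sqrt ((1 - \<epsilon> * poly m (X l))\<^sup>2 - 2 * \<epsilon>\<^sup>2 * g (X l)))) x)\<^sup>2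
       < (1 - \<epsilon> * poly m x)\<^sup>2 - 2 * \<epsilon>\<^sup>2 * g x) (at_right 0)"
      using T(1)
    proof (rule eventually_ball_finite, intro ballI)
      fix x assume "x \<in> T"
      then show "eventually (\<lambda>\<epsilon>. (poly (interp X P (\<lambda>l. sqrt ((1 - \<epsilon> * poly m (X l))\<^sup>2 - 2 * \<epsilon>\<^sup>2 * g (X l)))) x)\<^sup>2
         < (1 - \<epsilon> * poly m x)\<^sup>2 - 2 * \<epsilon>\<^sup>2 * g x) (at_right 0)"
        using X w(2)[OF T(2)] m by (intro interp_sqrt_less) (auto simp: g_def)
    qed
    moreover have "eventually (\<lambda>\<epsilon>. \<forall>l\<in>{..<P}. (1 - \<epsilon> * poly m (X l))\<^sup>2 - 2 * \<epsilon>\<^sup>2 * g (X l) > 0) (at_right 0)"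
    proof (rule eventually_ball_finite, simp, intro ballI)
      fix l assume "l \<in> {..<P}"
      have "((\<lambda>\<epsilon>. (1 - \<epsilon> * poly m (X l))\<^sup>2 - 2 * \<epsilon>\<^sup>2 * g (X l)) \<longlongrightarrow> (1 - 0 * poly m (X l))\<^sup>2 - 2 * 0\<^sup>2 * g (X l)) (at_right 0)"
        by (intro tendsto_intros)
      then show "eventually (\<lambda>\<epsilon>. (1 - \<epsilon> * poly m (X l))\<^sup>2 - 2 * \<epsilon>\<^sup>2 * g (X l) > 0) (at_right 0)"
        by (rule order_tendstoD) simp
    qed
    ultimately have "eventually (\<lambda>\<epsilon>. (\<forall>x\<in>T. (poly (interp X P (\<lambda>l. sqrt ((1 - \<epsilon> * poly m (X l))\<^sup>2 - 2 * \<epsilon>\<^sup>2 * g (X l)))) x)\<^sup>2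
       < (1 - \<epsilon> * poly m x)\<^sup>2 - 2 * \<epsilon>\<^sup>2 * g x) \<and>
       (\<forall>l\<in>{..<P}. (1 - \<epsilon> * poly m (X l))\<^sup>2 - 2 * \<epsilon>\<^sup>2 * g (X l) > 0)) (at_right 0)"
      by (rule eventually_conj)
    then obtain \<epsilon> where \<epsilon>:
      "\<forall>x\<in>T. (poly (interp X P (\<lambda>l. sqrt ((1 - \<epsilon> * poly m (X l))\<^sup>2 - 2 * \<epsilon>\<^sup>2 * g (X l)))) x)\<^sup>2
       < (1 - \<epsilon> * poly m x)\<^sup>2 - 2 * \<epsilon>\<^sup>2 * g x"
      "\<forall>l\<in>{..<P}. (1 - \<epsilon> * poly m (X l))\<^sup>2 - 2 * \<epsilon>\<^sup>2 * g (X l) > 0"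
      by (elim eventually_happens'[OF trivial_limit_at_right_real, THEN exE] conjE)
    have e: "(1 - \<epsilon> * poly m x)\<^sup>2 - 2 * \<epsilon>\<^sup>2 * g x =
        (1 - (1 + x) * poly (smult \<epsilon> w) x)\<^sup>2 - 2 * ((1 + x) * (poly (smult \<epsilon> w) x)\<^sup>2)" for x
      by (simp add: g_def m_def power_mult_distrib algebra_simps)
    show ?thesis
    proof (rule fin[of "smult \<epsilon> w"], unfold e[symmetric])
      show "degree (smult \<epsilon> w) \<le> P - 2" using w(1) by simp
    qed (use \<epsilon> in blast)+
  next
    case True
    text \<open>With two nodes the interpolant is a chord of the square root of a convex quadratic
      \<open>(1 + x / 2)\<^sup>2 + 3 / 4\<close>, so only the leading coefficients need to be compared.\<close>
    define f :: "real \<Rightarrow> real" where "f x = (1 + x / 2)\<^sup>2 + 3 / 4" for x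
    \<comment> \<open>As there is no error of second order for two nodes, a perturbation of fixed
      size, the constant -1/2, is used in place of an infinitesimal one.\<close>
    have W: "(1 - (1 + x) * poly [:- (1/2):] x)\<^sup>2 - 2 * ((1 + x) * (poly [:- (1/2):] x)\<^sup>2) = f x" for x
      by (simp add: f_def power2_eq_square field_simps)
    have fpos: "f x > 0" for x by (simp add: f_def add_nonneg_pos)
    define s where "s l = sqrt (f (X l))" for l
    have X01: "X 0 \<noteq> X 1" "-1 < X 0" "-1 < X 1" "X 0 < 1" "X 1 < 1"
      using inj_onD[OF X(1), of 0 1] X(3,4)[of 0] X(3,4)[of 1] True by auto
    define b where "b = (s 1 - s 0) / (X 1 - X 0)"
    define L where "L = [:s 0 - b * X 0, b:]"
    have L: "poly L (X 0) = s 0" "poly L (X 1) = s 1"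
    proof -
      have "b * (X 1 - X 0) = s 1 - s 0" using X01(1) by (simp add: b_def)
      then show "poly L (X 0) = s 0" "poly L (X 1) = s 1" by (simp_all add: L_def algebra_simps)
    qed
    have "interp X P s = L"
    proof (rule poly_eq_if_agree_on_nodes[OF X(1)])
      show "degree (interp X P s) < P" using True by (intro degree_interp_less) simp
      show "degree L < P" using True by (simp add: L_def)
      show "poly (interp X P s) (X l) = poly L (X l)" if "l < P" for l
      proof -
        have "l = 0 \<or> l = 1" using that True by auto
        then show ?thesis using L poly_interp_node[OF X(1) that, of s] by auto
      qed
    qed
    \<comment> \<open>The line \<open>1 + x / 2\<close> is the asymptote of the root of
      \<open>f\<close>; lying below the root, it forces the slope \<open>b\<close> of the chord
      below 1/2.\<close>
    have sgt: "s l > 1 + X l / 2" if "l < 2" for l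
    proof -
      have "(1 + X l / 2)\<^sup>2 < f (X l)" by (simp add: f_def)
      then show ?thesis unfolding s_def by (rule real_less_rsqrt)
    qed
    have ssq: "(s l)\<^sup>2 = f (X l)" for l using fpos[of "X l"] by (simp add: s_def)
    have "(X 1 - X 0) * (b * (s 1 + s 0)) = (s 1)\<^sup>2 - (s 0)\<^sup>2"
      using X01(1) by (simp add: b_def power2_eq_square square_diff_square_factored)
    also have "\<dots> = (X 1 - X 0) * ((1 + X 0 / 2 + (1 + X 1 / 2)) / 2)"
      unfolding ssq f_def by (simp add: power2_eq_square algebra_simps add_divide_distrib diff_divide_distrib)
    finally have beq: "b * (s 1 + s 0) = (1 + X 0 / 2 + (1 + X 1 / 2)) / 2"
      using X01(1) by (simp only: mult_cancel_left) auto
    have pos: "1 + X 0 / 2 + (1 + X 1 / 2) > 0" using X01 by simp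
    have ss: "s 1 + s 0 > 1 + X 0 / 2 + (1 + X 1 / 2)" using sgt[of 0] sgt[of 1] by simp
    have "b * (s 1 + s 0) > 0" unfolding beq using pos by simp
    then have b0: "b > 0" using pos ss by (simp add: zero_less_mult_iff)
    have bhalf: "b < 1 / 2"
    proof (rule ccontr)
      assume "\<not> b < 1 / 2"
      then have "1 / 2 * (s 1 + s 0) \<le> b * (s 1 + s 0)" using ss pos by (intro mult_right_mono) auto
      then show False using beq ss by simp
    qed
    have "b\<^sup>2 < (1 / 2)\<^sup>2" using b0 bhalf by (intro power_strict_mono) auto
    then have b2: "b\<^sup>2 - 1 / 4 < 0" by (simp add: power2_eq_square)
    have less: "(poly L x)\<^sup>2 < f x" if x: "x < X 0" "x < X 1" for x
    proof -
      define e where "e = s 0 - b * X 0"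
      have Le: "poly L x = e + b * x" for x by (simp add: L_def e_def algebra_simps)
      have D: "(poly L x)\<^sup>2 - f x = (b\<^sup>2 - 1 / 4) * x\<^sup>2 + (2 * e * b - 1) * x + (e\<^sup>2 - 7 / 4)" for x
        unfolding Le f_def by (simp add: power2_eq_square algebra_simps)
      have "(b\<^sup>2 - 1 / 4) * (X 0)\<^sup>2 + (2 * e * b - 1) * X 0 + (e\<^sup>2 - 7 / 4) = 0"
        "(b\<^sup>2 - 1 / 4) * (X 1)\<^sup>2 + (2 * e * b - 1) * X 1 + (e\<^sup>2 - 7 / 4) = 0"
        unfolding D[symmetric] L ssq by simp_all
      then have "(poly L x)\<^sup>2 - f x = (b\<^sup>2 - 1 / 4) * ((x - X 0) * (x - X 1))"
        unfolding D using X01(1) by (rule quadratic_from_roots)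
      moreover have "(x - X 0) * (x - X 1) > 0" using x by (intro mult_neg_neg) auto
      ultimately show ?thesis using mult_neg_pos[OF b2] by fastforce
    qed
    show ?thesis
    proof (rule fin[of "[:- (1/2):]"], unfold W)
      show "(poly (interp X P (\<lambda>l. sqrt (f (X l)))) x)\<^sup>2 < f x" if "x \<in> T" for x
        using less[of x] T(2)[OF that] True \<open>interp X P s = L\<close> unfolding s_def[abs_def] by simp
    qed (use fpos in auto)
  qed
qed

section \<open>Trigonometric polynomials\<close>

lemma trig_poly_of_cos_poly:
  fixes p :: "real poly"
  assumes "degree p \<le> d"
  obtains R :: "complex poly" where "degree R \<le> 2 * d"
    "\<And>\<theta>. poly R (cis \<theta>) = cis (real d * \<theta>) * of_real (poly p (cos \<theta>))"
proof -
  \<comment> \<open>For \<open>z = cis \<theta>\<close> the cosine is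
    \<open>(z\<^sup>2 + 1) / (2 * z)\<close>; the factor \<open>z ^ d\<close> clears the
    denominators.\<close>
  define R :: "complex poly" where "R = (\<Sum>i\<le>d. smult (of_real (poly.coeff p i) / 2 ^ i) (monom 1 (d - i) * [:1, 0, 1:] ^ i))"
  have deg: "degree (monom (1::complex) (d - i) * [:1, 0, 1:] ^ i) \<le> 2 * d" if "i \<le> d" for i
  proof -
    have "degree (monom (1::complex) (d - i) * [:1, 0, 1:] ^ i) \<le> degree (monom (1::complex) (d - i)) + degree ([:1::complex, 0, 1:] ^ i)"
      by (rule degree_mult_le)
    also have "\<dots> \<le> (d - i) + 2 * i"
      by (intro add_mono degree_monom_le order_trans[OF degree_power_le]) simp
    finally show ?thesis using that by simp
  qed
  show ?thesis
  proof (rule that[of R])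
    show "degree R \<le> 2 * d" unfolding R_def
      by (intro degree_sum_le order_trans[OF degree_smult_le deg]) auto
    fix \<theta> :: real
    have c: "1 + cis \<theta> * cis \<theta> = 2 * of_real (cos \<theta>) * cis \<theta>"
    proof -
      have "1 + (cos \<theta> * cos \<theta> - sin \<theta> * sin \<theta>) = 2 * (cos \<theta> * cos \<theta>)"
        using sin_cos_squared_add[of \<theta>] by (simp add: power2_eq_square)
      then show ?thesis by (simp add: complex_eq_iff)
    qed
    have "poly R (cis \<theta>) = (\<Sum>i\<le>d. of_real (poly.coeff p i) / 2 ^ i * (cis \<theta> ^ (d - i) * (1 + cis \<theta> * cis \<theta>) ^ i))"
      by (simp add: R_def poly_sum poly_monom)
    also have "\<dots> = (\<Sum>i\<le>d. cis (real d * \<theta>) * of_real (poly.coeff p i * cos \<theta> ^ i))"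
    proof (rule sum.cong)
      fix i assume "i \<in> {..d}"
      then have "cis \<theta> ^ (d - i) * cis \<theta> ^ i = cis \<theta> ^ d"
        by (simp flip: power_add)
      then have "cis (real d * \<theta>) = cis \<theta> ^ (d - i) * cis \<theta> ^ i"
        using Complex.DeMoivre[of \<theta> d] by simp
      then show "of_real (poly.coeff p i) / 2 ^ i * (cis \<theta> ^ (d - i) * (1 + cis \<theta> * cis \<theta>) ^ i) =
          cis (real d * \<theta>) * of_real (poly.coeff p i * cos \<theta> ^ i)"
        unfolding c by (simp add: power_mult_distrib)
    qed simp
    also have "\<dots> = cis (real d * \<theta>) * of_real (\<Sum>i\<le>d. poly.coeff p i * cos \<theta> ^ i)"
      by (simp add: sum_distrib_left)
    also have "(\<Sum>i\<le>d. poly.coeff p i * cos \<theta> ^ i) = poly p (cos \<theta>)"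
      unfolding poly_altdef using assms by (intro sum.mono_neutral_right) (auto simp: coeff_eq_0)
    finally show "poly R (cis \<theta>) = cis (real d * \<theta>) * of_real (poly p (cos \<theta>))" .
  qed
qed

section \<open>Contractive circulant matrices with prescribed singular values\<close>

text \<open>These are the angles of the \<open>k\<close>-th roots of unity after a rotation placing
  rows 0 to \<open>n\<close> symmetrically about angle 0.\<close>

definition row_angle :: "nat \<Rightarrow> nat \<Rightarrow> nat \<Rightarrow> real" where
  "row_angle n k j = (2 * real j - real n) * (pi / real k)"

text \<open>The index \<open>l\<close> with \<open>2 * l < n\<close> stands for the mirror pair of
  rows \<open>l\<close> and \<open>n - l\<close>, which share this cosine. Pair 0 is the outermost
  one and has the smallest cosine.\<close>

definition node_cos :: "nat \<Rightarrow> nat \<Rightarrow> nat \<Rightarrow> real" where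
  "node_cos n k l = cos (row_angle n k (n - l))"

lemma row_angle_mirror: "l \<le> n \<Longrightarrow> row_angle n k (n - l) = - row_angle n k l"
  by (simp add: row_angle_def of_nat_diff algebra_simps)

lemma row_angle_bounds:
  assumes "n < k" "2 * l < n"
  shows "0 < row_angle n k (n - l)" "row_angle n k (n - l) < pi"
proof -
  have l: "real (n - l) = real n - real l" using assms by (simp add: of_nat_diff)
  have k: "real k > 0" using assms by simp
  show "0 < row_angle n k (n - l)" unfolding row_angle_def l
    using assms k by (intro mult_pos_pos divide_pos_pos) auto
  have "2 * (real n - real l) - real n < real k" using assms by simp
  then have "(2 * (real n - real l) - real n) * (pi / real k) < real k * (pi / real k)"
    using k by (intro mult_strict_right_mono divide_pos_pos) auto
  then show "row_angle n k (n - l) < pi" unfolding row_angle_def l using k by simp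
qed

lemma node_cos_bounds:
  assumes "n < k" "2 * l < n"
  shows "-1 < node_cos n k l" "node_cos n k l < 1"
proof -
  note b = row_angle_bounds[OF assms]
  show "-1 < node_cos n k l" unfolding node_cos_def
    using cos_monotone_0_pi[of "row_angle n k (n - l)" pi] b by simp
  show "node_cos n k l < 1" unfolding node_cos_def
    using cos_monotone_0_pi[of 0 "row_angle n k (n - l)"] b by simp
qed

lemma node_cos_strict_mono:
  assumes "n < k" "2 * l < n" "i < l"
  shows "node_cos n k i < node_cos n k l"
proof -
  have i: "2 * i < n" using assms by simp
  have "row_angle n k (n - l) < row_angle n k (n - i)"
    unfolding row_angle_def using assms by (intro mult_strict_right_mono divide_pos_pos) (auto simp: of_nat_diff)
  then show ?thesis unfolding node_cos_def
    using row_angle_bounds[OF assms(1,2)] row_angle_bounds[OF assms(1) i] by (intro cos_monotone_0_pi) auto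
qed

lemma inj_node_cos:
  assumes "n < k" "2 * P \<le> n + 1"
  shows "inj_on (node_cos n k) {..<P}"
proof (rule inj_onI)
  fix x y assume xy: "x \<in> {..<P}" "y \<in> {..<P}" "node_cos n k x = node_cos n k y"
  have "2 * x < n" "2 * y < n" using xy assms(2) by auto
  then show "x = y" using node_cos_strict_mono[OF assms(1)] xy(3) by (metis less_irrefl nat_neq_iff)
qed

text \<open>The remaining roots of unity lie on the complementary arc, farther from angle 0 than
  every row; angles beyond \<open>pi\<close> are reflected first.\<close>

lemma cos_outside_less:
  assumes "n < j" "j < k" "2 * l < n"
  shows "cos (row_angle n k j) < node_cos n k l"
proof -
  have k: "real k > 0" using assms by simp
  have nk: "n < k" using assms by simp
  note b = row_angle_bounds[OF nk assms(3)]
  have gt: "row_angle n k (n - l) < row_angle n k j"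
    unfolding row_angle_def using assms by (intro mult_strict_right_mono divide_pos_pos) (auto simp: of_nat_diff)
  show ?thesis
  proof (cases "row_angle n k j \<le> pi")
    case True
    then show ?thesis unfolding node_cos_def using b gt by (intro cos_monotone_0_pi) auto
  next
    case False
    have "2 * pi - row_angle n k j = (2 * real k - 2 * real j + real n) * (pi / real k)"
      unfolding row_angle_def using k by (simp add: field_simps)
    also have "\<dots> > row_angle n k (n - l)"
      unfolding row_angle_def using assms by (intro mult_strict_right_mono divide_pos_pos) (auto simp: of_nat_diff)
    finally have "cos (2 * pi - row_angle n k j) < node_cos n k l"
      unfolding node_cos_def using b False by (intro cos_monotone_0_pi) auto
    then show ?thesis by (simp add: cos_diff)
  qed
qed

text \<open>The first factor moves the centre of a polynomial of degree \<open>n - 1\<close> to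
  exponent 0, so that what remains is conjugation symmetric. The constant \<open>\<nu>\<close> will
  be 1 for odd \<open>n\<close> and \<open>\<i>\<close> for even \<open>n\<close>.\<close>

definition phase_value :: "nat \<Rightarrow> nat \<Rightarrow> complex \<Rightarrow> (nat \<Rightarrow> real) \<Rightarrow> nat \<Rightarrow> complex" where
  "phase_value n k \<nu> G j =
     cis (real (n - 1) / 2 * row_angle n k j) * row_phase n \<nu> (\<lambda>l. of_real (G l)) j"

text \<open>There are \<open>n + 1\<close> conditions on \<open>n\<close> coefficients, so only
  special \<open>G\<close> admit a solution.\<close>

definition phase_poly :: "nat \<Rightarrow> nat \<Rightarrow> complex \<Rightarrow> (nat \<Rightarrow> real) \<Rightarrow> complex poly \<Rightarrow> bool" where
  "phase_poly n k \<nu> G R \<longleftrightarrow> degree R < n \<and> (\<forall>j\<le>n. poly R (cis (row_angle n k j)) = phase_value n k \<nu> G j)"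

text \<open>On the unit circle \<open>R\<close> is \<open>cis (h * \<theta>)\<close> times
  \<open>a + \<i> * sin \<theta> * B\<close>, with \<open>a\<close> and \<open>B\<close> polynomials
  in the cosine. \<open>B\<close> prescribes the sines \<open>G\<close> of the phases, and the
  \<open>h + 1\<close> coefficients of \<open>a\<close> are used up by making the values unimodular
  at the \<open>h + 1\<close> mirror pairs.\<close>

lemma odd_phase_poly:
  assumes n: "n = 2 * h + 1" "h \<ge> 1" and nk: "n < k"
    and B: "degree B \<le> h - 1"
    and G: "\<And>l. 2 * l < n \<Longrightarrow> G l = sin (row_angle n k (n - l)) * poly B (node_cos n k l)"
    and G1: "\<And>l. 2 * l < n \<Longrightarrow> \<bar>G l\<bar> < 1"
  obtains R where "phase_poly n k 1 G R"
    "\<And>\<theta>. (norm (poly R (cis \<theta>)))\<^sup>2 =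
       (poly (interp (node_cos n k) (h + 1) (\<lambda>l. sqrt (1 - (G l)\<^sup>2))) (cos \<theta>))\<^sup>2
         + (1 - (cos \<theta>)\<^sup>2) * (poly B (cos \<theta>))\<^sup>2"
proof -
  define a where "a = interp (node_cos n k) (h + 1) (\<lambda>l. sqrt (1 - (G l)\<^sup>2))"
  have inj: "inj_on (node_cos n k) {..<h + 1}" using n nk by (intro inj_node_cos) auto
  have "degree a < h + 1" unfolding a_def by (rule degree_interp_less) simp
  then have da: "degree a \<le> h" by simp
  obtain Ra where Ra: "degree Ra \<le> 2 * h" "\<And>\<theta>. poly Ra (cis \<theta>) = cis (real h * \<theta>) * of_real (poly a (cos \<theta>))"
    using trig_poly_of_cos_poly[OF da] by blast
  obtain Rb where Rb: "degree Rb \<le> 2 * (h - 1)"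
    "\<And>\<theta>. poly Rb (cis \<theta>) = cis (real (h - 1) * \<theta>) * of_real (poly B (cos \<theta>))"
    using trig_poly_of_cos_poly[OF B] by blast
  \<comment> \<open>At \<open>z = cis \<theta>\<close> the factor \<open>(z\<^sup>2 - 1) / 2\<close>
    equals \<open>\<i> * z * sin \<theta>\<close>.\<close>
  define R where "R = Ra + [:-1/2, 0, 1/2:] * Rb"
  have val: "poly R (cis \<theta>) = cis (real h * \<theta>) * Complex (poly a (cos \<theta>)) (sin \<theta> * poly B (cos \<theta>))" for \<theta>
  proof -
    have c: "cis (real h * \<theta>) = cis (real (h - 1) * \<theta>) * cis \<theta>"
      unfolding cis_mult using n(2) by (simp add: of_nat_diff algebra_simps)
    have m: "poly [:-1/2, 0, 1/2:] (cis \<theta>) = cis \<theta> * (\<i> * of_real (sin \<theta>))"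
    proof -
      have "sin (\<theta>) * sin (\<theta>) = 1 - cos (\<theta>) * cos (\<theta>)"
        using sin_cos_squared_add[of "\<theta>"] by (simp add: power2_eq_square eq_diff_eq)
      then show ?thesis by (simp add: complex_eq_iff diff_divide_distrib add_divide_distrib)
    qed
    have z: "Complex (poly a (cos \<theta>)) (sin \<theta> * poly B (cos \<theta>)) =
        of_real (poly a (cos \<theta>)) + \<i> * of_real (sin \<theta>) * of_real (poly B (cos \<theta>))"
      by (simp add: complex_eq_iff)
    show ?thesis unfolding R_def poly_add poly_mult m Ra(2) Rb(2) c z by (simp add: algebra_simps)
  qed
  have "degree ([:-1/2, 0, 1/2:] * Rb) \<le> 2 + 2 * (h - 1)"
    by (rule order_trans[OF degree_mult_le]) (use Rb(1) in simp)
  then have "degree R \<le> 2 * h" unfolding R_def using Ra(1) n(2) by (intro degree_add_le) auto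
  then have degR: "degree R < n" using n(1) by simp
  have ph: "phase_poly n k 1 G R" unfolding phase_poly_def
  proof (intro conjI allI impI degR)
    fix j assume j: "j \<le> n"
    have hn: "real (n - 1) / 2 = real h" using n(1) by simp
    have node: "poly a (node_cos n k l) = sqrt (1 - (G l)\<^sup>2)" if "2 * l < n" for l
      unfolding a_def using that n(1) inj by (intro poly_interp_node) auto
    show "poly R (cis (row_angle n k j)) = phase_value n k 1 G j"
    proof (cases "n < 2 * j")
      case True
      then have l: "2 * (n - j) < n" "n - (n - j) = j" using j by auto
      have c: "cos (row_angle n k j) = node_cos n k (n - j)" using l by (simp add: node_cos_def)
      show ?thesis unfolding phase_value_def hn val c node[OF l(1)] row_phase_def
        using True unit_branch_of_real[of "G (n - j)"] G1[OF l(1)] G[OF l(1)] l(2) by simp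
    next
      case False
      then have l: "2 * j < n" using n(1) by presburger
      have m: "row_angle n k j = - row_angle n k (n - j)" using row_angle_mirror[OF j, of k] by simp
      have c: "cos (row_angle n k j) = node_cos n k j" unfolding m node_cos_def by simp
      have s: "sin (row_angle n k j) * poly B (node_cos n k j) = - G j" unfolding m G[OF l] by simp
      show ?thesis unfolding phase_value_def hn val c node[OF l] row_phase_def s
        using l unit_branch_of_real[of "- G j"] G1[OF l] by simp
    qed
  qed
  show ?thesis
  proof (rule that[OF ph])
    fix \<theta> :: real
    show "(norm (poly R (cis \<theta>)))\<^sup>2 =
       (poly (interp (node_cos n k) (h + 1) (\<lambda>l. sqrt (1 - (G l)\<^sup>2))) (cos \<theta>))\<^sup>2
         + (1 - (cos \<theta>)\<^sup>2) * (poly B (cos \<theta>))\<^sup>2"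
      unfolding val norm_mult norm_cis a_def[symmetric]
      by (simp add: cmod_power2 power_mult_distrib sin_squared_eq)
  qed
qed

text \<open>The half-angle analogue, with
  \<open>cos (\<theta> / 2) * A + \<i> * sin (\<theta> / 2) * b\<close>. Now the real part is
  prescribed, hence \<open>\<nu> = \<i>\<close>. The unpaired middle row lies at angle 0, where
  \<open>b\<close> drops out and the value 1 requires \<open>poly A 1 = 1\<close>.\<close>

lemma even_phase_poly:
  assumes n: "n = 2 * q" "q \<ge> 1" and nk: "n < k"
    and A: "degree A \<le> q - 1" "poly A 1 = 1"
    and G: "\<And>l. 2 * l < n \<Longrightarrow> G l = - cos (row_angle n k (n - l) / 2) * poly A (node_cos n k l)"
    and G1: "\<And>l. 2 * l < n \<Longrightarrow> \<bar>G l\<bar> < 1"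
  obtains R where "phase_poly n k \<i> G R"
    "\<And>\<theta>. (norm (poly R (cis \<theta>)))\<^sup>2 = (1 + cos \<theta>) / 2 * (poly A (cos \<theta>))\<^sup>2 + (1 - cos \<theta>) / 2 *
       (poly (interp (node_cos n k) q (\<lambda>l. sqrt (1 - (G l)\<^sup>2) / sin (row_angle n k (n - l) / 2))) (cos \<theta>))\<^sup>2"
proof -
  define b where "b = interp (node_cos n k) q (\<lambda>l. sqrt (1 - (G l)\<^sup>2) / sin (row_angle n k (n - l) / 2))"
  have inj: "inj_on (node_cos n k) {..<q}" using n nk by (intro inj_node_cos) auto
  have "degree b < q" unfolding b_def using n(2) by (intro degree_interp_less) simp
  then have db: "degree b \<le> q - 1" by simp
  obtain Ra where Ra: "degree Ra \<le> 2 * (q - 1)"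
    "\<And>\<theta>. poly Ra (cis \<theta>) = cis (real (q - 1) * \<theta>) * of_real (poly A (cos \<theta>))"
    using trig_poly_of_cos_poly[OF A(1)] by blast
  obtain Rb where Rb: "degree Rb \<le> 2 * (q - 1)"
    "\<And>\<theta>. poly Rb (cis \<theta>) = cis (real (q - 1) * \<theta>) * of_real (poly b (cos \<theta>))"
    using trig_poly_of_cos_poly[OF db] by blast
  \<comment> \<open>At \<open>z = cis \<theta>\<close> the factors are
    \<open>cis (\<theta> / 2)\<close> times \<open>cos (\<theta> / 2)\<close> and times
    \<open>\<i> * sin (\<theta> / 2)\<close>.\<close>
  define R where "R = [:1/2, 1/2:] * Ra + [:-1/2, 1/2:] * Rb"
  have val: "poly R (cis \<theta>) = cis (real (n - 1) / 2 * \<theta>) *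
      Complex (cos (\<theta> / 2) * poly A (cos \<theta>)) (sin (\<theta> / 2) * poly b (cos \<theta>))" for \<theta>
  proof -
    have "real (n - 1) / 2 = real (q - 1) + 1 / 2" using n by (simp add: of_nat_diff)
    then have c: "cis (real (n - 1) / 2 * \<theta>) = cis (real (q - 1) * \<theta>) * cis (\<theta> / 2)"
      unfolding cis_mult by (simp only: distrib_right) simp
    have t: "cis \<theta> = cis (\<theta> / 2) * cis (\<theta> / 2)" unfolding cis_mult by simp
    have p: "poly [:1/2, 1/2:] (cis \<theta>) = cis (\<theta> / 2) * of_real (cos (\<theta> / 2))"
    proof -
      have "sin (\<theta> / 2) * sin (\<theta> / 2) = 1 - cos (\<theta> / 2) * cos (\<theta> / 2)"
        using sin_cos_squared_add[of "\<theta> / 2"] by (simp add: power2_eq_square eq_diff_eq)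
      then show ?thesis unfolding t by (simp add: complex_eq_iff diff_divide_distrib add_divide_distrib)
    qed
    have m: "poly [:-1/2, 1/2:] (cis \<theta>) = cis (\<theta> / 2) * (\<i> * of_real (sin (\<theta> / 2)))"
    proof -
      have "sin (\<theta> / 2) * sin (\<theta> / 2) = 1 - cos (\<theta> / 2) * cos (\<theta> / 2)"
        using sin_cos_squared_add[of "\<theta> / 2"] by (simp add: power2_eq_square eq_diff_eq)
      then show ?thesis unfolding t by (simp add: complex_eq_iff diff_divide_distrib add_divide_distrib)
    qed
    have "Complex (cos (\<theta> / 2) * poly A (cos \<theta>)) (sin (\<theta> / 2) * poly b (cos \<theta>)) =
        of_real (cos (\<theta> / 2)) * of_real (poly A (cos \<theta>)) + \<i> * of_real (sin (\<theta> / 2)) * of_real (poly b (cos \<theta>))"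
      by (simp add: complex_eq_iff)
    then show ?thesis unfolding R_def c poly_add poly_mult p m by (simp add: Ra(2) Rb(2) algebra_simps)
  qed
  have "degree ([:1/2, 1/2:] * Ra) \<le> 1 + 2 * (q - 1)" "degree ([:-1/2, 1/2:] * Rb) \<le> 1 + 2 * (q - 1)"
    by (rule order_trans[OF degree_mult_le], use Ra(1) Rb(1) in simp)+
  then have "degree R \<le> 1 + 2 * (q - 1)" unfolding R_def by (intro degree_add_le) auto
  then have degR: "degree R < n" using n by simp
  have ph: "phase_poly n k \<i> G R" unfolding phase_poly_def
  proof (intro conjI allI impI degR)
    fix j assume j: "j \<le> n"
    have node: "sin (row_angle n k (n - l) / 2) * poly b (node_cos n k l) = sqrt (1 - (G l)\<^sup>2)" if "2 * l < n" for l
    proof -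
      have "sin (row_angle n k (n - l) / 2) > 0"
        using row_angle_bounds[OF nk that] by (intro sin_gt_zero) auto
      moreover have "poly b (node_cos n k l) = sqrt (1 - (G l)\<^sup>2) / sin (row_angle n k (n - l) / 2)"
        unfolding b_def using that n(1) inj by (intro poly_interp_node) auto
      ultimately show ?thesis by simp
    qed
    consider "n < 2 * j" | "2 * j < n" | "2 * j = n" by linarith
    then show "poly R (cis (row_angle n k j)) = phase_value n k \<i> G j"
    proof cases
      case 1
      then have l: "2 * (n - j) < n" "n - (n - j) = j" using j by auto
      have c: "cos (row_angle n k j) = node_cos n k (n - j)" using l by (simp add: node_cos_def)
      have "cos (row_angle n k j / 2) * poly A (node_cos n k (n - j)) = - G (n - j)"
        using G[OF l(1)] l(2) by simp
      moreover have "sin (row_angle n k j / 2) * poly b (node_cos n k (n - j)) = sqrt (1 - (G (n - j))\<^sup>2)"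
        using node[OF l(1)] l(2) by simp
      moreover have "Complex (- G (n - j)) (sqrt (1 - (G (n - j))\<^sup>2)) = \<i> * unit_branch (of_real (G (n - j)))"
        using unit_branch_of_real[of "G (n - j)"] G1[OF l(1)] by (simp add: complex_eq_iff)
      ultimately show ?thesis unfolding phase_value_def val c row_phase_def using 1 by simp
    next
      case 2
      have m: "row_angle n k j = - row_angle n k (n - j)" using row_angle_mirror[OF j, of k] by simp
      have c: "cos (row_angle n k j) = node_cos n k j" unfolding m node_cos_def by simp
      have "cos (row_angle n k j / 2) * poly A (node_cos n k j) = - G j"
        using G[OF 2] m by simp
      moreover have "sin (row_angle n k j / 2) * poly b (node_cos n k j) = - sqrt (1 - (G j)\<^sup>2)"
        using node[OF 2] m by simp
      moreover have "Complex (- G j) (- sqrt (1 - (G j)\<^sup>2)) = unit_branch (- of_real (G j)) / \<i>"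
        using unit_branch_of_real[of "- G j"] G1[OF 2] by (simp add: complex_eq_iff)
      ultimately show ?thesis unfolding phase_value_def val c row_phase_def using 2 by simp
    next
      case 3
      then have "2 * real j = real n" by linarith
      then have "row_angle n k j = 0" by (simp add: row_angle_def)
      then show ?thesis unfolding phase_value_def val row_phase_def using 3 A(2) by (simp add: complex_eq_iff)
    qed
  qed
  show ?thesis
  proof (rule that[OF ph])
    fix \<theta> :: real
    have "cos \<theta> = 2 * (cos (\<theta> / 2))\<^sup>2 - 1" "cos \<theta> = 1 - 2 * (sin (\<theta> / 2))\<^sup>2"
      using cos_double_cos[of "\<theta> / 2"] cos_double_sin[of "\<theta> / 2"] by simp_all
    then have e: "(cos (\<theta> / 2))\<^sup>2 = (1 + cos \<theta>) / 2" "(sin (\<theta> / 2))\<^sup>2 = (1 - cos \<theta>) / 2" by (auto simp: field_simps)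
    show "(norm (poly R (cis \<theta>)))\<^sup>2 = (1 + cos \<theta>) / 2 * (poly A (cos \<theta>))\<^sup>2 + (1 - cos \<theta>) / 2 *
       (poly (interp (node_cos n k) q (\<lambda>l. sqrt (1 - (G l)\<^sup>2) / sin (row_angle n k (n - l) / 2))) (cos \<theta>))\<^sup>2"
      unfolding val norm_mult norm_cis b_def[symmetric]
      by (simp add: cmod_power2 power_mult_distrib e)
  qed
qed

text \<open>This interface hides the parity of \<open>n\<close>: solvability inside the family, and
  lines within it that move exactly the outermost \<open>m\<close> mirror pairs. It starts at
  \<open>m = 2\<close> because the family has one parameter less than there are pairs.\<close>

definition phase_family :: "nat \<Rightarrow> nat \<Rightarrow> complex \<Rightarrow> (nat \<Rightarrow> real) set \<Rightarrow> bool" where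
  "phase_family n k \<nu> \<G> \<longleftrightarrow> norm \<nu> = 1 \<and>
     (\<forall>G\<in>\<G>. (\<forall>l. 2 * l < n \<longrightarrow> \<bar>G l\<bar> < 1) \<longrightarrow> (\<exists>R. phase_poly n k \<nu> G R)) \<and>
     (\<forall>G\<in>\<G>. \<forall>m. 2 \<le> m \<and> 2 * m \<le> n + 1 \<longrightarrow>
        (\<exists>\<eta>::nat \<Rightarrow> real. (\<forall>l<m. \<eta> l > 0) \<and> (\<forall>l. m \<le> l \<and> 2 * l < n \<longrightarrow> \<eta> l = 0) \<and>
           (\<forall>z. (\<lambda>l. G l + z * \<eta> l) \<in> \<G>)))"

definition phase_contraction :: "nat \<Rightarrow> nat \<Rightarrow> complex \<Rightarrow> (nat \<Rightarrow> real) \<Rightarrow> bool" where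
  "phase_contraction n k \<nu> G \<longleftrightarrow> (\<forall>l. 2 * l < n \<longrightarrow> \<bar>G l\<bar> < 1) \<and>
     (\<exists>R. phase_poly n k \<nu> G R \<and> (\<forall>j. n < j \<and> j < k \<longrightarrow> norm (poly R (cis (row_angle n k j))) < 1))"

text \<open>A product of linear factors at the later nodes; as the node cosines increase, every
  factor is positive at the earlier ones.\<close>

lemma vanishing_direction:
  assumes "n < k" "m \<le> P" "2 * P \<le> n + 1"
  obtains D :: "real poly" where "degree D \<le> P - m"
    "\<And>l. l < m \<Longrightarrow> poly D (node_cos n k l) > 0"
    "\<And>l. m \<le> l \<Longrightarrow> l < P \<Longrightarrow> poly D (node_cos n k l) = 0"
proof
  let ?D = "\<Prod>l\<in>{m..<P}. [:node_cos n k l, -1:]"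
  have "degree ?D \<le> (\<Sum>l\<in>{m..<P}. degree [:node_cos n k l, -1:])"
    by (rule degree_prod_sum_le[unfolded comp_def]) auto
  then show "degree ?D \<le> P - m" by simp
  show "poly ?D (node_cos n k l) > 0" if "l < m" for l
    unfolding poly_prod
  proof (rule prod_pos)
    fix i assume i: "i \<in> {m..<P}"
    then have "2 * i < n" "l < i" using assms that by auto
    then show "poly [:node_cos n k i, -1:] (node_cos n k l) > 0"
      using node_cos_strict_mono[OF assms(1)] by simp
  qed
  show "poly ?D (node_cos n k l) = 0" if "m \<le> l" "l < P" for l
    unfolding poly_prod using that by (intro prod_zero) auto
qed

lemma norm_less_1_if_square: "(norm z)\<^sup>2 < 1 \<Longrightarrow> norm z < 1"
  for z :: complex
  by (metis abs_norm_cancel abs_square_less_1)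

lemma phase_family_odd:
  assumes n: "n = 2 * h + 1" "h \<ge> 1" and nk: "n < k"
  obtains \<G> where "phase_family n k 1 \<G>" "\<exists>G\<in>\<G>. phase_contraction n k 1 G"
proof -
  let ?X = "node_cos n k" and ?s = "\<lambda>l. sin (row_angle n k (n - l))"
  define \<G> where "\<G> = {G. \<exists>B. degree B \<le> h - 1 \<and> (\<forall>l. 2 * l < n \<longrightarrow> G l = ?s l * poly B (?X l))}"
  have spos: "?s l > 0" if "2 * l < n" for l
    using row_angle_bounds[OF nk that] by (intro sin_gt_zero) auto
  have fam: "phase_family n k 1 \<G>" unfolding phase_family_def
  proof (intro conjI ballI allI impI)
    fix G assume G: "G \<in> \<G>" "\<forall>l. 2 * l < n \<longrightarrow> \<bar>G l\<bar> < 1"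
    then obtain B where B: "degree B \<le> h - 1" "\<And>l. 2 * l < n \<Longrightarrow> G l = ?s l * poly B (?X l)"
      by (auto simp: \<G>_def)
    have g1: "\<And>l. 2 * l < n \<Longrightarrow> \<bar>G l\<bar> < 1" using G(2) by blast
    show "\<exists>R. phase_poly n k 1 G R"
      by (rule odd_phase_poly[OF n nk B g1], assumption, assumption, rule exI)
  next
    fix G m assume G: "G \<in> \<G>" and m: "2 \<le> m \<and> 2 * m \<le> n + 1"
    then obtain B where B: "degree B \<le> h - 1" "\<And>l. 2 * l < n \<Longrightarrow> G l = ?s l * poly B (?X l)"
      by (auto simp: \<G>_def)
    have mP: "m \<le> h + 1" "2 * (h + 1) \<le> n + 1" using m n by auto
    obtain D where D: "degree D \<le> h + 1 - m" "\<And>l. l < m \<Longrightarrow> poly D (?X l) > 0"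
      "\<And>l. m \<le> l \<Longrightarrow> l < h + 1 \<Longrightarrow> poly D (?X l) = 0"
      by (rule vanishing_direction[OF nk mP]) (rule that)
    show "\<exists>\<eta>::nat \<Rightarrow> real. (\<forall>l<m. \<eta> l > 0) \<and> (\<forall>l. m \<le> l \<and> 2 * l < n \<longrightarrow> \<eta> l = 0) \<and>
           (\<forall>z. (\<lambda>l. G l + z * \<eta> l) \<in> \<G>)"
    proof (intro exI[of _ "\<lambda>l. ?s l * poly D (?X l)"] conjI allI impI)
      fix l assume l: "l < m"
      then have "2 * l < n" using mP n by auto
      then show "?s l * poly D (?X l) > 0" using spos D(2)[OF l] by simp
    next
      fix l assume "m \<le> l \<and> 2 * l < n"
      then show "?s l * poly D (?X l) = 0" using D(3) n by simp
    next
      fix z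
      \<comment> \<open>Here \<open>m >= 2\<close> keeps the degree of \<open>D\<close> within
        \<open>h - 1\<close>.\<close>
      have "degree (B + smult z D) \<le> h - 1"
        using B(1) D(1) m by (intro degree_add_le order_trans[OF degree_smult_le]) auto
      then show "(\<lambda>l. G l + z * (?s l * poly D (?X l))) \<in> \<G>"
        unfolding \<G>_def using B(2) by (auto intro!: exI[of _ "B + smult z D"] simp: algebra_simps)
    qed
  qed simp
  define T where "T = (\<lambda>j. cos (row_angle n k j)) ` {n<..<k}"
  have inj: "inj_on ?X {..<h + 1}" using n nk by (intro inj_node_cos) auto
  have lt: "2 * l < n" if "l < h + 1" for l using that n by simp
  obtain B where B: "degree B \<le> h + 1 - 2"
    "\<And>l. l < h + 1 \<Longrightarrow> (1 - (?X l)\<^sup>2) * (poly B (?X l))\<^sup>2 < 1"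
    "\<And>x. x \<in> T \<Longrightarrow>
       (poly (interp ?X (h + 1) (\<lambda>l. sqrt (1 - (1 - (?X l)\<^sup>2) * (poly B (?X l))\<^sup>2))) x)\<^sup>2
         < 1 - (1 - x\<^sup>2) * (poly B x)\<^sup>2"
  proof (rule odd_base[OF inj])
    show "h + 1 \<ge> 2" using n by simp
    show "?X l < 1" if "l < h + 1" for l using node_cos_bounds[OF nk lt[OF that]] by simp
    show "finite T" by (simp add: T_def)
    show "x < ?X l" if "x \<in> T" "l < h + 1" for x l
      using that cos_outside_less[of n _ k l] lt by (auto simp: T_def)
  qed (rule that)
  define G where "G l = ?s l * poly B (?X l)" for l
  have Gsq: "(G l)\<^sup>2 = (1 - (?X l)\<^sup>2) * (poly B (?X l))\<^sup>2" for l
    unfolding G_def node_cos_def by (simp add: power_mult_distrib sin_squared_eq)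
  have G1: "\<bar>G l\<bar> < 1" if "2 * l < n" for l
    using B(2)[of l] that n Gsq[of l] by (simp add: abs_square_less_1[symmetric])
  have dB: "degree B \<le> h - 1" using B(1) by simp
  obtain R where R: "phase_poly n k 1 G R"
    "\<And>\<theta>. (norm (poly R (cis \<theta>)))\<^sup>2 =
       (poly (interp (node_cos n k) (h + 1) (\<lambda>l. sqrt (1 - (G l)\<^sup>2))) (cos \<theta>))\<^sup>2
         + (1 - (cos \<theta>)\<^sup>2) * (poly B (cos \<theta>))\<^sup>2"
    by (rule odd_phase_poly[OF n nk dB _ G1], rule G_def, assumption, rule that)
  have "norm (poly R (cis (row_angle n k j))) < 1" if "n < j \<and> j < k" for j
  proof (rule norm_less_1_if_square)
    have "cos (row_angle n k j) \<in> T" using that by (auto simp: T_def)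
    from B(3)[OF this] show "(norm (poly R (cis (row_angle n k j))))\<^sup>2 < 1"
      unfolding R(2) Gsq by simp
  qed
  then have "phase_contraction n k 1 G" unfolding phase_contraction_def using G1 R(1) by blast
  moreover have "G \<in> \<G>" unfolding \<G>_def using dB G_def by blast
  ultimately show ?thesis using that fam by blast
qed

lemma phase_family_even:
  assumes n: "n = 2 * q" "q \<ge> 2" and nk: "n < k"
  obtains \<G> where "phase_family n k \<i> \<G>" "\<exists>G\<in>\<G>. phase_contraction n k \<i> G"
proof -
  let ?X = "node_cos n k" and ?c = "\<lambda>l. cos (row_angle n k (n - l) / 2)"
    and ?s = "\<lambda>l. sin (row_angle n k (n - l) / 2)"
  define \<G> where "\<G> = {G. \<exists>A. degree A \<le> q - 1 \<and> poly A 1 = 1 \<and> (\<forall>l. 2 * l < n \<longrightarrow> G l = - ?c l * poly A (?X l))}"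
  have cpos: "?c l > 0" if "2 * l < n" for l
    using row_angle_bounds[OF nk that] by (intro cos_gt_zero) auto
  have spos: "?s l > 0" if "2 * l < n" for l
    using row_angle_bounds[OF nk that] by (intro sin_gt_zero) auto
  have q1: "q \<ge> 1" using n by simp
  have fam: "phase_family n k \<i> \<G>" unfolding phase_family_def
  proof (intro conjI ballI allI impI)
    fix G assume G: "G \<in> \<G>" "\<forall>l. 2 * l < n \<longrightarrow> \<bar>G l\<bar> < 1"
    then obtain A where A: "degree A \<le> q - 1" "poly A 1 = 1" "\<And>l. 2 * l < n \<Longrightarrow> G l = - ?c l * poly A (?X l)"
      unfolding \<G>_def by blast
    have g1: "\<And>l. 2 * l < n \<Longrightarrow> \<bar>G l\<bar> < 1" using G(2) by blast
    show "\<exists>R. phase_poly n k \<i> G R"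
      by (rule even_phase_poly[OF n(1) q1 nk A g1], assumption, assumption, rule exI)
  next
    fix G m assume G: "G \<in> \<G>" and m: "2 \<le> m \<and> 2 * m \<le> n + 1"
    then obtain A where A: "degree A \<le> q - 1" "poly A 1 = 1" "\<And>l. 2 * l < n \<Longrightarrow> G l = - ?c l * poly A (?X l)"
      unfolding \<G>_def by blast
    have mP: "m \<le> q" "2 * q \<le> n + 1" using m n by auto
    obtain D where D: "degree D \<le> q - m" "\<And>l. l < m \<Longrightarrow> poly D (?X l) > 0"
      "\<And>l. m \<le> l \<Longrightarrow> l < q \<Longrightarrow> poly D (?X l) = 0"
      by (rule vanishing_direction[OF nk mP]) (rule that)
    show "\<exists>\<eta>::nat \<Rightarrow> real. (\<forall>l<m. \<eta> l > 0) \<and> (\<forall>l. m \<le> l \<and> 2 * l < n \<longrightarrow> \<eta> l = 0) \<and>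
           (\<forall>z. (\<lambda>l. G l + z * \<eta> l) \<in> \<G>)"
    proof (intro exI[of _ "\<lambda>l. ?c l * ((1 - ?X l) * poly D (?X l))"] conjI allI impI)
      fix l assume l: "l < m"
      then have l2: "2 * l < n" using mP n by auto
      show "?c l * ((1 - ?X l) * poly D (?X l)) > 0"
        using cpos[OF l2] D(2)[OF l] node_cos_bounds[OF nk l2] by simp
    next
      fix l assume "m \<le> l \<and> 2 * l < n"
      then show "?c l * ((1 - ?X l) * poly D (?X l)) = 0" using D(3) n by simp
    next
      fix z
      \<comment> \<open>The factor \<open>1 - x\<close> preserves \<open>poly A 1 = 1\<close>; the
        degree it costs is again paid for by \<open>m >= 2\<close>.\<close>
      have "degree ([:1, -1:] * D) \<le> q - 1"
        by (rule order_trans[OF degree_mult_le]) (use D(1) m mP in simp)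
      then have "degree (A - smult z ([:1, -1:] * D)) \<le> q - 1"
        using A(1) by (intro degree_diff_le order_trans[OF degree_smult_le]) auto
      moreover have "poly (A - smult z ([:1, -1:] * D)) x = poly A x - z * ((1 - x) * poly D x)" for x
        by (simp add: algebra_simps)
      ultimately show "(\<lambda>l. G l + z * (?c l * ((1 - ?X l) * poly D (?X l)))) \<in> \<G>"
        unfolding \<G>_def using A(2,3)
        by (auto intro!: exI[of _ "A - smult z ([:1, -1:] * D)"] simp del: poly_diff poly_smult poly_mult)
          (simp add: algebra_simps)
    qed
  qed simp
  define T where "T = (\<lambda>j. cos (row_angle n k j)) ` {n<..<k}"
  have inj: "inj_on ?X {..<q}" using n nk by (intro inj_node_cos) auto
  have lt: "2 * l < n" if "l < q" for l using that n by simp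
  obtain A where A: "degree A \<le> q - 1" "poly A 1 = 1"
    "\<And>l. l < q \<Longrightarrow> (1 + ?X l) * (poly A (?X l))\<^sup>2 < 2"
    "\<And>x. x \<in> T \<Longrightarrow>
       (poly (interp ?X q (\<lambda>l. sqrt ((2 - (1 + ?X l) * (poly A (?X l))\<^sup>2) / (1 - ?X l)))) x)\<^sup>2
         < (2 - (1 + x) * (poly A x)\<^sup>2) / (1 - x)"
  proof (rule even_base[OF inj n(2)])
    show "-1 < ?X l" "?X l < 1" if "l < q" for l using node_cos_bounds[OF nk lt[OF that]] by simp_all
    show "finite T" by (simp add: T_def)
    show "x < ?X l" if "x \<in> T" "l < q" for x l
      using that cos_outside_less[of n _ k l] lt by (auto simp: T_def)
  qed (rule that)
  have "(?c l)\<^sup>2 = (1 + ?X l) / 2 \<and> (?s l)\<^sup>2 = (1 - ?X l) / 2" for l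
    using cos_double_cos[of "row_angle n k (n - l) / 2"] cos_double_sin[of "row_angle n k (n - l) / 2"]
    by (simp add: node_cos_def field_simps)
  then have csq: "(?c l)\<^sup>2 = (1 + ?X l) / 2" and ssq: "(?s l)\<^sup>2 = (1 - ?X l) / 2" for l by auto
  define G where "G l = - ?c l * poly A (?X l)" for l
  have Gsq: "(G l)\<^sup>2 = (1 + ?X l) * (poly A (?X l))\<^sup>2 / 2" for l
    unfolding G_def by (simp add: power_mult_distrib csq)
  have G1: "\<bar>G l\<bar> < 1" if "2 * l < n" for l
    using A(3)[of l] that n Gsq[of l] by (simp add: abs_square_less_1[symmetric])
  have cong: "interp ?X q (\<lambda>l. sqrt (1 - (G l)\<^sup>2) / ?s l) =
      interp ?X q (\<lambda>l. sqrt ((2 - (1 + ?X l) * (poly A (?X l))\<^sup>2) / (1 - ?X l)))"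
  proof (rule interp_cong)
    fix l assume "l < q"
    then have l: "2 * l < n" using lt by simp
    have X1: "?X l < 1" using node_cos_bounds[OF nk l] by simp
    have sl: "?s l = sqrt ((1 - ?X l) / 2)" using spos[OF l] ssq[of l] by (metis abs_of_pos real_sqrt_abs)
    have "sqrt (1 - (G l)\<^sup>2) / ?s l = sqrt ((1 - (G l)\<^sup>2) / ((1 - ?X l) / 2))"
      unfolding sl by (rule real_sqrt_divide[symmetric])
    also have "(1 - (G l)\<^sup>2) / ((1 - ?X l) / 2) = (2 - (1 + ?X l) * (poly A (?X l))\<^sup>2) / (1 - ?X l)"
      unfolding Gsq using X1 by (simp add: field_simps)
    finally show "sqrt (1 - (G l)\<^sup>2) / ?s l = sqrt ((2 - (1 + ?X l) * (poly A (?X l))\<^sup>2) / (1 - ?X l))" .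
  qed
  obtain R where R: "phase_poly n k \<i> G R"
    "\<And>\<theta>. (norm (poly R (cis \<theta>)))\<^sup>2 = (1 + cos \<theta>) / 2 * (poly A (cos \<theta>))\<^sup>2 + (1 - cos \<theta>) / 2 *
       (poly (interp ?X q (\<lambda>l. sqrt (1 - (G l)\<^sup>2) / ?s l)) (cos \<theta>))\<^sup>2"
    by (rule even_phase_poly[OF n(1) q1 nk A(1,2) _ G1], rule G_def, assumption, rule that)
  have "norm (poly R (cis (row_angle n k j))) < 1" if j: "n < j \<and> j < k" for j
  proof (rule norm_less_1_if_square)
    let ?x = "cos (row_angle n k j)"
    have x: "?x \<in> T" using j by (auto simp: T_def)
    have "?x < ?X 0" using j n cos_outside_less[of n j k 0] by simp
    then have x1: "1 - ?x > 0" using node_cos_bounds[OF nk, of 0] n by simp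
    from A(4)[OF x] have "(poly (interp ?X q (\<lambda>l. sqrt (1 - (G l)\<^sup>2) / ?s l)) ?x)\<^sup>2 * (1 - ?x)
        < 2 - (1 + ?x) * (poly A ?x)\<^sup>2"
      unfolding cong using x1 by (simp add: pos_less_divide_eq)
    then show "(norm (poly R (cis (row_angle n k j))))\<^sup>2 < 1"
      unfolding R(2) by (simp add: field_simps)
  qed
  then have "phase_contraction n k \<i> G" unfolding phase_contraction_def using G1 R(1) by blast
  moreover have "G \<in> \<G>" unfolding \<G>_def using A(1,2) G_def by blast
  ultimately show ?thesis using that fam by blast
qed

section \<open>Perturbation within a family of phases\<close>

lemma tendsto_row_phase:
  assumes "\<nu> \<noteq> 0" "\<And>l. 2 * l < n \<Longrightarrow> \<bar>G l\<bar> < 1" "j \<le> n"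
  shows "((\<lambda>z. row_phase n \<nu> (\<lambda>l. of_real (G l + z * \<eta> l)) j) \<longlongrightarrow> row_phase n \<nu> (\<lambda>l. of_real (G l)) j) (at_right 0)"
proof -
  have op: "open {w. \<bar>Re w\<bar> < 1}" by (intro open_Collect_less continuous_intros)
  have cont: "isCont unit_branch w" if "\<bar>Re w\<bar> < 1" for w
    using holomorphic_on_imp_continuous_on[OF holomorphic_unit_branch] op that
    by (simp add: continuous_on_eq_continuous_at)
  have lim: "((\<lambda>z. complex_of_real (G l + z * \<eta> l)) \<longlongrightarrow> of_real (G l + 0 * \<eta> l)) (at_right 0)" for l
    by (intro tendsto_intros)
  have a: "((\<lambda>z. unit_branch (of_real (G l + z * \<eta> l))) \<longlongrightarrow> unit_branch (of_real (G l))) (at_right 0)" if "2 * l < n" for l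
    using isCont_tendsto_compose[OF cont lim[of l]] assms(2)[OF that] by simp
  have b: "((\<lambda>z. unit_branch (- of_real (G l + z * \<eta> l))) \<longlongrightarrow> unit_branch (- of_real (G l))) (at_right 0)" if "2 * l < n" for l
    using isCont_tendsto_compose[OF cont tendsto_minus[OF lim[of l]]] assms(2)[OF that] by simp
  consider "n < 2 * j" | "2 * j < n" | "2 * j = n" by linarith
  then show ?thesis
  proof cases
    case 1
    then have "2 * (n - j) < n" using assms(3) by linarith
    then show ?thesis using 1 tendsto_mult[OF tendsto_const a] unfolding row_phase_def by simp
  next
    case 2
    then show ?thesis using tendsto_divide[OF b tendsto_const assms(1)] unfolding row_phase_def by simp
  next
    case 3
    then show ?thesis unfolding row_phase_def by simp
  qed
qed

lemma cis_row_angle: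
  assumes "k > 0"
  shows "cis (row_angle n k j) = cis (- (real n * pi / real k)) * cis (2 * pi / real k) ^ j"
  unfolding Complex.DeMoivre cis_mult row_angle_def using assms by (simp add: field_simps)

lemma inj_root_powers:
  assumes "k > 0"
  shows "inj_on (\<lambda>j. cis (2 * pi / real k) ^ j) {..<k}"
proof -
  have "inj_on (\<lambda>j. cis (2 * pi * real j / real k)) {..<k}"
    using Complex.bij_betw_roots_unity[OF assms] by (simp add: bij_betw_def)
  then show ?thesis unfolding Complex.DeMoivre by (simp add: mult_ac)
qed

lemma inj_cis_row_angle:
  assumes "k > 0"
  shows "inj_on (\<lambda>j. cis (row_angle n k j)) {..<k}"
  using inj_root_powers[OF assms] unfolding cis_row_angle[OF assms] by (simp add: inj_on_def)

text \<open>The values at the first \<open>n\<close> rows already determine the polynomial by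
  interpolation, so an arbitrary choice of solutions \<open>Rz\<close> still converges.\<close>

lemma tendsto_phase_poly:
  assumes nk: "n < k" "n > 0" and \<nu>: "\<nu> \<noteq> 0" and G: "\<And>l. 2 * l < n \<Longrightarrow> \<bar>G l\<bar> < 1"
    and R: "phase_poly n k \<nu> G R"
    and Rz: "eventually (\<lambda>z. phase_poly n k \<nu> (\<lambda>l. G l + z * \<eta> l) (Rz z)) (at_right 0)"
  shows "((\<lambda>z. poly (Rz z) x) \<longlongrightarrow> poly R x) (at_right 0)"
proof -
  let ?\<zeta> = "\<lambda>j. cis (row_angle n k j)"
  have inj: "inj_on ?\<zeta> {..<n}" using inj_cis_row_angle[of k n] nk by (auto elim: inj_on_subset)
  have eq: "poly Q x = (\<Sum>j<n. phase_value n k \<nu> H j * poly (interp ?\<zeta> n (\<lambda>i. if i = j then 1 else 0)) x)"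
    if "phase_poly n k \<nu> H Q" for H Q
  proof -
    have "interp ?\<zeta> n (phase_value n k \<nu> H) = Q"
      by (rule poly_eq_if_agree_on_nodes[OF inj])
         (use that nk in \<open>auto simp: phase_poly_def degree_interp_less poly_interp_node[OF inj]\<close>)
    then show ?thesis using poly_interp_sum[of ?\<zeta> n "phase_value n k \<nu> H" x] by simp
  qed
  have "((\<lambda>z. \<Sum>j<n. phase_value n k \<nu> (\<lambda>l. G l + z * \<eta> l) j * poly (interp ?\<zeta> n (\<lambda>i. if i = j then 1 else 0)) x)
      \<longlongrightarrow> (\<Sum>j<n. phase_value n k \<nu> G j * poly (interp ?\<zeta> n (\<lambda>i. if i = j then 1 else 0)) x)) (at_right 0)"
    unfolding phase_value_def
    by (intro tendsto_sum tendsto_mult tendsto_const tendsto_row_phase \<nu> G) auto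
  then have "((\<lambda>z. \<Sum>j<n. phase_value n k \<nu> (\<lambda>l. G l + z * \<eta> l) j * poly (interp ?\<zeta> n (\<lambda>i. if i = j then 1 else 0)) x)
      \<longlongrightarrow> poly R x) (at_right 0)" unfolding eq[OF R] .
  moreover have "eventually (\<lambda>z. (\<Sum>j<n. phase_value n k \<nu> (\<lambda>l. G l + z * \<eta> l) j * poly (interp ?\<zeta> n (\<lambda>i. if i = j then 1 else 0)) x) = poly (Rz z) x) (at_right 0)"
    using Rz by eventually_elim (simp add: eq)
  ultimately show ?thesis by (rule Lim_transform_eventually)
qed

text \<open>Finite induction over the required minors: each step moves \<open>G\<close> along a line
  of the family to make one more determinant nonzero, so slightly that the earlier determinants and
  the strict contraction survive.\<close>

lemma generic_phase_contraction:
  fixes \<alpha> \<beta> :: "'c \<Rightarrow> nat" and x y :: "'c \<Rightarrow> nat \<Rightarrow> complex"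
  assumes n: "n \<ge> 3" "n < k" and fam: "phase_family n k \<nu> \<G>" and ex: "\<exists>G\<in>\<G>. phase_contraction n k \<nu> G"
    and C: "finite C" "\<And>c. c \<in> C \<Longrightarrow> \<alpha> c + \<beta> c = n \<and> \<alpha> c \<ge> 1 \<and> \<beta> c \<ge> 1"
    and x: "\<And>c. c \<in> C \<Longrightarrow> inj_on (x c) {..<\<alpha> c} \<and> (\<forall>i<\<alpha> c. x c i \<noteq> 0)"
    and y: "\<And>c. c \<in> C \<Longrightarrow> inj_on (y c) {..<\<beta> c} \<and> (\<forall>i<\<beta> c. y c i \<noteq> 0)"
  shows "\<exists>G\<in>\<G>. phase_contraction n k \<nu> G \<and> (\<forall>c\<in>C. \<exists>j0\<le>1.
     cdet n (mixed_vandermonde (\<alpha> c) j0 (x c) (y c) (row_phase n \<nu> (\<lambda>l. of_real (G l)))) \<noteq> 0)"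
  using C x y
proof (induction C)
  case empty
  then show ?case using ex by simp
next
  case (insert c C)
  have \<nu>: "norm \<nu> = 1" "\<nu> \<noteq> 0" using fam by (auto simp: phase_family_def)
  obtain G where G: "G \<in> \<G>" "phase_contraction n k \<nu> G" and reg: "\<forall>c\<in>C. \<exists>j0\<le>1.
     cdet n (mixed_vandermonde (\<alpha> c) j0 (x c) (y c) (row_phase n \<nu> (\<lambda>l. of_real (G l)))) \<noteq> 0"
    using insert.IH insert.prems by auto
  then obtain j1 where j1: "\<And>c. c \<in> C \<Longrightarrow> j1 c \<le> (1::nat) \<and>
     cdet n (mixed_vandermonde (\<alpha> c) (j1 c) (x c) (y c) (row_phase n \<nu> (\<lambda>l. of_real (G l)))) \<noteq> 0"
    by metis
  have G1: "\<And>l. 2 * l < n \<Longrightarrow> \<bar>G l\<bar> < 1" using G(2) by (auto simp: phase_contraction_def)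
  obtain R where R: "phase_poly n k \<nu> G R" "\<And>j. n < j \<Longrightarrow> j < k \<Longrightarrow> norm (poly R (cis (row_angle n k j))) < 1"
    using G(2) by (auto simp: phase_contraction_def)
  have ab: "\<alpha> c + \<beta> c = n" "\<alpha> c \<ge> 1" "\<beta> c \<ge> 1" using insert.prems(1)[of c] by auto
  have xc: "inj_on (x c) {..<\<alpha> c}" "\<And>i. i < \<alpha> c \<Longrightarrow> x c i \<noteq> 0" using insert.prems(2)[of c] by auto
  have yc: "inj_on (y c) {..<\<beta> c}" "\<And>i. i < \<beta> c \<Longrightarrow> y c i \<noteq> 0" using insert.prems(3)[of c] by auto
  show ?case
  proof (rule mixed_vandermonde_perturb[OF n(1) ab xc yc \<nu>(1) G1])
    fix m j0
    assume m: "2 \<le> m" "2 * m \<le> n + 1" and j0: "j0 \<le> 1"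
      and pert: "\<And>\<eta> :: nat \<Rightarrow> real. (\<And>l. l < m \<Longrightarrow> \<eta> l > 0) \<Longrightarrow> (\<And>l. m \<le> l \<Longrightarrow> 2 * l < n \<Longrightarrow> \<eta> l = 0) \<Longrightarrow>
        eventually (\<lambda>z. cdet n (mixed_vandermonde (\<alpha> c) j0 (x c) (y c)
          (row_phase n \<nu> (\<lambda>l. of_real (G l + z * \<eta> l)))) \<noteq> 0) (at_right 0)"
    obtain \<eta> :: "nat \<Rightarrow> real" where \<eta>: "\<And>l. l < m \<Longrightarrow> \<eta> l > 0" "\<And>l. m \<le> l \<Longrightarrow> 2 * l < n \<Longrightarrow> \<eta> l = 0"
      "\<And>z. (\<lambda>l. G l + z * \<eta> l) \<in> \<G>"
      using fam G(1) m unfolding phase_family_def by metis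
    let ?H = "\<lambda>z l. G l + z * \<eta> l"
    have fin: "finite {l. 2 * l < n}" by (rule finite_subset[of _ "{..<n}"]) auto
    have "eventually (\<lambda>z. \<forall>l\<in>{l. 2 * l < n}. \<bar>?H z l\<bar> < 1) (at_right 0)"
    proof (rule eventually_ball_finite[OF fin], intro ballI)
      fix l assume "l \<in> {l. 2 * l < n}"
      then have "\<bar>G l + 0 * \<eta> l\<bar> < 1" using G1 by simp
      moreover have "((\<lambda>z. \<bar>?H z l\<bar>) \<longlongrightarrow> \<bar>G l + 0 * \<eta> l\<bar>) (at_right 0)" by (intro tendsto_intros)
      ultimately show "eventually (\<lambda>z. \<bar>?H z l\<bar> < 1) (at_right 0)" by (rule order_tendstoD(2)[rotated])
    qed
    then have cube: "eventually (\<lambda>z. \<forall>l. 2 * l < n \<longrightarrow> \<bar>?H z l\<bar> < 1) (at_right 0)" by simp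
    have fam1: "\<exists>Q. phase_poly n k \<nu> H Q" if "H \<in> \<G>" "\<forall>l. 2 * l < n \<longrightarrow> \<bar>H l\<bar> < 1" for H
      using fam that unfolding phase_family_def by blast
    define Rz where "Rz z = (SOME Q. phase_poly n k \<nu> (?H z) Q)" for z
    have Rz: "eventually (\<lambda>z. phase_poly n k \<nu> (?H z) (Rz z)) (at_right 0)"
      using cube
    proof eventually_elim
      case (elim z)
      then have "\<exists>Q. phase_poly n k \<nu> (?H z) Q" using fam1[OF \<eta>(3)[of z]] by blast
      then show ?case unfolding Rz_def by (rule someI_ex)
    qed
    have n0: "n > 0" using n by simp
    have "eventually (\<lambda>z. \<forall>j\<in>{n<..<k}. norm (poly (Rz z) (cis (row_angle n k j))) < 1) (at_right 0)"
    proof (rule eventually_ball_finite, simp, intro ballI)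
      fix j assume "j \<in> {n<..<k}"
      then have lt: "norm (poly R (cis (row_angle n k j))) < 1" using R(2) by simp
      have "((\<lambda>z. norm (poly (Rz z) (cis (row_angle n k j)))) \<longlongrightarrow> norm (poly R (cis (row_angle n k j)))) (at_right 0)"
        by (intro tendsto_norm tendsto_phase_poly[OF n(2) n0 \<nu>(2) G1 R(1) Rz])
      then show "eventually (\<lambda>z. norm (poly (Rz z) (cis (row_angle n k j))) < 1) (at_right 0)"
        using lt by (rule order_tendstoD(2))
    qed
    with cube Rz have ctr: "eventually (\<lambda>z. phase_contraction n k \<nu> (?H z)) (at_right 0)"
      by eventually_elim (auto simp: phase_contraction_def)
    have old: "eventually (\<lambda>z. \<forall>c\<in>C. cdet n (mixed_vandermonde (\<alpha> c) (j1 c) (x c) (y c)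
        (row_phase n \<nu> (\<lambda>l. of_real (?H z l)))) \<noteq> 0) (at_right 0)"
    proof (rule eventually_ball_finite[OF insert.hyps(1)], intro ballI)
      fix c assume c: "c \<in> C"
      have "((\<lambda>z. cdet n (mixed_vandermonde (\<alpha> c) (j1 c) (x c) (y c) (row_phase n \<nu> (\<lambda>l. of_real (?H z l)))))
         \<longlongrightarrow> cdet n (mixed_vandermonde (\<alpha> c) (j1 c) (x c) (y c) (row_phase n \<nu> (\<lambda>l. of_real (G l))))) (at_right 0)"
      proof (rule tendsto_cdet)
        fix i j assume ij: "i < n" "j < n"
        have "j1 c + i \<le> n" using j1[OF c] ij by linarith
        note r = tendsto_row_phase[where \<eta> = \<eta>, OF \<nu>(2) G1 this]
        show "((\<lambda>z. mixed_vandermonde (\<alpha> c) (j1 c) (x c) (y c) (row_phase n \<nu> (\<lambda>l. of_real (?H z l))) i j)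
         \<longlongrightarrow> mixed_vandermonde (\<alpha> c) (j1 c) (x c) (y c) (row_phase n \<nu> (\<lambda>l. of_real (G l))) i j) (at_right 0)"
          unfolding mixed_vandermonde_def
          by (cases "j < \<alpha> c"; simp only: if_True if_False) (intro tendsto_intros r; simp)+
      qed
      then show "eventually (\<lambda>z. cdet n (mixed_vandermonde (\<alpha> c) (j1 c) (x c) (y c)
        (row_phase n \<nu> (\<lambda>l. of_real (?H z l)))) \<noteq> 0) (at_right 0)"
        by (rule tendsto_imp_eventually_ne) (use j1[OF c] in simp)
    qed
    have "eventually (\<lambda>z. phase_contraction n k \<nu> (?H z) \<and>
      (\<forall>c\<in>C. cdet n (mixed_vandermonde (\<alpha> c) (j1 c) (x c) (y c)
        (row_phase n \<nu> (\<lambda>l. of_real (?H z l)))) \<noteq> 0) \<and>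
      cdet n (mixed_vandermonde (\<alpha> c) j0 (x c) (y c) (row_phase n \<nu> (\<lambda>l. of_real (?H z l)))) \<noteq> 0) (at_right 0)"
      by (intro eventually_conj ctr old pert \<eta>)
    then obtain z where z: "phase_contraction n k \<nu> (?H z)"
      "\<forall>c\<in>C. cdet n (mixed_vandermonde (\<alpha> c) (j1 c) (x c) (y c)
        (row_phase n \<nu> (\<lambda>l. of_real (?H z l)))) \<noteq> 0"
      "cdet n (mixed_vandermonde (\<alpha> c) j0 (x c) (y c) (row_phase n \<nu> (\<lambda>l. of_real (?H z l)))) \<noteq> 0"
      by (elim eventually_happens'[OF trivial_limit_at_right_real, THEN exE] conjE)
    show ?case
    proof (intro bexI[OF _ \<eta>(3)[of z]] conjI z(1) ballI)
      fix c' assume "c' \<in> insert c C"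
      then show "\<exists>j0\<le>1. cdet n (mixed_vandermonde (\<alpha> c') j0 (x c') (y c') (row_phase n \<nu> (\<lambda>l. of_real (?H z l)))) \<noteq> 0"
        using z(2,3) j0 j1 by blast
    qed
  qed
qed

section \<open>The spanning condition for circulants\<close>

lemma cdet_transpose: "cdet n (\<lambda>i j. M j i) = cdet n M"
proof -
  have "Matrix.mat n n (\<lambda>(i, j). M j i) = transpose_mat (Matrix.mat n n (\<lambda>(i, j). M i j))" by auto
  then show ?thesis unfolding cdet_def by (simp add: det_transpose[of _ n])
qed

lemma sum_bij_enum:
  assumes "bij_betw e {..<card A} A"
  shows "(\<Sum>i\<in>A. f i) = (\<Sum>c<card A. f (e c))"
  using sum.reindex_bij_betw[OF assms, of f] by simp

lemma root_power_enumeration: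
  assumes "k > 0"
  obtains e where "\<And>A. A \<subseteq> {..<k} \<Longrightarrow> bij_betw (e A) {..<card A} A"
    "\<And>A. A \<subseteq> {..<k} \<Longrightarrow> inj_on (\<lambda>c. cis (2 * pi / real k) ^ e A c) {..<card A}"
proof -
  have "\<exists>e. bij_betw e {..<card A} A" if "A \<subseteq> {..<k}" for A
    using ex_bij_betw_nat_finite[OF finite_subset[OF that]] by (simp add: lessThan_atLeast0)
  then obtain e where e: "bij_betw (e A) {..<card A} A" if "A \<subseteq> {..<k}" for A by metis
  show ?thesis
  proof (rule that[OF e])
    fix A assume A: "A \<subseteq> {..<k}"
    have "inj_on (\<lambda>j. cis (2 * pi / real k) ^ j) (e A ` {..<card A})"
      using inj_root_powers[OF assms] e[OF A] A unfolding bij_betw_def by (auto elim: inj_on_subset)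
    then show "inj_on (\<lambda>c. cis (2 * pi / real k) ^ e A c) {..<card A}"
      using e[OF A] unfolding bij_betw_def by (auto dest: comp_inj_on simp: o_def)
  qed
qed

text \<open>The values of \<open>U\<close> are the eigenvalues of the circulant. The last property
  is the spanning condition after a discrete Fourier transform: \<open>A\<close> and
  \<open>B\<close> collect the members of either kind not orthogonal to a given vector.\<close>

lemma unimodular_circulant:
  assumes n: "n \<ge> 3" "n < k"
  obtains U :: "complex poly" where "degree U < n"
    "\<And>j. j \<le> n \<Longrightarrow> norm (poly U (cis (2 * pi / real k) ^ j)) = 1"
    "\<And>j. n < j \<Longrightarrow> j < k \<Longrightarrow> norm (poly U (cis (2 * pi / real k) ^ j)) < 1"
    "\<And>A B a b. A \<subseteq> {..<k} \<Longrightarrow> B \<subseteq> {..<k} \<Longrightarrow> card A + card B = n \<Longrightarrow> A \<noteq> {} \<Longrightarrow> B \<noteq> {} \<Longrightarrow>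
       (\<And>j. j \<le> n \<Longrightarrow> (\<Sum>i\<in>A. a i * cis (2 * pi / real k) ^ (i * j)) =
          poly U (cis (2 * pi / real k) ^ j) * (\<Sum>i\<in>B. b i * cis (2 * pi / real k) ^ (i * j))) \<Longrightarrow>
       (\<forall>i\<in>A. a i = 0) \<and> (\<forall>i\<in>B. b i = 0)"
proof -
  define w where "w = cis (2 * pi / real k)"
  \<comment> \<open>The centring factor of \<open>phase_value\<close> has the form
    \<open>c0 * g ^ j\<close>: its geometric part is absorbed into the nodes of the second block and
    the constant into the unknowns.\<close>
  define g where "g = cis (real (n - 1) * pi / real k)"
  have k0: "k > 0" using n by simp
  have w0: "w \<noteq> 0" "g \<noteq> 0" by (auto simp: w_def g_def)
  obtain \<nu> \<G> where fam: "phase_family n k \<nu> \<G>" "\<exists>G\<in>\<G>. phase_contraction n k \<nu> G"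
  proof (cases "odd n")
    case True
    then obtain h where h: "n = 2 * h + 1" by (auto elim: oddE)
    then have "h \<ge> 1" using n by simp
    then show ?thesis using phase_family_odd[OF h _ n(2)] that by blast
  next
    case False
    then obtain q where q: "n = 2 * q" by (auto elim: evenE)
    then have "q \<ge> 2" using n by simp
    then show ?thesis using phase_family_even[OF q _ n(2)] that by blast
  qed
  define C where "C = {(A, B). A \<subseteq> {..<k} \<and> B \<subseteq> {..<k} \<and> card A + card B = n \<and> A \<noteq> {} \<and> B \<noteq> {}}"
  have finC: "finite C"
    by (rule finite_subset[of _ "Pow {..<k} \<times> Pow {..<k}"]) (auto simp: C_def)
  obtain e where e: "\<And>A. A \<subseteq> {..<k} \<Longrightarrow> bij_betw (e A) {..<card A} A"
    and inj: "\<And>A. A \<subseteq> {..<k} \<Longrightarrow> inj_on (\<lambda>c. w ^ e A c) {..<card A}"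
    using root_power_enumeration[OF k0, folded w_def] by blast
  define x where "x p c = w ^ e (fst p) c" for p :: "nat set \<times> nat set" and c
  define y where "y p c = w ^ e (snd p) c * g" for p :: "nat set \<times> nat set" and c
  have "\<exists>G\<in>\<G>. phase_contraction n k \<nu> G \<and> (\<forall>c\<in>C. \<exists>j0\<le>1.
     cdet n (mixed_vandermonde (card (fst c)) j0 (x c) (y c) (row_phase n \<nu> (\<lambda>l. of_real (G l)))) \<noteq> 0)"
  proof (rule generic_phase_contraction[OF n fam finC])
    fix c assume c: "c \<in> C"
    then have f: "finite (fst c)" "finite (snd c)" by (auto simp: C_def intro: finite_subset[OF _ finite_lessThan[of k]])
    show "card (fst c) + card (snd c) = n \<and> card (fst c) \<ge> 1 \<and> card (snd c) \<ge> 1"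
      using c f by (cases c) (auto simp: C_def Suc_le_eq card_gt_0_iff)
    show "inj_on (x c) {..<card (fst c)} \<and> (\<forall>i<card (fst c). x c i \<noteq> 0)"
      using inj[of "fst c"] c w0 unfolding x_def by (auto simp: C_def)
    show "inj_on (y c) {..<card (snd c)} \<and> (\<forall>i<card (snd c). y c i \<noteq> 0)"
      using inj[of "snd c"] c w0 unfolding y_def by (auto simp: C_def inj_on_def)
  qed
  then obtain G where G: "phase_contraction n k \<nu> G" and reg: "\<And>c. c \<in> C \<Longrightarrow> \<exists>j0\<le>1.
     cdet n (mixed_vandermonde (card (fst c)) j0 (x c) (y c) (row_phase n \<nu> (\<lambda>l. of_real (G l)))) \<noteq> 0"
    by blast
  obtain R where R: "phase_poly n k \<nu> G R" "\<And>j. n < j \<Longrightarrow> j < k \<Longrightarrow> norm (poly R (cis (row_angle n k j))) < 1"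
    and G1: "\<And>l. 2 * l < n \<Longrightarrow> \<bar>G l\<bar> < 1"
    using G unfolding phase_contraction_def by blast
  have \<nu>: "norm \<nu> = 1" using fam(1) by (simp add: phase_family_def)
  \<comment> \<open>Composing with a rotation returns from the symmetric angles to the powers of
    \<open>w\<close> and does not raise the degree.\<close>
  define U where "U = pcompose R [:0, cis (- (real n * pi / real k)):]"
  have U: "poly U (w ^ j) = poly R (cis (row_angle n k j))" for j
    unfolding U_def poly_pcompose cis_row_angle[OF k0] w_def by (simp add: mult.commute)
  have val: "poly U (w ^ j) = phase_value n k \<nu> G j" if "j \<le> n" for j
    using R(1) that by (simp add: U phase_poly_def)
  define c0 where "c0 = cis (- (real (n - 1) * real n * pi / (2 * real k)))"
  have phase: "cis (real (n - 1) / 2 * row_angle n k j) = c0 * g ^ j" for j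
    unfolding c0_def g_def Complex.DeMoivre cis_mult row_angle_def using k0
    by (intro arg_cong[where f = cis]) (simp add: field_simps)
  show ?thesis
  proof (rule that[of U], fold w_def)
    have "degree U \<le> degree R * degree [:0, cis (- (real n * pi / real k)):]"
      unfolding U_def by (rule degree_pcompose_le)
    also have "\<dots> \<le> degree R" by simp
    finally show "degree U < n" using R(1) by (simp add: phase_poly_def)
    show "norm (poly U (w ^ j)) = 1" if "j \<le> n" for j
      unfolding val[OF that] phase_value_def norm_mult
      using norm_row_phase_of_real[of \<nu> n G j] \<nu> G1 that by simp
    show "norm (poly U (w ^ j)) < 1" if "n < j" "j < k" for j
      using R(2)[OF that] by (simp add: U)
  next
    fix A B :: "nat set" and a b :: "nat \<Rightarrow> complex"
    assume AB: "A \<subseteq> {..<k}" "B \<subseteq> {..<k}" "card A + card B = n" "A \<noteq> {}" "B \<noteq> {}"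
      and eq: "\<And>j. j \<le> n \<Longrightarrow> (\<Sum>i\<in>A. a i * w ^ (i * j)) = poly U (w ^ j) * (\<Sum>i\<in>B. b i * w ^ (i * j))"
    then have "(A, B) \<in> C" by (auto simp: C_def)
    from reg[OF this] obtain j0 where j0: "j0 \<le> 1"
      "cdet n (mixed_vandermonde (card A) j0 (x (A, B)) (y (A, B)) (row_phase n \<nu> (\<lambda>l. of_real (G l)))) \<noteq> 0"
      by auto
    have det: "cdet (card A + card B) (mixed_vandermonde (card A) j0 (x (A, B)) (y (A, B))
        (row_phase n \<nu> (\<lambda>l. of_real (G l)))) \<noteq> 0"
      using j0(2) unfolding AB(3) .
    have "(\<forall>c<card A. a (e A c) = 0) \<and> (\<forall>c<card B. - c0 * b (e B c) = 0)"
    proof (rule mixed_vandermonde_kernel[OF det])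
      fix j assume "j0 \<le> j" "j < j0 + card A + card B"
      then have j: "j \<le> n" using j0 AB(3) by linarith
      have "(\<Sum>c<card A. a (e A c) * x (A, B) c ^ j) = (\<Sum>i\<in>A. a i * w ^ (i * j))"
        unfolding sum_bij_enum[OF e[OF AB(1)]] x_def by (simp add: power_mult)
      moreover have "(\<Sum>c<card B. - c0 * b (e B c) * y (A, B) c ^ j) = - c0 * g ^ j * (\<Sum>i\<in>B. b i * w ^ (i * j))"
        unfolding sum_bij_enum[OF e[OF AB(2)]] y_def sum_distrib_left
        by (rule sum.cong[OF refl], simp only: power_mult power_mult_distrib) (simp add: mult_ac)
      ultimately show "(\<Sum>c<card A. a (e A c) * x (A, B) c ^ j) +
          row_phase n \<nu> (\<lambda>l. of_real (G l)) j * (\<Sum>c<card B. - c0 * b (e B c) * y (A, B) c ^ j) = 0"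
        using eq[OF j] unfolding val[OF j] phase_value_def phase by (simp add: mult_ac)
    qed
    moreover have "c0 \<noteq> 0" by (simp add: c0_def)
    ultimately have "\<forall>i\<in>e A ` {..<card A}. a i = 0" "\<forall>i\<in>e B ` {..<card B}. b i = 0" by auto
    moreover have "e A ` {..<card A} = A" "e B ` {..<card B} = B"
      using e[OF AB(1)] e[OF AB(2)] by (simp_all add: bij_betw_def)
    ultimately show "(\<forall>i\<in>A. a i = 0) \<and> (\<forall>i\<in>B. b i = 0)" by simp
  qed
qed

text \<open>Smaller index sets are enlarged to two nonempty sets of total size \<open>n\<close>,
  with coefficient 0 at the new indices. This fails only if one set already has \<open>n\<close>
  elements; then the other is empty and the system is an ordinary Vandermonde system.\<close>

lemma unimodular_circulant_general:
  assumes n: "n \<ge> 3" "n < k"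
  obtains U :: "complex poly" where "degree U < n"
    "\<And>j. j \<le> n \<Longrightarrow> norm (poly U (cis (2 * pi / real k) ^ j)) = 1"
    "\<And>j. n < j \<Longrightarrow> j < k \<Longrightarrow> norm (poly U (cis (2 * pi / real k) ^ j)) < 1"
    "\<And>A B a b. A \<subseteq> {..<k} \<Longrightarrow> B \<subseteq> {..<k} \<Longrightarrow> card A + card B \<le> n \<Longrightarrow>
       (\<And>j. j \<le> n \<Longrightarrow> (\<Sum>i\<in>A. a i * cis (2 * pi / real k) ^ (i * j)) =
          poly U (cis (2 * pi / real k) ^ j) * (\<Sum>i\<in>B. b i * cis (2 * pi / real k) ^ (i * j))) \<Longrightarrow>
       (\<forall>i\<in>A. a i = 0) \<and> (\<forall>i\<in>B. b i = 0)"
proof -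
  define w where "w = cis (2 * pi / real k)"
  have k0: "k > 0" using n by simp
  show ?thesis
  proof (rule unimodular_circulant[OF n], fold w_def)
    fix U :: "complex poly"
    assume deg: "degree U < n" and one: "\<And>j. j \<le> n \<Longrightarrow> norm (poly U (w ^ j)) = 1"
      and less: "\<And>j. n < j \<Longrightarrow> j < k \<Longrightarrow> norm (poly U (w ^ j)) < 1"
      and core: "\<And>A B a b. A \<subseteq> {..<k} \<Longrightarrow> B \<subseteq> {..<k} \<Longrightarrow> card A + card B = n \<Longrightarrow> A \<noteq> {} \<Longrightarrow> B \<noteq> {} \<Longrightarrow>
       (\<And>j. j \<le> n \<Longrightarrow> (\<Sum>i\<in>A. a i * w ^ (i * j)) = poly U (w ^ j) * (\<Sum>i\<in>B. b i * w ^ (i * j))) \<Longrightarrow>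
       (\<forall>i\<in>A. a i = 0) \<and> (\<forall>i\<in>B. b i = 0)"
    have vdm: "\<forall>i\<in>A. a i = 0" if A: "A \<subseteq> {..<k}" "card A \<le> n"
      and z: "\<And>j. j \<le> n \<Longrightarrow> (\<Sum>i\<in>A. a i * w ^ (i * j)) = 0" for A a
    proof
      fix i assume i: "i \<in> A"
      show "a i = 0"
      proof (rule vandermonde_kernel[where I = A and x = "\<lambda>i. w ^ i" and ?j0.0 = 0 and a = a, OF _ _ _ _ i])
        show "finite A" using A(1) by (rule finite_subset) simp
        show "inj_on (\<lambda>i. w ^ i) A" using inj_root_powers[OF k0] A(1) unfolding w_def by (rule inj_on_subset)
        show "w ^ c \<noteq> 0" for c by (simp add: w_def)
        show "(\<Sum>c\<in>A. a c * (w ^ c) ^ j) = 0" if "j < 0 + card A" for j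
          using z[of j] that A(2) by (simp add: power_mult)
      qed
    qed
    show thesis
    proof (rule that[of U], fold w_def)
      fix A B :: "nat set" and a b :: "nat \<Rightarrow> complex"
      assume A: "A \<subseteq> {..<k}" and B: "B \<subseteq> {..<k}" and AB: "card A + card B \<le> n"
        and eq: "\<And>j. j \<le> n \<Longrightarrow> (\<Sum>i\<in>A. a i * w ^ (i * j)) = poly U (w ^ j) * (\<Sum>i\<in>B. b i * w ^ (i * j))"
      have fin: "finite A" "finite B" using A B by (auto intro: finite_subset)
      show "(\<forall>i\<in>A. a i = 0) \<and> (\<forall>i\<in>B. b i = 0)"
      proof (cases "card B = n")
        case True
        then have "A = {}" using AB fin by simp
        have "(\<Sum>i\<in>B. b i * w ^ (i * j)) = 0" if "j \<le> n" for j
          using eq[OF that] one[OF that] \<open>A = {}\<close> by auto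
        then have "\<forall>i\<in>B. b i = 0" using vdm[OF B] True by auto
        then show ?thesis using \<open>A = {}\<close> by simp
      next
        case Bn: False
        show ?thesis
        proof (cases "card A = n")
          case True
          then have "B = {}" using AB fin by simp
          then have "\<forall>i\<in>A. a i = 0" using vdm[OF A, of a] True eq by auto
          then show ?thesis using \<open>B = {}\<close> by simp
        next
          case An: False
          define B' where "B' = (if B = {} then {0} else B)"
          have B': "B \<subseteq> B'" "B' \<subseteq> {..<k}" "B' \<noteq> {}" using B k0 by (auto simp: B'_def)
          have cB': "card B' < n" "card A + card B' \<le> n" using AB An Bn n fin by (auto simp: B'_def)
          have "\<exists>A'. A \<subseteq> A' \<and> A' \<subseteq> {..<k} \<and> card A' = n - card B'"
            using exists_subset_between[of A "n - card B'" "{..<k}"] A cB' n by auto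
          then obtain A' where A': "A \<subseteq> A'" "A' \<subseteq> {..<k}" "card A' = n - card B'" by blast
          define a' where "a' i = (if i \<in> A then a i else 0)" for i
          define b' where "b' i = (if i \<in> B then b i else 0)" for i
          have fin': "finite A'" "finite B'" using A' B' by (auto intro: finite_subset)
          have sa: "(\<Sum>i\<in>A'. a' i * w ^ (i * j)) = (\<Sum>i\<in>A. a i * w ^ (i * j))" for j
            using A'(1) fin' by (intro sum.mono_neutral_cong_right) (auto simp: a'_def)
          have sb: "(\<Sum>i\<in>B'. b' i * w ^ (i * j)) = (\<Sum>i\<in>B. b i * w ^ (i * j))" for j
            using B'(1) fin' by (intro sum.mono_neutral_cong_right) (auto simp: b'_def)
          have "(\<forall>i\<in>A'. a' i = 0) \<and> (\<forall>i\<in>B'. b' i = 0)"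
          proof (rule core[OF A'(2) B'(2)])
            show "card A' + card B' = n" "A' \<noteq> {}" using A'(3) cB' by auto
            show "(\<Sum>i\<in>A'. a' i * w ^ (i * j)) = poly U (w ^ j) * (\<Sum>i\<in>B'. b' i * w ^ (i * j))" if "j \<le> n" for j
              unfolding sa sb by (rule eq[OF that])
          qed (rule B')
          then show ?thesis using A'(1) B'(1) by (auto simp: a'_def b'_def split: if_splits)
        qed
      qed
    qed (use deg one less in auto)
  qed
qed

lemma root_power_sum:
  assumes "k > 0" "w = cis (2 * pi / real k)" "i < k" "i' < k"
  shows "(\<Sum>j<k. w ^ (i * j) * cnj (w ^ (i' * j))) = (if i = i' then of_nat k else 0)"
proof -
  have wk: "w ^ k = 1" unfolding assms(2) Complex.DeMoivre using assms(1) by simp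
  have w0: "w \<noteq> 0" by (simp add: assms(2))
  have cw: "cnj w = inverse w" by (simp add: assms(2) cis_cnj cis_inverse)
  define q where "q = w ^ i * inverse (w ^ i')"
  have "(\<Sum>j<k. w ^ (i * j) * cnj (w ^ (i' * j))) = (\<Sum>j<k. q ^ j)"
    by (intro sum.cong) (simp_all add: q_def power_mult_distrib power_mult cw power_inverse)
  also have "\<dots> = (if i = i' then of_nat k else 0)"
  proof (cases "i = i'")
    case True
    then show ?thesis using w0 by (simp add: q_def)
  next
    case False
    have "q \<noteq> 1"
    proof
      assume "q = 1"
      then have "w ^ i = w ^ i'" using w0 by (simp add: q_def field_simps)
      then show False using inj_root_powers[OF assms(1)] assms(2-4) False by (auto simp: inj_on_def)
    qed
    moreover have "q ^ k = 1"
    proof -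
      have "q ^ k = (w ^ k) ^ i * inverse ((w ^ k) ^ i')"
        unfolding q_def power_mult_distrib power_inverse by (simp add: power_mult[symmetric] mult.commute)
      then show ?thesis using wk by simp
    qed
    ultimately show ?thesis using False by (simp add: geometric_sum)
  qed
  finally show ?thesis .
qed

section \<open>The local vectors\<close>

definition side_zeros :: "nat \<Rightarrow> nat \<Rightarrow> (nat \<Rightarrow> nat \<Rightarrow> complex) \<Rightarrow> (nat \<Rightarrow> complex) \<Rightarrow> nat set" where
  "side_zeros k D a v = {i. i < k \<and> (\<Sum>t<D. v t * cnj (a i t)) = 0}"

lemma tendsto_inverse_mult_inverse_power:
  "((\<lambda>\<rho>::real. inverse \<rho> * inverse (\<rho> ^ i)) \<longlongrightarrow> 0) at_top"
proof (rule Lim_null_comparison)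
  show "((\<lambda>\<rho>::real. inverse \<rho>) \<longlongrightarrow> 0) at_top" by (rule tendsto_inverse_0_at_top[OF filterlim_ident])
  show "eventually (\<lambda>\<rho>::real. norm (inverse \<rho> * inverse (\<rho> ^ i)) \<le> inverse \<rho>) at_top"
  proof (rule eventually_mono[OF eventually_ge_at_top[of 1]])
    fix \<rho> :: real assume "1 \<le> \<rho>"
    moreover from this have "inverse (\<rho> ^ i) \<le> 1" by (simp add: inverse_le_1_iff)
    ultimately show "norm (inverse \<rho> * inverse (\<rho> ^ i)) \<le> inverse \<rho>"
      by (simp add: norm_mult abs_mult mult_left_le)
  qed
qed

text \<open>The vectors are \<open>a i t = w ^ (i * t) / \<rho> ^ t\<close> and
  \<open>b i t = p_t * \<rho> ^ t * w ^ (i * t)\<close>, where \<open>p\<close> has its roots at the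
  prescribed residues. In their inner product \<open>\<rho>\<close> cancels and a value of
  \<open>p\<close> remains. So \<open>\<rho>\<close> is free to make any \<open>d\<close> of the
  vectors independent: relative to the first kind, the second carries the weights
  \<open>p_t * \<rho> ^ (2 * t)\<close>, which separate as \<open>\<rho>\<close> grows.\<close>

lemma generic_side:
  assumes d: "2 \<le> d" "d \<le> k" "\<sigma> + (d - 1) \<le> k"
  obtains a b :: "nat \<Rightarrow> nat \<Rightarrow> complex" where
    "\<And>i i'. i < k \<Longrightarrow> i' < k \<Longrightarrow> (i + k - i') mod k \<in> {\<sigma>..<\<sigma> + (d - 1)} \<Longrightarrow> (\<Sum>t<d. b i' t * cnj (a i t)) = 0"
    "\<And>v. \<exists>t<d. v t \<noteq> 0 \<Longrightarrow> card (side_zeros k d a v) + card (side_zeros k d b v) \<le> d - 1"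
    "\<And>i. a i 0 \<noteq> 0" "\<And>i. b i 0 \<noteq> 0"
proof -
  define w where "w = cis (2 * pi / real k)"
  have k0: "k > 0" using d by simp
  have wk: "w ^ k = 1" unfolding w_def Complex.DeMoivre using k0 by simp
  have w0: "w \<noteq> 0" by (simp add: w_def)
  have cw: "cnj w = inverse w" by (simp add: w_def cis_cnj cis_inverse)
  have injw: "inj_on (\<lambda>j. w ^ j) {..<k}" using inj_root_powers[OF k0] by (simp add: w_def)
  have injc: "inj_on (\<lambda>j. inverse w ^ j) {..<k}" using injw by (auto simp: inj_on_def power_inverse)
  define p where "p = (\<Prod>s\<in>{\<sigma>..<\<sigma> + (d - 1)}. [:- (inverse w ^ s), 1:])"
  have degp: "degree p = d - 1" unfolding p_def by (subst degree_prod_eq_sum_degree) auto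
  have p0: "p \<noteq> 0" unfolding p_def by auto
  have proot: "poly p (inverse w ^ s) = 0" if "s \<in> {\<sigma>..<\<sigma> + (d - 1)}" for s
    unfolding p_def poly_prod using that by (intro prod_zero) auto
  have pexp: "poly p z = (\<Sum>t<d. poly.coeff p t * z ^ t)" for z
    unfolding poly_altdef degp using d by (intro sum.cong) auto
  \<comment> \<open>With a zero coefficient only \<open>d - 1\<close> terms would remain, and
    vanishing at \<open>d - 1\<close> consecutive powers of a root of unity would kill them by the
    Vandermonde argument with nodes and exponents exchanged.\<close>
  have pnz: "poly.coeff p t \<noteq> 0" if t: "t < d" for t
  proof
    assume z: "poly.coeff p t = 0"
    have "poly.coeff p s = 0" if s: "s \<in> {..<d} - {t}" for s
    proof (rule vandermonde_kernel[where I = "{..<d} - {t}" and x = "\<lambda>s. inverse w ^ s" and ?j0.0 = \<sigma> and a = "poly.coeff p", OF _ _ _ _ s])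
      show "inj_on (\<lambda>s. inverse w ^ s) ({..<d} - {t})" using d by (intro inj_on_subset[OF injc]) auto
      show "inverse w ^ c \<noteq> 0" for c using w0 by simp
      fix j assume j: "\<sigma> \<le> j" "j < \<sigma> + card ({..<d} - {t})"
      then have "j \<in> {\<sigma>..<\<sigma> + (d - 1)}" using t by simp
      then have "(\<Sum>s<d. poly.coeff p s * (inverse w ^ j) ^ s) = 0" using proot pexp by metis
      then have "(\<Sum>s\<in>{..<d} - {t}. poly.coeff p s * (inverse w ^ j) ^ s) = 0"
        using z t by (simp add: sum.remove[of "{..<d}" t])
      then show "(\<Sum>s\<in>{..<d} - {t}. poly.coeff p s * (inverse w ^ s) ^ j) = 0"
        by (simp add: power_mult[symmetric] mult.commute)
    qed simp
    then have "poly.coeff p s = 0" for s using z degp d by (cases "s < d"; cases "s = t") (auto simp: coeff_eq_0)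
    then show False using p0 by (simp add: poly_eq_iff)
  qed
  define C where "C = {(A, B). A \<subseteq> {..<k} \<and> B \<subseteq> {..<k} \<and> card A + card B = d}"
  have finC: "finite C"
    by (rule finite_subset[of _ "Pow {..<k} \<times> Pow {..<k}"]) (auto simp: C_def)
  obtain e where e: "\<And>A. A \<subseteq> {..<k} \<Longrightarrow> bij_betw (e A) {..<card A} A"
    and inj: "\<And>A. A \<subseteq> {..<k} \<Longrightarrow> inj_on (\<lambda>c. w ^ e A c) {..<card A}"
    using root_power_enumeration[OF k0, folded w_def] by blast
  define \<Lambda> where "\<Lambda> \<rho> t = poly.coeff p t * of_real \<rho> ^ (2 * t)" for \<rho> :: real and t
  have "eventually (\<lambda>\<rho>. \<forall>(A, B)\<in>C. cdet d (mixed_vandermonde (card A) 0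
      (\<lambda>c. w ^ e A c) (\<lambda>c. w ^ e B c) (\<Lambda> \<rho>)) \<noteq> 0) at_top"
  proof (rule eventually_ball_finite[OF finC], intro ballI)
    fix AB assume AB: "AB \<in> C"
    obtain A B where AB': "AB = (A, B)" by (cases AB)
    have A: "A \<subseteq> {..<k}" "B \<subseteq> {..<k}" "card A + card B = d" using AB by (auto simp: AB' C_def)
    have "eventually (\<lambda>\<rho>. cdet (card A + card B) (mixed_vandermonde (card A) 0
      (\<lambda>c. w ^ e A c) (\<lambda>c. w ^ e B c) (\<Lambda> \<rho>)) \<noteq> 0) at_top"
    \<comment> \<open>The odd exponent \<open>2 * card A - 1\<close> lies strictly between those of
      the weights in rows \<open>card A - 1\<close> and \<open>card A\<close>.\<close>
    proof (rule mixed_vandermonde_eventually[where s = "\<lambda>\<rho>. of_real (\<rho> ^ (2 * card A) / \<rho>)"])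
      fix j assume j: "0 + card A \<le> j" "j < 0 + card A + card B"
      obtain i where i: "j = card A + i" using j le_Suc_ex by auto
      have "((\<lambda>\<rho>. complex_of_real (inverse \<rho> * inverse (\<rho> ^ (2 * i)))) \<longlongrightarrow> 0) at_top"
        by (rule tendsto_of_real[OF tendsto_inverse_mult_inverse_power, unfolded of_real_0])
      from tendsto_mult_left_zero[OF this, of "inverse (poly.coeff p j)"]
      show "((\<lambda>\<rho>. of_real (\<rho> ^ (2 * card A) / \<rho>) / \<Lambda> \<rho> j) \<longlongrightarrow> 0) at_top"
      proof (rule Lim_transform_eventually, intro eventually_mono[OF eventually_gt_at_top[of 0]])
        fix \<rho> :: real assume \<rho>: "0 < \<rho>"
        have "complex_of_real \<rho> ^ (2 * j) = of_real \<rho> ^ (2 * card A) * of_real \<rho> ^ (2 * i)"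
          by (simp add: i distrib_left power_add)
        then show "of_real (inverse \<rho> * inverse (\<rho> ^ (2 * i))) * inverse (poly.coeff p j) =
            of_real (\<rho> ^ (2 * card A) / \<rho>) / \<Lambda> \<rho> j"
          using \<rho> by (simp add: \<Lambda>_def divide_inverse mult_ac)
      qed
    next
      fix j assume j: "0 \<le> j" "j < 0 + card A"
      then obtain i where i: "card A = Suc (j + i)" by (metis add_0 less_iff_Suc_add)
      have "((\<lambda>\<rho>. complex_of_real (inverse \<rho> * inverse (\<rho> ^ (2 * i)))) \<longlongrightarrow> 0) at_top"
        by (rule tendsto_of_real[OF tendsto_inverse_mult_inverse_power, unfolded of_real_0])
      from tendsto_mult_left_zero[OF this, of "poly.coeff p j"]
      show "((\<lambda>\<rho>. \<Lambda> \<rho> j / of_real (\<rho> ^ (2 * card A) / \<rho>)) \<longlongrightarrow> 0) at_top"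
      proof (rule Lim_transform_eventually, intro eventually_mono[OF eventually_gt_at_top[of 0]])
        fix \<rho> :: real assume \<rho>: "0 < \<rho>"
        have "2 * card A = 2 * j + (2 * i + 2)" using i by simp
        then have "complex_of_real \<rho> ^ (2 * card A) = of_real \<rho> ^ (2 * j) * (of_real \<rho> ^ (2 * i) * (of_real \<rho> * of_real \<rho>))"
          by (simp only: power_add power2_eq_square)
        then show "of_real (inverse \<rho> * inverse (\<rho> ^ (2 * i))) * poly.coeff p j =
            \<Lambda> \<rho> j / of_real (\<rho> ^ (2 * card A) / \<rho>)"
          using \<rho> by (simp add: \<Lambda>_def divide_inverse mult_ac)
      qed
    next
      show "eventually (\<lambda>\<rho>. complex_of_real (\<rho> ^ (2 * card A) / \<rho>) \<noteq> 0 \<and>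
          (\<forall>j. 0 + card A \<le> j \<and> j < 0 + card A + card B \<longrightarrow> \<Lambda> \<rho> j \<noteq> 0)) at_top"
        by (rule eventually_mono[OF eventually_gt_at_top[of 0]]) (use pnz A(3) in \<open>auto simp: \<Lambda>_def\<close>)
    qed (use inj A w0 in auto)
    then show "eventually (\<lambda>\<rho>. case AB of (A, B) \<Rightarrow> cdet d (mixed_vandermonde (card A) 0
      (\<lambda>c. w ^ e A c) (\<lambda>c. w ^ e B c) (\<Lambda> \<rho>)) \<noteq> 0) at_top" by (simp add: AB' A(3))
  qed
  then have "eventually (\<lambda>\<rho>. (\<forall>(A, B)\<in>C. cdet d (mixed_vandermonde (card A) 0
      (\<lambda>c. w ^ e A c) (\<lambda>c. w ^ e B c) (\<Lambda> \<rho>)) \<noteq> 0) \<and> \<rho> > 0) at_top"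
    by (intro eventually_conj eventually_gt_at_top)
  then obtain \<rho> where \<rho>: "\<forall>(A, B)\<in>C. cdet d (mixed_vandermonde (card A) 0
      (\<lambda>c. w ^ e A c) (\<lambda>c. w ^ e B c) (\<Lambda> \<rho>)) \<noteq> 0" "\<rho> > 0"
    by (elim eventually_happens'[OF trivial_limit_at_top_linorder, THEN exE] conjE)
  define a where "a i t = w ^ (i * t) / of_real \<rho> ^ t" for i t
  define b where "b i t = poly.coeff p t * of_real \<rho> ^ t * w ^ (i * t)" for i t
  show ?thesis
  proof (rule that[of b a])
    show "a i 0 \<noteq> 0" "b i 0 \<noteq> 0" for i using pnz[of 0] d by (simp_all add: a_def b_def)
  next
    fix i i' assume i: "i < k" "i' < k" "(i + k - i') mod k \<in> {\<sigma>..<\<sigma> + (d - 1)}"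
    define s where "s = (i + k - i') mod k"
    have "w ^ s * w ^ i' = w ^ i"
    proof -
      have "w ^ (i + k - i') = w ^ s * (w ^ k) ^ ((i + k - i') div k)"
        unfolding s_def power_mult[symmetric] power_add[symmetric] by simp
      then have "w ^ s * w ^ i' = w ^ (i + k - i') * w ^ i'" using wk by simp
      also have "\<dots> = w ^ (i + k)" unfolding power_add[symmetric] using i by simp
      finally show ?thesis using wk by (simp add: power_add)
    qed
    then have e1: "w ^ i' * inverse (w ^ i) = inverse w ^ s"
      using w0 by (simp add: power_inverse field_simps)
    have "(\<Sum>t<d. b i' t * cnj (a i t)) = (\<Sum>t<d. poly.coeff p t * (w ^ i' * inverse (w ^ i)) ^ t)"
    proof (rule sum.cong[OF refl])
      fix t
      have "cnj (a i t) = inverse (w ^ i) ^ t / of_real \<rho> ^ t"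
        by (simp add: a_def cw power_mult power_inverse)
      then show "b i' t * cnj (a i t) = poly.coeff p t * (w ^ i' * inverse (w ^ i)) ^ t"
        using \<rho>(2) by (simp add: b_def power_mult power_mult_distrib)
    qed
    also have "\<dots> = poly p (inverse w ^ s)" unfolding e1 pexp ..
    also have "\<dots> = 0" using proot i(3) by (simp add: s_def)
    finally show "(\<Sum>t<d. b i' t * cnj (a i t)) = 0" .
  next
    fix v :: "nat \<Rightarrow> complex" assume v: "\<exists>t<d. v t \<noteq> 0"
    show "card (side_zeros k d a v) + card (side_zeros k d b v) \<le> d - 1"
    proof (rule ccontr)
      assume "\<not> ?thesis"
      then have ge: "card (side_zeros k d a v) + card (side_zeros k d b v) \<ge> d" using d by linarith
      define \<alpha> where "\<alpha> = min d (card (side_zeros k d a v))"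
      obtain A where A: "A \<subseteq> side_zeros k d a v" "card A = \<alpha>"
        using obtain_subset_with_card_n[of \<alpha> "side_zeros k d a v"] by (auto simp: \<alpha>_def)
      have "d - \<alpha> \<le> card (side_zeros k d b v)" using ge unfolding \<alpha>_def by arith
      then obtain B where B: "B \<subseteq> side_zeros k d b v" "card B = d - \<alpha>"
        by (rule obtain_subset_with_card_n)
      have ABk: "A \<subseteq> {..<k}" "B \<subseteq> {..<k}" using A(1) B(1) by (auto simp: side_zeros_def)
      have cAB: "card A + card B = d" using A(2) B(2) by (simp add: \<alpha>_def)
      define M where "M = mixed_vandermonde (card A) 0 (\<lambda>c. w ^ e A c) (\<lambda>c. w ^ e B c) (\<Lambda> \<rho>)"
      have "(A, B) \<in> C" using ABk cAB by (simp add: C_def)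
      then have "cdet d M \<noteq> 0" using \<rho>(1) by (auto simp: M_def)
      then have det: "cdet d (\<lambda>i j. M j i) \<noteq> 0" by (simp only: cdet_transpose[of d M] not_False_eq_True)
      \<comment> \<open>After conjugation and rescaling, orthogonality of \<open>v\<close> to
        vectors of both kinds becomes a kernel equation for one transposed mixed Vandermonde
        matrix.\<close>
      define u where "u t = cnj (v t) / of_real \<rho> ^ t" for t
      have "\<forall>c<d. (\<Sum>t<d. M t c * u t) = 0"
      proof (intro allI impI)
        fix c assume c: "c < d"
        show "(\<Sum>t<d. M t c * u t) = 0"
        proof (cases "c < card A")
          case True
          then have "e A c \<in> A" using e[OF ABk(1)] by (auto simp: bij_betw_def)
          then have "(\<Sum>t<d. v t * cnj (a (e A c) t)) = 0" using A(1) by (auto simp: side_zeros_def)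
          then have "cnj (\<Sum>t<d. v t * cnj (a (e A c) t)) = 0" by simp
          moreover have "cnj (\<Sum>t<d. v t * cnj (a (e A c) t)) = (\<Sum>t<d. M t c * u t)"
            unfolding cnj_sum using True
            by (intro sum.cong) (simp_all add: M_def mixed_vandermonde_def u_def a_def power_mult)
          ultimately show ?thesis by simp
        next
          case False
          then have "e B (c - card A) \<in> B" using e[OF ABk(2)] c cAB by (auto simp: bij_betw_def)
          then have "(\<Sum>t<d. v t * cnj (b (e B (c - card A)) t)) = 0" using B(1) by (auto simp: side_zeros_def)
          then have "cnj (\<Sum>t<d. v t * cnj (b (e B (c - card A)) t)) = 0" by simp
          moreover have "cnj (\<Sum>t<d. v t * cnj (b (e B (c - card A)) t)) = (\<Sum>t<d. M t c * u t)"
            unfolding cnj_sum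
          proof (rule sum.cong[OF refl])
            fix t
            have "of_real \<rho> ^ (2 * t) = (of_real \<rho> ^ t * of_real \<rho> ^ t :: complex)" by (simp add: mult_2 power_add)
            then show "cnj (v t * cnj (b (e B (c - card A)) t)) = M t c * u t"
              using False \<rho>(2) by (simp add: M_def mixed_vandermonde_def u_def b_def \<Lambda>_def power_mult[of w])
          qed
          ultimately show ?thesis by simp
        qed
      qed
      then have "\<forall>t<d. u t = 0" using det unfolding cdet_nonzero_iff by blast
      then show False using v \<rho>(2) by (auto simp: u_def)
    qed
  qed
qed

text \<open>The \<open>e i\<close> are Fourier vectors padded with zeros. The \<open>f i\<close> are
  the same vectors multiplied by the eigenvalues of the circulant, with the lost norm restored in
  extra coordinates. Only the \<open>k - n - 1\<close> frequencies with eigenvalue of modulus below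
  1 need one, which explains the dimension \<open>2 * k - n - 1\<close>.\<close>

lemma special_side:
  assumes n: "n \<ge> 3" "n < k"
  obtains e f :: "nat \<Rightarrow> nat \<Rightarrow> complex" where
    "\<And>i i'. i < k \<Longrightarrow> i' < k \<Longrightarrow> i \<noteq> i' \<Longrightarrow> (\<Sum>t<2 * k - n - 1. e i t * cnj (e i' t)) = 0"
    "\<And>i i'. i < k \<Longrightarrow> i' < k \<Longrightarrow> i \<noteq> i' \<Longrightarrow> (\<Sum>t<2 * k - n - 1. f i t * cnj (f i' t)) = 0"
    "\<And>i i'. i < k \<Longrightarrow> i' < k \<Longrightarrow> n \<le> (i + k - i') mod k \<Longrightarrow> (\<Sum>t<2 * k - n - 1. f i' t * cnj (e i t)) = 0"
    "\<And>v. \<exists>t<2 * k - n - 1. v t \<noteq> 0 \<Longrightarrow>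
      card (side_zeros k (2 * k - n - 1) e v) + card (side_zeros k (2 * k - n - 1) f v) \<le> 2 * k - n - 1"
    "\<And>i. e i 0 \<noteq> 0" "\<And>i. f i 0 \<noteq> 0"
proof -
  define w where "w = cis (2 * pi / real k)"
  have k0: "k > 0" using n by simp
  have wk: "w ^ k = 1" unfolding w_def Complex.DeMoivre using k0 by simp
  have w0: "w \<noteq> 0" by (simp add: w_def)
  have cw: "cnj w = inverse w" by (simp add: w_def cis_cnj cis_inverse)
  define D where "D = 2 * k - n - 1"
  show ?thesis
  proof (rule unimodular_circulant_general[OF n], fold w_def D_def)
    fix U :: "complex poly"
    assume deg: "degree U < n" and one: "\<And>j. j \<le> n \<Longrightarrow> norm (poly U (w ^ j)) = 1"
      and less: "\<And>j. n < j \<Longrightarrow> j < k \<Longrightarrow> norm (poly U (w ^ j)) < 1"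
      and core: "\<And>A B a b. A \<subseteq> {..<k} \<Longrightarrow> B \<subseteq> {..<k} \<Longrightarrow> card A + card B \<le> n \<Longrightarrow>
       (\<And>j. j \<le> n \<Longrightarrow> (\<Sum>i\<in>A. a i * w ^ (i * j)) = poly U (w ^ j) * (\<Sum>i\<in>B. b i * w ^ (i * j))) \<Longrightarrow>
       (\<forall>i\<in>A. a i = 0) \<and> (\<forall>i\<in>B. b i = 0)"
    define lam where "lam j = poly U (w ^ j)" for j
    define rt where "rt j = sqrt (1 - (norm (lam j))\<^sup>2)" for j
    define e where "e i t = (if t < k then w ^ (i * t) else 0)" for i t
    \<comment> \<open>The extra coordinate \<open>t\<close> belongs to the frequency
      \<open>t - k + Suc n\<close>, the first of them being \<open>n + 1\<close>.\<close>
    define f where "f i t = (if t < k then lam t * w ^ (i * t)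
        else of_real (rt (t - k + Suc n)) * w ^ (i * (t - k + Suc n)))" for i t
    have Dk: "D = k + (k - Suc n)" using n by (simp add: D_def)
    have split: "(\<Sum>t<D. g t) = (\<Sum>t<k. g t) + (\<Sum>j\<in>{Suc n..<k}. g (j + k - Suc n))" for g :: "nat \<Rightarrow> complex"
    proof -
      have "(\<Sum>c<k - Suc n. g (k + c)) = (\<Sum>j\<in>{Suc n..<k}. g (j + k - Suc n))"
        by (rule sum.reindex_bij_witness[of _ "\<lambda>j. j - Suc n" "\<lambda>c. c + Suc n"]) (auto simp: add_ac)
      then show ?thesis unfolding Dk sum_lessThan_add by simp
    qed
    have etail: "e i (j + k - Suc n) = 0" if "Suc n \<le> j" for i j
      using that by (simp add: e_def)
    have ftail: "f i (j + k - Suc n) = of_real (rt j) * w ^ (i * j)" if "Suc n \<le> j" "j < k" for i j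
    proof -
      have "\<not> j + k - Suc n < k" "j + k - Suc n - k + Suc n = j" using that by auto
      then show ?thesis by (simp only: f_def if_False)
    qed
    have e_val: "e i j = w ^ (i * j)" and f_val: "f i j = lam j * w ^ (i * j)" if "j < k" for i j
      using that by (simp_all add: e_def f_def)
    have rt_sq: "of_real (rt j) * of_real (rt j) = (1 - lam j * cnj (lam j) :: complex)" if "j < k" for j
    proof -
      have "norm (lam j) \<le> 1" using one[of j] less[of j] that unfolding lam_def by (cases "j \<le> n") auto
      then have "1 - (norm (lam j))\<^sup>2 \<ge> 0" by (simp add: abs_square_le_1)
      then have "rt j * rt j = 1 - (norm (lam j))\<^sup>2" by (simp add: rt_def)
      then have "complex_of_real (rt j * rt j) = of_real (1 - (norm (lam j))\<^sup>2)" by simp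
      then show ?thesis by (simp only: of_real_mult of_real_diff of_real_1 complex_norm_square)
    qed
    have rt_pos: "rt j \<noteq> 0" if "j \<in> {Suc n..<k}" for j
    proof -
      have "norm (lam j) < 1" using less[of j] that unfolding lam_def by auto
      then have "(norm (lam j))\<^sup>2 < 1" by (simp add: abs_square_less_1)
      then show ?thesis by (simp add: rt_def)
    qed
    have rt_zero: "rt j = 0" if "j \<le> n" for j using one[OF that] by (simp add: rt_def lam_def)
    have e_orth: "(\<Sum>t<D. e i t * cnj (e i' t)) = 0" if "i < k" "i' < k" "i \<noteq> i'" for i i'
    proof -
      have "(\<Sum>t<D. e i t * cnj (e i' t)) = (\<Sum>j<k. w ^ (i * j) * cnj (w ^ (i' * j)))"
        unfolding split by (simp add: etail e_val)
      then show ?thesis using root_power_sum[OF k0 w_def that(1,2)] that(3) by simp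
    qed
    have f_orth: "(\<Sum>t<D. f i t * cnj (f i' t)) = 0" if "i < k" "i' < k" "i \<noteq> i'" for i i'
    proof -
      let ?q = "\<lambda>j. w ^ (i * j) * cnj (w ^ (i' * j))"
      have "(\<Sum>j\<in>{Suc n..<k}. f i (j + k - Suc n) * cnj (f i' (j + k - Suc n))) =
          (\<Sum>j\<in>{Suc n..<k}. of_real (rt j) * of_real (rt j) * ?q j)"
        by (rule sum.cong[OF refl]) (simp add: ftail mult_ac del: complex_cnj_power)
      also have "\<dots> = (\<Sum>j<k. of_real (rt j) * of_real (rt j) * ?q j)"
        by (rule sum.mono_neutral_left) (auto simp: rt_zero not_less_eq_eq)
      finally have "(\<Sum>t<D. f i t * cnj (f i' t)) =
          (\<Sum>j<k. lam j * cnj (lam j) * ?q j) + (\<Sum>j<k. of_real (rt j) * of_real (rt j) * ?q j)"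
        unfolding split by (simp add: f_val mult_ac)
      also have "\<dots> = (\<Sum>j<k. ?q j)"
        unfolding sum.distrib[symmetric] by (rule sum.cong[OF refl]) (simp only: rt_sq lessThan_iff, simp add: algebra_simps)
      finally show ?thesis using root_power_sum[OF k0 w_def that(1,2)] that(3) by simp
    qed
    \<comment> \<open>Orthogonality of characters picks out the coefficient of \<open>U\<close> at
      the residue \<open>i - i'\<close>, which is zero from \<open>n\<close> on by the degree
      bound.\<close>
    have ef_orth: "(\<Sum>t<D. f i' t * cnj (e i t)) = 0" if "i < k" "i' < k" "n \<le> (i + k - i') mod k" for i i'
    proof -
      have "(\<Sum>t<D. f i' t * cnj (e i t)) = (\<Sum>j<k. lam j * (w ^ (i' * j) * cnj (w ^ (i * j))))"
        unfolding split by (simp add: f_val e_val etail mult_ac)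
      also have "\<dots> = (\<Sum>j<k. \<Sum>s\<le>degree U. poly.coeff U s * (w ^ ((s + i') mod k * j) * cnj (w ^ (i * j))))"
      proof (rule sum.cong[OF refl])
        fix j
        have "w ^ ((s + i') mod k * j) = (w ^ j) ^ s * w ^ (i' * j)" for s
        proof -
          have "w ^ (s + i') = w ^ ((s + i') mod k) * (w ^ k) ^ ((s + i') div k)"
            unfolding power_mult[symmetric] power_add[symmetric] by simp
          then have "w ^ ((s + i') mod k) = w ^ (s + i')" using wk by simp
          then have "w ^ ((s + i') mod k * j) = w ^ ((s + i') * j)" by (simp add: power_mult)
          then show ?thesis by (simp add: power_mult[symmetric] power_add[symmetric] algebra_simps)
        qed
        then show "lam j * (w ^ (i' * j) * cnj (w ^ (i * j))) =
            (\<Sum>s\<le>degree U. poly.coeff U s * (w ^ ((s + i') mod k * j) * cnj (w ^ (i * j))))"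
          unfolding lam_def poly_altdef by (simp add: sum_distrib_left sum_distrib_right mult_ac)
      qed
      also have "\<dots> = (\<Sum>s\<le>degree U. poly.coeff U s * (\<Sum>j<k. w ^ ((s + i') mod k * j) * cnj (w ^ (i * j))))"
        by (subst sum.swap) (simp add: sum_distrib_left)
      also have "\<dots> = 0"
      proof (rule sum.neutral, rule ballI)
        fix s assume "s \<in> {..degree U}"
        then have s: "s < n" using deg by simp
        have "(s + i') mod k \<noteq> i"
        proof
          assume eq: "(s + i') mod k = i"
          have "(i + k - i') mod k = ((s + i') mod k + (k - i')) mod k" using eq that by simp
          also have "\<dots> = (s + i' + (k - i')) mod k" by (rule mod_add_left_eq)
          also have "\<dots> = s" using that s n by simp
          finally show False using that s by simp
        qed
        then show "poly.coeff U s * (\<Sum>j<k. w ^ ((s + i') mod k * j) * cnj (w ^ (i * j))) = 0"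
          using root_power_sum[OF k0 w_def, of "(s + i') mod k" i] k0 that by simp
      qed
      finally show ?thesis .
    qed
    have zeros: "card (side_zeros k D e v) + card (side_zeros k D f v) \<le> D" if v: "\<exists>t<D. v t \<noteq> 0" for v
    proof (rule ccontr)
      assume "\<not> ?thesis"
      then have gt: "card (side_zeros k D e v) + card (side_zeros k D f v) \<ge> D + 1" by simp
      define A where "A = {..<k} - side_zeros k D e v"
      define B where "B = {..<k} - side_zeros k D f v"
      have sub: "side_zeros k D e v \<subseteq> {..<k}" "side_zeros k D f v \<subseteq> {..<k}" by (auto simp: side_zeros_def)
      have "card A = k - card (side_zeros k D e v)" "card B = k - card (side_zeros k D f v)"
        unfolding A_def B_def using sub by (simp_all add: card_Diff_subset finite_subset)
      moreover have "card (side_zeros k D e v) \<le> k" "card (side_zeros k D f v) \<le> k"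
        using card_mono[OF _ sub(1)] card_mono[OF _ sub(2)] by simp_all
      ultimately have "card A + card (side_zeros k D e v) = k" "card B + card (side_zeros k D f v) = k" by auto
      moreover have "D + n + 1 = 2 * k" using n by (simp add: D_def)
      ultimately have AB: "card A + card B \<le> n" using gt by linarith
      define x where "x j = v j" for j
      \<comment> \<open>Up to the factor \<open>k\<close>, \<open>x\<close> and \<open>y\<close> are
        the Fourier transforms of the products of \<open>v\<close> with the \<open>e i\<close> and
        \<open>f i\<close>. For \<open>j <= n\<close> the extra coordinates are absent and the
        eigenvalue is unimodular, hence \<open>x j = lam j * y j\<close>.\<close>
      define y where "y j = cnj (lam j) * v j + (if j \<le> n then 0 else of_real (rt j) * v (j + k - Suc n))" for j
      define a where "a i = (\<Sum>t<D. v t * cnj (e i t))" for i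
      define b where "b i = (\<Sum>t<D. v t * cnj (f i t))" for i
      have a_eq: "a i = (\<Sum>j<k. x j * cnj (w ^ (i * j)))" for i
        unfolding a_def split by (simp add: e_val etail x_def)
      have b_eq: "b i = (\<Sum>j<k. y j * cnj (w ^ (i * j)))" for i
      proof -
        have "(\<Sum>j\<in>{Suc n..<k}. v (j + k - Suc n) * cnj (f i (j + k - Suc n))) =
            (\<Sum>j\<in>{Suc n..<k}. (if j \<le> n then 0 else of_real (rt j) * v (j + k - Suc n)) * cnj (w ^ (i * j)))"
          by (rule sum.cong[OF refl]) (simp add: ftail mult_ac)
        also have "\<dots> = (\<Sum>j<k. (if j \<le> n then 0 else of_real (rt j) * v (j + k - Suc n)) * cnj (w ^ (i * j)))"
          by (rule sum.mono_neutral_left) auto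
        finally have t: "(\<Sum>j\<in>{Suc n..<k}. v (j + k - Suc n) * cnj (f i (j + k - Suc n))) =
          (\<Sum>j<k. (if j \<le> n then 0 else of_real (rt j) * v (j + k - Suc n)) * cnj (w ^ (i * j)))" .
        show ?thesis unfolding b_def split t y_def distrib_right sum.distrib by (simp add: f_val mult_ac)
      qed
      have inversion: "(\<Sum>i<k. (\<Sum>j<k. z j * cnj (w ^ (i * j))) * w ^ (i * j')) = of_nat k * z j'" if "j' < k" for z j'
      proof -
        have "(\<Sum>i<k. (\<Sum>j<k. z j * cnj (w ^ (i * j))) * w ^ (i * j')) =
            (\<Sum>j<k. z j * (\<Sum>i<k. w ^ (j' * i) * cnj (w ^ (j * i))))"
          unfolding sum_distrib_left sum_distrib_right by (subst sum.swap) (simp add: mult_ac)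
        also have "\<dots> = (\<Sum>j<k. if j = j' then of_nat k * z j' else 0)"
          by (rule sum.cong[OF refl]) (use root_power_sum[OF k0 w_def that] in \<open>auto simp: mult_ac\<close>)
        finally show ?thesis using that by simp
      qed
      have sumA: "(\<Sum>i\<in>A. a i * w ^ (i * j)) = of_nat k * x j" if "j < k" for j
      proof -
        have "(\<Sum>i\<in>A. a i * w ^ (i * j)) = (\<Sum>i<k. a i * w ^ (i * j))"
          by (rule sum.mono_neutral_left) (auto simp: A_def side_zeros_def a_def)
        then show ?thesis using inversion[OF that, of x] unfolding a_eq by simp
      qed
      have sumB: "(\<Sum>i\<in>B. b i * w ^ (i * j)) = of_nat k * y j" if "j < k" for j
      proof -
        have "(\<Sum>i\<in>B. b i * w ^ (i * j)) = (\<Sum>i<k. b i * w ^ (i * j))"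
          by (rule sum.mono_neutral_left) (auto simp: B_def side_zeros_def b_def)
        then show ?thesis using inversion[OF that, of y] unfolding b_eq by simp
      qed
      have "(\<forall>i\<in>A. a i = 0) \<and> (\<forall>i\<in>B. b i = 0)"
      proof (rule core[OF _ _ AB])
        show "A \<subseteq> {..<k}" "B \<subseteq> {..<k}" by (auto simp: A_def B_def)
        fix j assume j: "j \<le> n"
        have "lam j * cnj (lam j) = 1" using one[OF j] by (simp add: lam_def complex_norm_square[symmetric])
        then have "x j = lam j * y j" using j by (simp add: x_def y_def mult.assoc[symmetric])
        then show "(\<Sum>i\<in>A. a i * w ^ (i * j)) = poly U (w ^ j) * (\<Sum>i\<in>B. b i * w ^ (i * j))"
          using sumA[of j] sumB[of j] j n by (simp add: lam_def)
      qed
      then have x0: "x j = 0" and y0: "y j = 0" if "j < k" for j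
        using sumA[OF that] sumB[OF that] k0 by simp_all
      have "v t = 0" if t: "t < D" for t
      proof (cases "t < k")
        case True
        then show ?thesis using x0[of t] by (simp add: x_def)
      next
        case False
        define j where "j = t - k + Suc n"
        have j: "j \<in> {Suc n..<k}" "j + k - Suc n = t" using False t by (auto simp: j_def Dk)
        then have "of_real (rt j) * v t = 0" using y0[of j] x0[of j] by (simp add: y_def x_def)
        then show ?thesis using rt_pos[OF j(1)] by simp
      qed
      then show False using v by blast
    qed
    show thesis
    proof (rule that[of e f], fold D_def)
      show "e i 0 \<noteq> 0" "f i 0 \<noteq> 0" for i using k0 one[of 0] by (auto simp: e_val f_val lam_def)
      show "(\<Sum>t<D. e i t * cnj (e i' t)) = 0" if "i < k" "i' < k" "i \<noteq> i'" for i i'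
        by (rule e_orth[OF that])
      show "(\<Sum>t<D. f i t * cnj (f i' t)) = 0" if "i < k" "i' < k" "i \<noteq> i'" for i i'
        by (rule f_orth[OF that])
      show "(\<Sum>t<D. f i' t * cnj (e i t)) = 0" if "i < k" "i' < k" "n \<le> (i + k - i') mod k" for i i'
        by (rule ef_orth[OF that])
      show "card (side_zeros k D e v) + card (side_zeros k D f v) \<le> D" if "\<exists>t<D. v t \<noteq> 0" for v
        by (rule zeros[OF that])
    qed
  qed
qed

section \<open>Unextendable product bases\<close>

lemma tinner_prod_tensor:
  "tinner p d (prod_tensor p d v) (prod_tensor p d w) = (\<Prod>j<p. \<Sum>t<d j. v j t * cnj (w j t))"
proof -
  have "tinner p d (prod_tensor p d v) (prod_tensor p d w) =
      (\<Sum>i\<in>idx p d. \<Prod>j<p. v j (i j) * cnj (w j (i j)))"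
    unfolding tinner_def by (rule sum.cong) (simp_all add: prod_tensor_def prod.distrib)
  also have "\<dots> = (\<Prod>j<p. \<Sum>t<d j. v j t * cnj (w j t))"
    unfolding idx_def by (rule prod_sum_PiE[symmetric]) auto
  finally show ?thesis .
qed

lemma is_product_vector_prod_tensor:
  "is_product_vector p d (prod_tensor p d v) \<longleftrightarrow> (\<forall>j<p. \<exists>t<d j. v j t \<noteq> 0)"
proof
  assume "is_product_vector p d (prod_tensor p d v)"
  then obtain i where i: "i \<in> idx p d" "(\<Prod>j<p. v j (i j)) \<noteq> 0"
    by (auto simp: is_product_vector_def prod_tensor_def split: if_splits)
  show "\<forall>j<p. \<exists>t<d j. v j t \<noteq> 0"
  proof (intro allI impI)
    fix j assume "j < p"
    then have "i j < d j" "v j (i j) \<noteq> 0" using i by (auto simp: idx_def PiE_def Pi_def)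
    then show "\<exists>t<d j. v j t \<noteq> 0" by blast
  qed
next
  assume "\<forall>j<p. \<exists>t<d j. v j t \<noteq> 0"
  then obtain i where i: "\<And>j. j < p \<Longrightarrow> i j < d j \<and> v j (i j) \<noteq> 0" by metis
  define i' where "i' = restrict i {..<p}"
  have "i' \<in> idx p d" using i by (auto simp: idx_def i'_def)
  moreover have "prod_tensor p d v i' \<noteq> 0"
    using \<open>i' \<in> idx p d\<close> i by (simp add: prod_tensor_def i'_def)
  ultimately show "is_product_vector p d (prod_tensor p d v)"
    unfolding is_product_vector_def by blast
qed

lemma inner_zero_commute:
  "(\<Sum>t<m. x t * cnj (y t)) = 0 \<longleftrightarrow> (\<Sum>t<m. y t * cnj (x t)) = 0" for x y :: "nat \<Rightarrow> complex"
proof -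
  have "cnj (\<Sum>t<m. x t * cnj (y t)) = (\<Sum>t<m. y t * cnj (x t))"
    by (simp add: mult.commute)
  then show ?thesis by (metis complex_cnj_zero_iff)
qed

section \<open>The lower bound\<close>

lemma distribute:
  assumes "finite J" "finite S" "card S \<le> (\<Sum>j\<in>J. m j)"
  shows "\<exists>c. (\<forall>x\<in>S. c x \<in> J) \<and> (\<forall>j\<in>J. card {x\<in>S. c x = j} \<le> m j)"
  using assms
proof (induction J arbitrary: S)
  case empty
  then show ?case by simp
next
  case (insert j J)
  obtain T where T: "T \<subseteq> S" "card T = min (card S) (m j)"
    using obtain_subset_with_card_n[of "min (card S) (m j)" S] by auto
  have "card (S - T) \<le> (\<Sum>j\<in>J. m j)"
    using T insert.prems insert.hyps by (simp add: card_Diff_subset finite_subset)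
  then obtain c where c: "\<And>x. x \<in> S - T \<Longrightarrow> c x \<in> J" "\<And>i. i \<in> J \<Longrightarrow> card {x\<in>S - T. c x = i} \<le> m i"
    using insert.IH[of "S - T"] insert.prems by auto
  define c' where "c' x = (if x \<in> T then j else c x)" for x
  have "card {x\<in>S. c' x = i} \<le> m i" if "i \<in> insert j J" for i
  proof (cases "i = j")
    case True
    then have "{x\<in>S. c' x = i} = T" using T c insert.hyps by (auto simp: c'_def)
    then show ?thesis using T True by simp
  next
    case False
    then have "{x\<in>S. c' x = i} = {x\<in>S - T. c x = i}" by (auto simp: c'_def)
    then show ?thesis using c(2)[of i] that False by simp
  qed
  moreover have "c' x \<in> insert j J" if "x \<in> S" for x using that c(1) by (auto simp: c'_def)
  ultimately show ?case by blast
qed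

lemma even_card_symmetric:
  assumes "finite E" "\<And>x y. (x, y) \<in> E \<Longrightarrow> (y, x) \<in> E \<and> x \<noteq> y"
  shows "even (card E)"
  using assms
proof (induction "card E" arbitrary: E rule: less_induct)
  case less
  show ?case
  proof (cases "E = {}")
    case False
    then obtain x y where xy: "(x, y) \<in> E" by auto
    then have yx: "(y, x) \<in> E" "x \<noteq> y" using less.prems by auto
    let ?E = "E - {(x, y), (y, x)}"
    have sub: "{(x, y), (y, x)} \<subseteq> E" using xy yx by simp
    have c2: "card {(x, y), (y, x)} = 2" using yx by simp
    have c: "card ?E = card E - 2" using card_Diff_subset[OF _ sub] c2 by simp
    have ge: "card E \<ge> 2" using card_mono[OF less.prems(1) sub] c2 by simp
    have "even (card ?E)"
    proof (rule less.hyps)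
      show "card ?E < card E" using c ge by simp
      show "finite ?E" using less.prems(1) by simp
      show "(b, a) \<in> ?E \<and> a \<noteq> b" if "(a, b) \<in> ?E" for a b using that less.prems(2) by blast
    qed
    then show ?thesis using c ge by simp
  qed simp
qed

text \<open>If the members assigned to each factor do not span it, the tensor product of the normal
  vectors is orthogonal to all members. It cannot be a member itself, since it would be orthogonal
  to itself in spite of norm 1.\<close>

lemma UPB_no_nonspanning_cover:
  assumes S: "is_UPB p d S" and V: "\<And>x. x \<in> S \<Longrightarrow> x = prod_tensor p d (V x)"
    and c: "\<And>x. x \<in> S \<Longrightarrow> c x < p"
    and u: "\<And>j. j < p \<Longrightarrow> \<exists>u. (\<exists>t<d j. u t \<noteq> 0) \<and> (\<forall>x\<in>S. c x = j \<longrightarrow> (\<Sum>t<d j. u t * cnj (V x j t)) = 0)"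
  shows False
proof -
  obtain u where u: "\<And>j. j < p \<Longrightarrow> (\<exists>t<d j. u j t \<noteq> 0) \<and> (\<forall>x\<in>S. c x = j \<longrightarrow> (\<Sum>t<d j. u j t * cnj (V x j t)) = 0)"
    using u by metis
  define y where "y = prod_tensor p d u"
  have prod: "is_product_vector p d y" unfolding y_def is_product_vector_prod_tensor using u by blast
  have orth: "tinner p d y x = 0" if "x \<in> S" for x
  proof -
    have "tinner p d y x = (\<Prod>j<p. \<Sum>t<d j. u j t * cnj (V x j t))"
      unfolding y_def by (subst V[OF that]) (rule tinner_prod_tensor)
    also have "\<dots> = 0" using u[of "c x"] c[OF that] that by (intro prod_zero) auto
    finally show ?thesis .
  qed
  have "y \<notin> S"
  proof
    assume "y \<in> S"
    then have "tinner p d y y = 1" using S by (simp add: is_UPB_def)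
    then show False using orth[OF \<open>y \<in> S\<close>] by simp
  qed
  then show False using S prod orth by (auto simp: is_UPB_def)
qed

lemma UPB_card_gt:
  assumes S: "is_UPB p d S" and d: "\<And>j. j < p \<Longrightarrow> 2 \<le> d j"
    and odd: "odd (f_N p d)" and ev: "\<exists>j<p. even (d j)"
  shows "card S \<ge> f_N p d + 1"
proof -
  have fin: "finite S" and unit: "\<And>x. x \<in> S \<Longrightarrow> is_product_vector p d x"
    and orth: "\<And>x y. x \<in> S \<Longrightarrow> y \<in> S \<Longrightarrow> x \<noteq> y \<Longrightarrow> tinner p d x y = 0"
    using S by (auto simp: is_UPB_def)
  have "\<forall>x\<in>S. \<exists>v. x = prod_tensor p d v" using unit by (auto simp: is_product_vector_def)
  then obtain V where V: "\<And>x. x \<in> S \<Longrightarrow> x = prod_tensor p d (V x)" by metis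
  have Vnz: "\<exists>t<d j. V x j t \<noteq> 0" if "x \<in> S" "j < p" for x j
    using unit[OF that(1)] V[OF that(1)] is_product_vector_prod_tensor[of p d "V x"] that(2) by metis
  have small: "\<exists>u. (\<exists>t<d j. u t \<noteq> 0) \<and> (\<forall>x\<in>T. (\<Sum>t<d j. u t * cnj (V x j t)) = 0)"
    if "T \<subseteq> S" "card T \<le> d j - 1" "j < p" for T j
  proof -
    have "finite T" "card T < d j" using that fin finite_subset d[of j] by auto
    then obtain u where "\<exists>t<d j. u t \<noteq> 0" "\<forall>x\<in>T. (\<Sum>t<d j. u t * cnj (V x j t)) = 0"
      using homogeneous_solution_set[of T "d j" "\<lambda>x t. cnj (V x j t)"] by blast
    then show ?thesis by blast
  qed
  have ge: "card S \<ge> f_N p d"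
  proof (rule ccontr)
    assume "\<not> ?thesis"
    then have "card S \<le> (\<Sum>j<p. d j - 1)" by (simp add: f_N_def)
    then obtain c where c: "\<forall>x\<in>S. c x \<in> {..<p}" "\<forall>j\<in>{..<p}. card {x\<in>S. c x = j} \<le> d j - 1"
      using distribute[OF finite_lessThan fin] by blast
    show False
    proof (rule UPB_no_nonspanning_cover[OF S V])
      show "c x < p" if "x \<in> S" for x using c(1) that by simp
      show "\<exists>u. (\<exists>t<d j. u t \<noteq> 0) \<and> (\<forall>x\<in>S. c x = j \<longrightarrow> (\<Sum>t<d j. u t * cnj (V x j t)) = 0)" if "j < p" for j
        using small[of "{x\<in>S. c x = j}" j] c(2) that by auto
    qed
  qed
  have "card S \<noteq> f_N p d"
  proof
    assume eq: "card S = f_N p d"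
    define N where "N j x = {y\<in>S. y \<noteq> x \<and> (\<Sum>t<d j. V x j t * cnj (V y j t)) = 0}" for j x
    have finN: "finite (N j x)" for j x using fin by (simp add: N_def)
    have NS: "N j x \<subseteq> S" for j x by (auto simp: N_def)
    \<comment> \<open>With \<open>d j\<close> neighbours in factor \<open>j\<close>, the component
      of \<open>x\<close> is a normal vector for all of them, and the other factors have room for
      the remaining members.\<close>
    have le: "card (N j x) \<le> d j - 1" if x: "x \<in> S" and j: "j < p" for x j
    proof (rule ccontr)
      assume "\<not> ?thesis"
      then have gt: "card (N j x) \<ge> d j" using d[OF j] by simp
      have "(\<Sum>i<p. d i - 1) = (d j - 1) + (\<Sum>i\<in>{..<p} - {j}. d i - 1)"
        using j by (simp add: sum.remove)
      then have "card (S - N j x) \<le> (\<Sum>i\<in>{..<p} - {j}. d i - 1)"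
        using gt eq d[OF j] finN NS by (simp add: card_Diff_subset f_N_def)
      then obtain c where c: "\<forall>y\<in>S - N j x. c y \<in> {..<p} - {j}"
        "\<forall>i\<in>{..<p} - {j}. card {y\<in>S - N j x. c y = i} \<le> d i - 1"
        using distribute[of "{..<p} - {j}" "S - N j x" "\<lambda>i. d i - 1"] fin by auto
      define c' where "c' y = (if y \<in> N j x then j else c y)" for y
      show False
      proof (rule UPB_no_nonspanning_cover[OF S V])
        show "c' y < p" if "y \<in> S" for y using c(1) that j by (auto simp: c'_def)
        show "\<exists>u. (\<exists>t<d i. u t \<noteq> 0) \<and> (\<forall>y\<in>S. c' y = i \<longrightarrow> (\<Sum>t<d i. u t * cnj (V y i t)) = 0)" if i: "i < p" for i
        proof (cases "i = j")
          case True
          have "(\<Sum>t<d j. V x j t * cnj (V y j t)) = 0" if "y \<in> S" "c' y = j" for y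
          proof -
            have "y \<in> N j x" using that c(1) by (auto simp: c'_def split: if_splits)
            then show ?thesis by (simp add: N_def)
          qed
          then show ?thesis using Vnz[OF x j] True by blast
        next
          case False
          have "{y\<in>S. c' y = i} = {y\<in>S - N j x. c y = i}" using False by (auto simp: c'_def)
          then show ?thesis using small[of "{y\<in>S. c' y = i}" i] c(2) i False by auto
        qed
      qed
    qed
    \<comment> \<open>Each of the \<open>f_N p d - 1\<close> other members is orthogonal to
      \<open>x\<close> in some factor, and the upper bounds add up to exactly this number, so all of
      them are attained.\<close>
    have deg: "card (N j x) = d j - 1" if x: "x \<in> S" and j: "j < p" for x j
    proof (rule ccontr)
      assume "card (N j x) \<noteq> d j - 1"
      then have lt: "card (N j x) < d j - 1" using le[OF x j] by simp
      have "S - {x} \<subseteq> (\<Union>i<p. N i x)"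
      proof
        fix y assume y: "y \<in> S - {x}"
        then have "tinner p d (prod_tensor p d (V x)) (prod_tensor p d (V y)) = 0"
          using orth[of x y] x V[of x] V[of y] by auto
        then have "\<exists>i<p. (\<Sum>t<d i. V x i t * cnj (V y i t)) = 0"
          unfolding tinner_prod_tensor by (auto simp: prod_zero_iff)
        then show "y \<in> (\<Union>i<p. N i x)" using y by (auto simp: N_def)
      qed
      then have "card (S - {x}) \<le> card (\<Union>i<p. N i x)" by (intro card_mono) (auto simp: finN)
      also have "\<dots> \<le> (\<Sum>i<p. card (N i x))" by (rule card_UN_le) simp
      also have "\<dots> < (\<Sum>i<p. d i - 1)"
        by (rule sum_strict_mono_ex1) (use le[OF x] lt j in auto)
      finally show False using eq x fin by (simp add: f_N_def)
    qed
    obtain j where j: "j < p" "even (d j)" using ev by blast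
    \<comment> \<open>Counting ordered pairs: a symmetric irreflexive relation has even size, but
      here the size is a product of two odd numbers.\<close>
    define E where "E = (SIGMA x:S. N j x)"
    have "even (card E)"
    proof (rule even_card_symmetric)
      show "finite E" using fin finN by (simp add: E_def)
      show "(y, x) \<in> E \<and> x \<noteq> y" if "(x, y) \<in> E" for x y
        using that inner_zero_commute[of "V x j" "V y j" "d j"] by (auto simp: E_def N_def)
    qed
    moreover have "card E = card S * (d j - 1)"
      unfolding E_def using fin finN deg[OF _ j(1)] by (simp add: card_SigmaI)
    moreover have "odd (d j - 1)" using j d[OF j(1)] by simp
    ultimately show False using odd eq by simp
  qed
  then show ?thesis using ge by simp
qed

section \<open>The construction\<close>

lemma UPB_exists:
  assumes d: "\<And>j. j \<le> q \<Longrightarrow> 2 \<le> d j"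
    and n: "n = (\<Sum>j<q. d j - 1)" "n \<ge> 3" and k: "2 * k = n + d q + 1" "n < k"
  shows "\<exists>S. is_UPB (Suc q) d S \<and> card S = 2 * k"
proof -
  \<comment> \<open>The partial sums cut the residues below \<open>n\<close> into consecutive
    intervals of length \<open>d j - 1\<close>, one for each factor before the last.\<close>
  define \<sigma> where "\<sigma> j = (\<Sum>i<j. d i - 1)" for j
  have \<sigma>_Suc: "\<sigma> (Suc j) = \<sigma> j + (d j - 1)" for j by (simp add: \<sigma>_def)
  have \<sigma>_le: "\<sigma> j \<le> n" if "j \<le> q" for j
    unfolding \<sigma>_def n(1) using that by (intro sum_mono2) auto
  define good where "good j a b \<longleftrightarrow>
      (\<forall>i<k. \<forall>i'<k. (i + k - i') mod k \<in> {\<sigma> j..<\<sigma> (Suc j)} \<longrightarrow> (\<Sum>t<d j. b i' t * cnj (a i t)) = 0) \<and>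
      (\<forall>v. (\<exists>t<d j. v t \<noteq> 0) \<longrightarrow> card (side_zeros k (d j) a v) + card (side_zeros k (d j) b v) \<le> d j - 1) \<and>
      (\<forall>i. a i 0 \<noteq> 0 \<and> b i 0 \<noteq> 0)" for j and a b :: "nat \<Rightarrow> nat \<Rightarrow> complex"
  have "\<forall>j. \<exists>ab. j < q \<longrightarrow> good j (fst ab) (snd ab)"
  proof
    fix j
    show "\<exists>ab. j < q \<longrightarrow> good j (fst ab) (snd ab)"
    proof (cases "j < q")
      case True
      have le: "\<sigma> j + (d j - 1) \<le> n" using \<sigma>_le[of "Suc j"] \<sigma>_Suc[of j] True by simp
      have d2: "2 \<le> d j" "d j \<le> k" "\<sigma> j + (d j - 1) \<le> k" using d[of j] True le k(2) by auto
      show ?thesis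
      proof (rule generic_side[OF d2], fold \<sigma>_Suc)
        fix a b :: "nat \<Rightarrow> nat \<Rightarrow> complex"
        assume h: "\<And>i i'. i < k \<Longrightarrow> i' < k \<Longrightarrow> (i + k - i') mod k \<in> {\<sigma> j..<\<sigma> (Suc j)} \<Longrightarrow> (\<Sum>t<d j. b i' t * cnj (a i t)) = 0"
          "\<And>v. \<exists>t<d j. v t \<noteq> 0 \<Longrightarrow> card (side_zeros k (d j) a v) + card (side_zeros k (d j) b v) \<le> d j - 1"
          "\<And>i. a i 0 \<noteq> 0" "\<And>i. b i 0 \<noteq> 0"
        have "good j a b" unfolding good_def by (intro impI conjI allI h)
        then show ?thesis by (intro exI[of _ "(a, b)"]) simp
      qed
    qed simp
  qed
  from choice[OF this] obtain g where g: "\<forall>j. j < q \<longrightarrow> good j (fst (g j)) (snd (g j))" by blast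
  define a where "a j = fst (g j)" for j
  define b where "b j = snd (g j)" for j
  have ab: "(\<forall>i<k. \<forall>i'<k. (i + k - i') mod k \<in> {\<sigma> j..<\<sigma> (Suc j)} \<longrightarrow> (\<Sum>t<d j. b j i' t * cnj (a j i t)) = 0) \<and>
      (\<forall>v. (\<exists>t<d j. v t \<noteq> 0) \<longrightarrow> card (side_zeros k (d j) (a j) v) + card (side_zeros k (d j) (b j) v) \<le> d j - 1) \<and>
      (\<forall>i. a j i 0 \<noteq> 0 \<and> b j i 0 \<noteq> 0)" if "j < q" for j
    using g that unfolding good_def a_def b_def by blast
  have dq: "2 * k - n - 1 = d q" using k by simp
  obtain e f where ef:
    "\<And>i i'. i < k \<Longrightarrow> i' < k \<Longrightarrow> i \<noteq> i' \<Longrightarrow> (\<Sum>t<d q. e i t * cnj (e i' t)) = 0"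
    "\<And>i i'. i < k \<Longrightarrow> i' < k \<Longrightarrow> i \<noteq> i' \<Longrightarrow> (\<Sum>t<d q. f i t * cnj (f i' t)) = 0"
    "\<And>i i'. i < k \<Longrightarrow> i' < k \<Longrightarrow> n \<le> (i + k - i') mod k \<Longrightarrow> (\<Sum>t<d q. f i' t * cnj (e i t)) = 0"
    "\<And>v. \<exists>t<d q. v t \<noteq> 0 \<Longrightarrow> card (side_zeros k (d q) e v) + card (side_zeros k (d q) f v) \<le> d q"
    "\<And>i. e i 0 \<noteq> 0" "\<And>i. f i 0 \<noteq> 0"
    by (rule special_side[OF n(2) k(2), unfolded dq]) (rule that)
  define A where "A j = (if j < q then a j else e)" for j
  define B where "B j = (if j < q then b j else f)" for j
  define vec where "vec v j t = (if v < k then A j v t else B j (v - k) t)" for v j t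
  \<comment> \<open>Coordinate 0 serves as the witness that each local vector is nonzero and can be
    normalized.\<close>
  have vec0: "vec v j 0 \<noteq> 0" for v j
    using ab[of j] ef(5,6) by (auto simp: vec_def A_def B_def)
  have d0: "0 < d j" if "j \<le> q" for j using d[OF that] by simp
  have cross: "\<exists>j\<le>q. (\<Sum>t<d j. B j i' t * cnj (A j i t)) = 0" if i: "i < k" "i' < k" for i i'
  proof (cases "n \<le> (i + k - i') mod k")
    case True
    then show ?thesis using ef(3)[OF i] by (intro exI[of _ q]) (simp add: A_def B_def)
  next
    case False
    define \<delta> where "\<delta> = (i + k - i') mod k"
    define j where "j = (LEAST j. \<delta> < \<sigma> (Suc j))"
    have q0: "q > 0" using n by (cases q) auto
    have "\<delta> < \<sigma> (Suc (q - 1))" using False q0 by (simp add: \<delta>_def \<sigma>_def n(1))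
    then have j: "\<delta> < \<sigma> (Suc j)" "j \<le> q - 1" unfolding j_def by (auto intro: LeastI Least_le)
    have "\<sigma> j \<le> \<delta>"
    proof (cases j)
      case (Suc j')
      then have "\<not> \<delta> < \<sigma> (Suc j')" using not_less_Least[of j' "\<lambda>j. \<delta> < \<sigma> (Suc j)"] by (simp add: j_def)
      then show ?thesis using Suc by simp
    qed (simp add: \<sigma>_def)
    then show ?thesis using ab[of j] j q0 i by (intro exI[of _ j]) (auto simp: A_def B_def \<delta>_def)
  qed
  have orth: "\<exists>j\<le>q. (\<Sum>t<d j. vec v j t * cnj (vec v' j t)) = 0"
    if "v < 2 * k" "v' < 2 * k" "v \<noteq> v'" for v v'
  proof -
    consider "v < k" "v' < k" | "\<not> v < k" "\<not> v' < k" | "v < k" "\<not> v' < k" | "\<not> v < k" "v' < k" by blast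
    then show ?thesis
    proof cases
      case 1
      then show ?thesis using ef(1)[of v v'] that by (intro exI[of _ q]) (simp add: vec_def A_def)
    next
      case 2
      then show ?thesis using ef(2)[of "v - k" "v' - k"] that by (intro exI[of _ q]) (simp add: vec_def B_def)
    next
      case 3
      then have lt: "v < k" "v' - k < k" using that by linarith+
      then obtain j where "j \<le> q" "(\<Sum>t<d j. B j (v' - k) t * cnj (A j v t)) = 0"
        using cross[of v "v' - k"] lt by auto
      then show ?thesis using 3 inner_zero_commute[of "B j (v' - k)" "A j v" "d j"]
        by (intro exI[of _ j]) (simp add: vec_def)
    next
      case 4
      then have lt: "v' < k" "v - k < k" using that by linarith+
      then obtain j where "j \<le> q" "(\<Sum>t<d j. B j (v - k) t * cnj (A j v' t)) = 0"
        using cross[of v' "v - k"] lt by auto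
      then show ?thesis using 4 by (intro exI[of _ j]) (simp add: vec_def)
    qed
  qed
  \<comment> \<open>The last factor is allowed one zero more than general position would give. The
    bounds still add up to \<open>n + d q\<close>, one less than the number of members, which is
    what makes the basis unextendible.\<close>
  have zeros: "card {v. v < 2 * k \<and> (\<Sum>t<d j. u t * cnj (vec v j t)) = 0} \<le> (if j < q then d j - 1 else d j)"
    if j: "j \<le> q" and u: "\<exists>t<d j. u t \<noteq> 0" for j u
  proof -
    have "{v. v < 2 * k \<and> (\<Sum>t<d j. u t * cnj (vec v j t)) = 0} =
        side_zeros k (d j) (A j) u \<union> (\<lambda>i. i + k) ` side_zeros k (d j) (B j) u" (is "?L = ?R")
    proof (intro equalityI subsetI)
      fix v assume v: "v \<in> ?L"
      show "v \<in> ?R"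
      proof (cases "v < k")
        case True
        then show ?thesis using v by (simp add: vec_def side_zeros_def)
      next
        case False
        then have "v - k \<in> side_zeros k (d j) (B j) u" using v by (auto simp: vec_def side_zeros_def)
        moreover have "v = v - k + k" using False by simp
        ultimately show ?thesis by blast
      qed
    next
      fix v assume "v \<in> ?R"
      then show "v \<in> ?L" by (auto simp: vec_def side_zeros_def)
    qed
    also have "card \<dots> \<le> card (side_zeros k (d j) (A j) u) + card ((\<lambda>i. i + k) ` side_zeros k (d j) (B j) u)"
      by (rule card_Un_le)
    also have "\<dots> = card (side_zeros k (d j) (A j) u) + card (side_zeros k (d j) (B j) u)"
      by (simp add: card_image inj_on_def)
    also have "\<dots> \<le> (if j < q then d j - 1 else d j)"
    proof (cases "j < q")
      case True
      then show ?thesis using ab[OF True] u by (simp add: A_def B_def)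
    next
      case False
      then have "j = q" using j by simp
      then show ?thesis using ef(4) u by (simp add: A_def B_def)
    qed
    finally show ?thesis .
  qed
  define r where "r v j = sqrt (\<Sum>t<d j. (norm (vec v j t))\<^sup>2)" for v j
  have r: "r v j > 0" if "j \<le> q" for v j
    unfolding r_def real_sqrt_gt_0_iff
    by (rule sum_pos2[of _ 0]) (use d0[OF that] vec0 in auto)
  define h where "h v j t = vec v j t / of_real (r v j)" for v j t
  have h_inner: "(\<Sum>t<d j. x t * cnj (h v j t)) = (\<Sum>t<d j. x t * cnj (vec v j t)) / of_real (r v j)" for x v j
    by (simp add: h_def sum_divide_distrib)
  have h_unit: "(\<Sum>t<d j. h v j t * cnj (h v j t)) = 1" if "j \<le> q" for v j
  proof -
    have "(\<Sum>t<d j. vec v j t * cnj (vec v j t)) = of_real (\<Sum>t<d j. (norm (vec v j t))\<^sup>2)"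
      by (simp add: complex_norm_square[symmetric])
    also have "\<dots> = of_real ((r v j)\<^sup>2)" unfolding r_def by (simp add: sum_nonneg)
    finally have "(\<Sum>t<d j. vec v j t * cnj (vec v j t)) = (of_real (r v j))\<^sup>2" by simp
    moreover have "(\<Sum>t<d j. h v j t * cnj (h v j t)) = (\<Sum>t<d j. vec v j t * cnj (vec v j t)) / (of_real (r v j))\<^sup>2"
      by (simp add: h_def sum_divide_distrib power2_eq_square)
    ultimately show ?thesis using r[OF that, of v] by simp
  qed
  have h_zero: "(\<Sum>t<d j. x t * cnj (h v j t)) = 0 \<longleftrightarrow> (\<Sum>t<d j. x t * cnj (vec v j t)) = 0" if "j \<le> q" for x v j
    unfolding h_inner using r[OF that, of v] by simp
  define X where "X v = prod_tensor (Suc q) d (h v)" for v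
  have X_unit: "tinner (Suc q) d (X v) (X v) = 1" for v
    unfolding X_def tinner_prod_tensor by (intro prod.neutral) (auto simp: h_unit)
  have X_orth: "tinner (Suc q) d (X v) (X v') = 0" if vv: "v < 2 * k" "v' < 2 * k" "v \<noteq> v'" for v v'
  proof -
    obtain j where j: "j \<le> q" "(\<Sum>t<d j. vec v j t * cnj (vec v' j t)) = 0" using orth[OF vv] by blast
    have "(\<Sum>t<d j. h v j t * cnj (vec v' j t)) = 0"
      using j(2) by (simp add: h_def sum_divide_distrib[symmetric])
    then have "(\<Sum>t<d j. h v j t * cnj (h v' j t)) = 0" using h_zero[OF j(1)] by blast
    then show ?thesis unfolding X_def tinner_prod_tensor using j(1) by (intro prod_zero) auto
  qed
  have X_prod: "is_product_vector (Suc q) d (X v)" for v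
    unfolding X_def is_product_vector_prod_tensor
  proof (intro allI impI)
    fix j assume "j < Suc q"
    then have "j \<le> q" by simp
    then show "\<exists>t<d j. h v j t \<noteq> 0"
      using vec0 r[of j v] d0[of j] by (intro exI[of _ 0]) (auto simp: h_def)
  qed
  have inj: "inj_on X {..<2 * k}"
  proof (rule inj_onI, rule ccontr)
    fix v v' assume "v \<in> {..<2 * k}" "v' \<in> {..<2 * k}" "X v = X v'" "v \<noteq> v'"
    then show False using X_orth[of v v'] X_unit[of v] by auto
  qed
  have "is_UPB (Suc q) d (X ` {..<2 * k})" unfolding is_UPB_def
  proof (intro conjI ballI impI allI notI)
    fix y assume y: "is_product_vector (Suc q) d y \<and> y \<notin> X ` {..<2 * k}"
      and yS: "\<forall>s\<in>X ` {..<2 * k}. tinner (Suc q) d y s = 0"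
    obtain u where u: "y = prod_tensor (Suc q) d u" using y by (auto simp: is_product_vector_def)
    have unz: "\<exists>t<d j. u j t \<noteq> 0" if "j \<le> q" for j
      using y that unfolding u is_product_vector_prod_tensor by auto
    have "{..<2 * k} \<subseteq> (\<Union>j<Suc q. {v. v < 2 * k \<and> (\<Sum>t<d j. u j t * cnj (vec v j t)) = 0})"
    proof
      fix v assume v: "v \<in> {..<2 * k}"
      then have "tinner (Suc q) d y (X v) = 0" using yS by blast
      then have "\<exists>j<Suc q. (\<Sum>t<d j. u j t * cnj (h v j t)) = 0"
        unfolding u X_def tinner_prod_tensor prod_zero_iff[OF finite_lessThan] by auto
      then obtain j where "j \<le> q" "(\<Sum>t<d j. u j t * cnj (vec v j t)) = 0"
        using h_zero less_Suc_eq_le by blast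
      then show "v \<in> (\<Union>j<Suc q. {v. v < 2 * k \<and> (\<Sum>t<d j. u j t * cnj (vec v j t)) = 0})"
        using v by auto
    qed
    then have "card {..<2 * k} \<le> card (\<Union>j<Suc q. {v. v < 2 * k \<and> (\<Sum>t<d j. u j t * cnj (vec v j t)) = 0})"
      by (rule card_mono[rotated]) auto
    also have "\<dots> \<le> (\<Sum>j<Suc q. card {v. v < 2 * k \<and> (\<Sum>t<d j. u j t * cnj (vec v j t)) = 0})"
      by (rule card_UN_le) simp
    also have "\<dots> \<le> (\<Sum>j<Suc q. if j < q then d j - 1 else d j)"
      by (rule sum_mono) (use zeros unz in auto)
    also have "\<dots> = n + d q" by (simp add: n(1))
    finally show False using k(1) by simp
  qed (use X_unit X_orth X_prod in auto)
  moreover have "card (X ` {..<2 * k}) = 2 * k" using inj by (simp add: card_image)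
  ultimately show ?thesis by blast
qed

theorem theorem1:
  fixes p :: nat and d :: "nat \<Rightarrow> nat"
  assumes "p \<ge> 2"
    and "\<forall>j<p. 2 \<le> d j"
    and "\<forall>j. Suc j < p \<longrightarrow> d j \<le> d (Suc j)"
    and "d (p - 1) - 1 \<ge> (\<Sum>j<p - 1. d j - 1)"
    and "(\<Sum>j<p - 1. d j - 1) \<ge> 3"
    and "\<not> (p = 2 \<and> min (d 0) (d 1) = 2)"
    and "odd (f_N p d)"
    and "\<exists>j<p. even (d j)"
  shows "f_m p d = f_N p d + 1"
proof -
  obtain q where q: "p = Suc q" using assms(1) by (cases p) auto
  define n where "n = (\<Sum>j<q. d j - 1)"
  have d: "\<And>j. j \<le> q \<Longrightarrow> 2 \<le> d j" using assms(2) by (auto simp: q)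
  have n: "n \<ge> 3" "n \<le> d q - 1" using assms(4,5) by (auto simp: q n_def)
  have fN: "f_N p d = n + d q" using d[of q] by (simp add: f_N_def q n_def)
  then have "even (n + d q + 1)" using assms(7) by simp
  then obtain k where k: "n + d q + 1 = 2 * k" by (rule evenE)
  \<comment> \<open>The last dimension dominates: \<open>n <= d q - 1\<close> gives
    \<open>2 * k >= 2 * n + 2\<close>.\<close>
  have nk: "n < k" using k n d[of q] by linarith
  obtain S where S: "is_UPB p d S" "card S = 2 * k"
    using UPB_exists[OF d n_def n(1) k[symmetric] nk] by (auto simp: q)
  show ?thesis unfolding f_m_def
  proof (rule Least_equality)
    show "\<exists>S. is_UPB p d S \<and> card S = f_N p d + 1" using S k fN by auto
    fix y assume "\<exists>S. is_UPB p d S \<and> card S = y"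
    then show "f_N p d + 1 \<le> y" using UPB_card_gt[of p d] assms(2,7,8) by blast
  qed
qed

end
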